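(* Let $F_\varepsilon$ be an analytic (or $C^\infty$, or formal) family of area-preserving maps defined in a neighbourhood of the origin of $\mathbb{R}^2$ such that $F_0(0)=0$, and $DF_0(0)$ has the double eigenvalue $1$ and is not diagonalisable. Then there is a canonical formal change of variables $\psi_\varepsilon$ such that $F_\varepsilon=\psi_\varepsilon^{-1}\circ\Phi^1_{g_\varepsilon}\circ\psi_\varepsilon$ with $$g_\varepsilon(x,y)=\frac{y^2}{2}+\sum_{k+3m\ge3}u^{0}_{km}x^k\varepsilon^m .$$ Suppose that, for such a Hamiltonian $g_\varepsilon$, there is $n\ge3$ such that $u^0_{k0}=0$ for all $k<n$ and $b:=u^0_{n0}\neq0$. Then there exists a canonical formal change of variables $\phi_\varepsilon$ such that $F_\varepsilon=\phi_\varepsilon^{-1}\circ\Phi^1_{h_\varepsilon}\circ\phi_\varepsilon$ with $$h_\varepsilon(x,y)=\frac{y^2}{2}+U_\varepsilon(x),\qquad U_\varepsilon(x)=bx^n+\sum_{\substack{k+nm>n\\ k\not\equiv-1 \ (\mathrm{mod}\ n)}}u_{km}x^k\varepsilon^m .$$ The coefficients of the series are defined uniquely by the map $F_\varepsilon$.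
   Context: The family $F_\varepsilon$ depends on a small parameter $\varepsilon$ and preserves both area and orientation. It is identified with its Taylor series at $(x,y,\varepsilon)=(0,0,0)$; all conjugacy identities are identities of formal power series with real coefficients. All summation indices are non-negative integers. A canonical formal change of variables is a pair of formal power series in $(x,y,\varepsilon)$, with zero constant term, whose Jacobian determinant with respect to $(x,y)$ is identically $1$ or identically $-1$ (a reflection of the orientation is allowed). Compositions are in $(x,y)$, with $\varepsilon$ as a parameter. For formal series, $\{f,g\}=\partial_xf\,\partial_yg-\partial_yf\,\partial_xg$ and $L_\chi g=\{g,\chi\}$. The formal time-one map of a formal Hamiltonian $\chi$ is $\Phi^1_\chi(x,y)=(\exp(L_\chi)x,\exp(L_\chi)y)$, where $\exp(L_\chi)g=\sum_{k\ge0}\frac1{k!}L_\chi^kg$. For the Hamiltonians $g_\varepsilon$ and $h_\varepsilon$ above this is well defined coefficient by coefficient (assign orders $2,3,6$ to $x,y,\varepsilon$; all monomials that are non-constant in $(x,y)$ then have order at least $6$).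
   Formalization: Uniqueness is proved for coefficients with k≥1, up to (x,y)→(−x,−y), which sends b to σⁿb and u_{km} to σᵏu_{km}, σ=±1. Literal uniqueness fails: u_{0m} does not affect the map, and for n=4, y²/2+x⁴+εx and y²/2+x⁴−εx give conjugate maps. *)

theory Defs
  imports
    "HOL-Computational_Algebra.Formal_Power_Series"
    "HOL-Number_Theory.Cong"
    "Jordan_Normal_Form.Char_Poly"
begin

section \<open>Formal power series in x, y and the parameter\<close>

text \<open>
  The ring of real formal power series in \<open>(x, y, \<epsilon>)\<close> is the iterated power series ring, with
  \<open>x\<close> the outermost and \<open>\<epsilon>\<close> the innermost variable.
\<close>

type_synonym series = "real fps fps fps"

definition coef :: "series \<Rightarrow> nat \<Rightarrow> nat \<Rightarrow> nat \<Rightarrow> real" where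
  "coef f i j m = fps_nth (fps_nth (fps_nth f i) j) m"

definition mk_series :: "(nat \<Rightarrow> nat \<Rightarrow> nat \<Rightarrow> real) \<Rightarrow> series" where
  "mk_series c = Abs_fps (\<lambda>i. Abs_fps (\<lambda>j. Abs_fps (\<lambda>m. c i j m)))"

definition cst :: "real \<Rightarrow> series" where
  "cst c = fps_const (fps_const (fps_const c))"

definition var_x :: series where "var_x = fps_X"
definition var_y :: series where "var_y = fps_const fps_X"
definition var_eps :: series where "var_eps = fps_const (fps_const fps_X)"

definition diff_x :: "series \<Rightarrow> series" where
  "diff_x f = fps_deriv f"

definition diff_y :: "series \<Rightarrow> series" where
  "diff_y f = Abs_fps (\<lambda>i. fps_deriv (fps_nth f i))"

lemma coef_mk_series [simp]: "coef (mk_series c) i j m = c i j m"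
  by (simp add: coef_def mk_series_def)

lemma series_eqI: "(\<And>i j m. coef f i j m = coef g i j m) \<Longrightarrow> f = g"
  by (simp add: coef_def fps_eq_iff)


section \<open>Formal maps of the plane depending on the parameter\<close>

type_synonym fmap = "series \<times> series"

definition id_map :: fmap where
  "id_map = (var_x, var_y)"

definition zero_const :: "fmap \<Rightarrow> bool" where
  "zero_const \<phi> \<longleftrightarrow> coef (fst \<phi>) 0 0 0 = 0 \<and> coef (snd \<phi>) 0 0 0 = 0"

definition jacobian :: "fmap \<Rightarrow> series" where
  "jacobian \<phi> = diff_x (fst \<phi>) * diff_y (snd \<phi>) - diff_y (fst \<phi>) * diff_x (snd \<phi>)"

definition linear_part :: "fmap \<Rightarrow> real mat" where
  "linear_part \<phi> = mat_of_rows_list 2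
     [[coef (diff_x (fst \<phi>)) 0 0 0, coef (diff_y (fst \<phi>)) 0 0 0],
      [coef (diff_x (snd \<phi>)) 0 0 0, coef (diff_y (snd \<phi>)) 0 0 0]]"

text \<open>
  \<open>subst f \<phi>\<close> is \<open>f(\<phi>\<^sub>1, \<phi>\<^sub>2, \<epsilon>) = \<Sum> f\<^sub>p\<^sub>q\<^sub>r \<phi>\<^sub>1\<^sup>p \<phi>\<^sub>2\<^sup>q \<epsilon>\<^sup>r\<close>, for \<open>\<phi>\<close> with zero constant term.
  Then \<open>\<phi>\<^sub>1\<^sup>p \<phi>\<^sub>2\<^sup>q \<epsilon>\<^sup>r\<close> has no monomials of total degree below \<open>p + q + r\<close>, so that the terms with
  \<open>p\<close>, \<open>q\<close> or \<open>r\<close> above \<open>i + j + m\<close>, left out below, do not contribute to the coefficient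
  of \<open>x\<^sup>i y\<^sup>j \<epsilon>\<^sup>m\<close>.
\<close>

definition subst :: "series \<Rightarrow> fmap \<Rightarrow> series" where
  "subst f \<phi> = mk_series (\<lambda>i j m.
     \<Sum>p\<le>i + j + m. \<Sum>q\<le>i + j + m. \<Sum>r\<le>i + j + m.
       coef f p q r * coef (fst \<phi> ^ p * snd \<phi> ^ q * var_eps ^ r) i j m)"

definition comp_map :: "fmap \<Rightarrow> fmap \<Rightarrow> fmap" (infixr "\<circ>\<^sub>f" 55) where
  "F \<circ>\<^sub>f \<phi> = (subst (fst F) \<phi>, subst (snd F) \<phi>)"

definition canonical :: "fmap \<Rightarrow> bool" where
  "canonical \<psi> \<longleftrightarrow> zero_const \<psi> \<and> (jacobian \<psi> = 1 \<or> jacobian \<psi> = - 1)"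

definition is_inverse :: "fmap \<Rightarrow> fmap \<Rightarrow> bool" where
  "is_inverse \<theta> \<psi> \<longleftrightarrow> zero_const \<theta> \<and> \<theta> \<circ>\<^sub>f \<psi> = id_map \<and> \<psi> \<circ>\<^sub>f \<theta> = id_map"

text \<open>\<open>conjugated_by \<psi> F G\<close> says that \<open>F = \<psi>\<^sup>-\<^sup>1 \<circ> G \<circ> \<psi>\<close>.\<close>

definition conjugated_by :: "fmap \<Rightarrow> fmap \<Rightarrow> fmap \<Rightarrow> bool" where
  "conjugated_by \<psi> F G \<longleftrightarrow> (\<exists>\<theta>. is_inverse \<theta> \<psi> \<and> F = \<theta> \<circ>\<^sub>f G \<circ>\<^sub>f \<psi>)"


section \<open>Formal time-one maps\<close>

definition bracket :: "series \<Rightarrow> series \<Rightarrow> series" where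
  "bracket f g = diff_x f * diff_y g - diff_y f * diff_x g"

definition lie :: "series \<Rightarrow> series \<Rightarrow> series" where
  "lie \<chi> g = bracket g \<chi>"

text \<open>
  The exponential series is summed coefficient by coefficient. For the Hamiltonians considered
  here only finitely many summands contribute to each coefficient; for other \<open>\<chi>\<close> the
  value need not be meaningful.
\<close>

definition exp_lie :: "series \<Rightarrow> series \<Rightarrow> series" where
  "exp_lie \<chi> g = mk_series (\<lambda>i j m. \<Sum>k. coef ((lie \<chi> ^^ k) g) i j m / fact k)"

definition time_one :: "series \<Rightarrow> fmap" where
  "time_one \<chi> = (exp_lie \<chi> var_x, exp_lie \<chi> var_y)"


section \<open>The Hamiltonians\<close>

text \<open>\<open>potential S u\<close> is \<open>\<Sum> u\<^sub>k\<^sub>m x\<^sup>k \<epsilon>\<^sup>m\<close>, summed over \<open>(k, m) \<in> S\<close>.\<close>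

definition potential :: "(nat \<times> nat) set \<Rightarrow> (nat \<Rightarrow> nat \<Rightarrow> real) \<Rightarrow> series" where
  "potential S u = mk_series (\<lambda>k j m. if j = 0 \<and> (k, m) \<in> S then u k m else 0)"

definition g_index :: "(nat \<times> nat) set" where
  "g_index = {(k, m). k + 3 * m \<ge> 3}"

definition g_ham :: "(nat \<Rightarrow> nat \<Rightarrow> real) \<Rightarrow> series" where
  "g_ham u = cst (1/2) * var_y ^ 2 + potential g_index u"

definition h_index :: "nat \<Rightarrow> (nat \<times> nat) set" where
  "h_index n = {(k, m). k + n * m > n \<and> \<not> [int k = - 1] (mod int n)}"

definition h_ham :: "nat \<Rightarrow> real \<Rightarrow> (nat \<Rightarrow> nat \<Rightarrow> real) \<Rightarrow> series" where
  "h_ham n b u =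
     cst (1/2) * var_y ^ 2 + (cst b * var_x ^ n + potential (h_index n) u)"


section \<open>Diagonalisability\<close>

definition diagonalisable :: "real mat \<Rightarrow> bool" where
  "diagonalisable A \<longleftrightarrow> (\<exists>D. diagonal_mat D \<and> similar_mat A D)"

end

theory Submission
  imports Defs
begin

text \<open>
  Give \<open>x\<close>, \<open>y\<close>, \<open>\<epsilon>\<close> the weights \<open>2\<close>, \<open>n\<close>, \<open>2n\<close>; then \<open>y\<^sup>2/2 + b x\<^sup>n\<close> is homogeneous and bracketing
  with a Hamiltonian of order above \<open>n + 2\<close> raises the order. After a linear change \<open>F\<close> is the
  identity up to higher order in the weights with \<open>n = 3\<close>, and an interpolating Hamiltonian is found
  one order at a time, because the leading difference of two area-preserving maps is
  divergence-free. The bracket with \<open>y\<^sup>2/2 + b x\<^sup>n\<close> reaches all monomials divisible by \<open>y\<close> and, for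
  \<open>b \<noteq> 0\<close>, the powers \<open>x\<^sup>k\<close> with \<open>k \<equiv> -1 (mod n)\<close>, so these can be removed. For uniqueness, a canonical
  map between two normal forms has a shear, up to sign, as linear part; after composing with the
  sign it is the time-one map of a Hamiltonian \<open>\<chi>\<close> that takes one normal form to
  the other. The leading part of \<open>\<chi>\<close> must commute with \<open>y\<^sup>2/2 + b
  x\<^sup>n\<close>, and subtracting the corresponding function of the Hamiltonian raises the order
  of \<open>\<chi>\<close> indefinitely.
\<close>

text \<open>With weight \<open>2 * n\<close> for the parameter, every monomial divisible by
  \<epsilon> and by x or y lies above the leading weight, whatever its coefficient; only pure powers
  of \<epsilon> can interfere, and they do not affect the maps. A bracket costs
  \<open>n + 2\<close>, the joint weight of x and y, so Hamiltonians of order \<open>n + 3\<close>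
  have summable exponentials; for the normal forms, of order \<open>2 * n\<close>, this amounts to n
  \<ge> 3. The obstacle in the uniqueness part is that two weight systems are involved. Normal forms
  with unknown exponents n and n' are compared in the weights for 3, while raising the order of
  \<chi> takes place in the weights for n. There a monomial x^r in the second component of the
  conjugating map may weigh less than y. Such monomials have to be excluded by comparing
  coefficients of the two Hamiltonians, which also yields n = n'.\<close>

declare One_nat_def [simp del]

section \<open>Coefficients\<close>

lemma coef_add [simp]: "coef (f + g) i j m = coef f i j m + coef g i j m"
  and coef_diff [simp]: "coef (f - g) i j m = coef f i j m - coef g i j m"
  and coef_uminus [simp]: "coef (- f) i j m = - coef f i j m"
  and coef_zero [simp]: "coef 0 i j m = 0"
  and coef_cst_mult [simp]: "coef (cst c * f) i j m = c * coef f i j m"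
  by (simp_all add: coef_def cst_def)

lemma coef_sum [simp]: "coef (\<Sum>a\<in>A. f a) i j m = (\<Sum>a\<in>A. coef (f a) i j m)"
  by (simp add: coef_def fps_sum_nth)

lemma coef_mult:
  "coef (f * g) i j m =
    (\<Sum>p\<le>i. \<Sum>q\<le>j. \<Sum>r\<le>m. coef f p q r * coef g (i - p) (j - q) (m - r))"
  by (simp add: coef_def fps_mult_nth fps_sum_nth atLeast0AtMost)

lemma cst_0 [simp]: "cst 0 = 0" and cst_1 [simp]: "cst 1 = 1"
  and cst_add: "cst (a + b) = cst a + cst b"
  and cst_diff: "cst (a - b) = cst a - cst b"
  and cst_uminus: "cst (- a) = - cst a"
  and cst_mult: "cst (a * b) = cst a * cst b"
  by (simp_all add: cst_def fps_const_neg[symmetric] del: fps_const_neg)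

lemma cst_of_nat: "cst (of_nat k) = of_nat k"
  by (induction k) (simp_all add: cst_add)

lemma cst_numeral: "cst (numeral k) = numeral k"
  using cst_of_nat[of "numeral k"] by simp

lemma cst_power: "cst (a ^ k) = cst a ^ k"
  by (induction k) (simp_all add: cst_mult)

lemma coef_cst: "coef (cst c) i j m = (if i = 0 \<and> j = 0 \<and> m = 0 then c else 0)"
  by (simp add: coef_def cst_def)

lemma coef_1: "coef 1 i j m = (if i = 0 \<and> j = 0 \<and> m = 0 then 1 else 0)"
  using coef_cst[of 1] by simp

lemma coef_x_mult [simp]: "coef (var_x * f) i j m = (if i = 0 then 0 else coef f (i - 1) j m)"
  by (cases i) (simp_all add: coef_def var_x_def)

lemma coef_y_mult [simp]: "coef (var_y * f) i j m = (if j = 0 then 0 else coef f i (j - 1) m)"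
  by (cases j) (simp_all add: coef_def var_y_def)

lemma coef_eps_mult [simp]:
  "coef (var_eps * f) i j m = (if m = 0 then 0 else coef f i j (m - 1))"
  by (cases m) (simp_all add: coef_def var_eps_def)

lemma coef_diff_x [simp]: "coef (diff_x f) i j m = real (i + 1) * coef f (i + 1) j m"
proof -
  have "fps_nth (of_nat k * g) j = of_nat k * fps_nth g j" for k j and g :: "'a::comm_ring_1 fps"
    by (induction k) (simp_all add: algebra_simps)
  then show ?thesis
    by (simp add: coef_def diff_x_def del: of_nat_Suc of_nat_add)
qed

lemma coef_diff_y [simp]: "coef (diff_y f) i j m = real (j + 1) * coef f i (j + 1) m"
proof -
  have "fps_nth (of_nat k * g) j = of_nat k * fps_nth g j" for k j and g :: "'a::comm_ring_1 fps"
    by (induction k) (simp_all add: algebra_simps)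
  then show ?thesis
    by (simp add: coef_def diff_y_def del: of_nat_Suc of_nat_add)
qed

definition monomial :: "nat \<Rightarrow> nat \<Rightarrow> nat \<Rightarrow> series" where
  "monomial p q r = var_x ^ p * var_y ^ q * var_eps ^ r"

lemma monomial_0 [simp]: "monomial 0 0 0 = 1"
  by (simp add: monomial_def)

lemma monomial_mult: "monomial p q r * monomial p' q' r' = monomial (p + p') (q + q') (r + r')"
  by (simp add: monomial_def power_add ac_simps)

lemma var_x_monomial: "var_x = monomial 1 0 0"
  and var_y_monomial: "var_y = monomial 0 1 0"
  and var_eps_monomial: "var_eps = monomial 0 0 1"
  by (simp_all add: monomial_def)

lemma coef_monomial_mult:
  "coef (monomial p q r * f) i j m =
    (if p \<le> i \<and> q \<le> j \<and> r \<le> m then coef f (i - p) (j - q) (m - r) else 0)"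
proof -
  have e: "coef (var_eps ^ r * f) i j m = (if r \<le> m then coef f i j (m - r) else 0)" for f i j m
    by (induction r arbitrary: m) (auto simp: mult.assoc One_nat_def)
  have y: "coef (var_y ^ q * f) i j m = (if q \<le> j then coef f i (j - q) m else 0)" for f i j m
    by (induction q arbitrary: j) (auto simp: mult.assoc One_nat_def)
  have x: "coef (var_x ^ p * f) i j m = (if p \<le> i then coef f (i - p) j m else 0)" for f i j m
    by (induction p arbitrary: i) (auto simp: mult.assoc One_nat_def)
  show ?thesis
    by (simp add: monomial_def mult.assoc x y e)
qed

lemma coef_monomial: "coef (monomial p q r) i j m = (if i = p \<and> j = q \<and> m = r then 1 else 0)"
  using coef_monomial_mult[of p q r 1 i j m] by (auto simp: coef_1)

lemma coef_var_x: "coef var_x i j m = (if i = 1 \<and> j = 0 \<and> m = 0 then 1 else 0)"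
  and coef_var_y: "coef var_y i j m = (if i = 0 \<and> j = 1 \<and> m = 0 then 1 else 0)"
  and coef_var_eps: "coef var_eps i j m = (if i = 0 \<and> j = 0 \<and> m = 1 then 1 else 0)"
  by (auto simp: var_x_monomial var_y_monomial var_eps_monomial coef_monomial)

lemma coef_potential:
  "coef (potential S u) i j m = (if j = 0 \<and> (i, m) \<in> S then u i m else 0)"
  by (simp add: potential_def)


section \<open>Weighted orders\<close>

text \<open>The weights are arguments because several gradings occur: total degree for convergence,
  \<open>(2, n, 2 * n)\<close> for the normal form, and gradings chosen so that one selected
  monomial of a series becomes leading.\<close>

definition ord_ge :: "nat \<Rightarrow> nat \<Rightarrow> nat \<Rightarrow> nat \<Rightarrow> series \<Rightarrow> bool" where
  "ord_ge a b c N f \<longleftrightarrow> (\<forall>i j m. a * i + b * j + c * m < N \<longrightarrow> coef f i j m = 0)"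

lemma ord_geD: "ord_ge a b c N f \<Longrightarrow> a * i + b * j + c * m < N \<Longrightarrow> coef f i j m = 0"
  by (auto simp: ord_ge_def)

lemma ord_ge_mono_le: "ord_ge a b c N f \<Longrightarrow> M \<le> N \<Longrightarrow> ord_ge a b c M f"
  by (auto simp: ord_ge_def)

lemma ord_ge_trivial [simp]: "ord_ge a b c 0 f"
  by (simp add: ord_ge_def)

lemma ord_ge_zero [simp]: "ord_ge a b c N 0"
  by (simp add: ord_ge_def)

lemma ord_ge_add: "ord_ge a b c N f \<Longrightarrow> ord_ge a b c N g \<Longrightarrow> ord_ge a b c N (f + g)"
  and ord_ge_diff: "ord_ge a b c N f \<Longrightarrow> ord_ge a b c N g \<Longrightarrow> ord_ge a b c N (f - g)"
  and ord_ge_uminus: "ord_ge a b c N f \<Longrightarrow> ord_ge a b c N (- f)"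
  and ord_ge_cst_mult: "ord_ge a b c N f \<Longrightarrow> ord_ge a b c N (cst t * f)"
  by (simp_all add: ord_ge_def)

lemma ord_ge_sum: "(\<And>k. k \<in> A \<Longrightarrow> ord_ge a b c N (f k)) \<Longrightarrow> ord_ge a b c N (sum f A)"
  by (simp add: ord_ge_def)

lemma ord_ge_mult:
  assumes "ord_ge a b c N f" "ord_ge a b c M g"
  shows "ord_ge a b c (N + M) (f * g)"
  unfolding ord_ge_def
proof (intro allI impI)
  fix i j m
  assume lt: "a * i + b * j + c * m < N + M"
  have "coef f p q r * coef g (i - p) (j - q) (m - r) = 0" if "p \<le> i" "q \<le> j" "r \<le> m" for p q r
  proof -
    have "a * i = a * p + a * (i - p)" "b * j = b * q + b * (j - q)" "c * m = c * r + c * (m - r)"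
      using that by (simp_all flip: distrib_left)
    with lt have "a * p + b * q + c * r < N \<or> a * (i - p) + b * (j - q) + c * (m - r) < M"
      by linarith
    then show ?thesis
      using assms by (auto simp: ord_ge_def)
  qed
  then show "coef (f * g) i j m = 0"
    unfolding coef_mult by (intro sum.neutral ballI) simp
qed

lemma ord_ge_mult_left: "ord_ge a b c N f \<Longrightarrow> ord_ge a b c N (g * f)"
  using ord_ge_mult[of a b c 0 g N f] by simp

lemma ord_ge_power: "ord_ge a b c N f \<Longrightarrow> ord_ge a b c (N * k) (f ^ k)"
  by (induction k) (auto dest: ord_ge_mult)

lemma ord_ge_monomial: "N \<le> a * p + b * q + c * r \<Longrightarrow> ord_ge a b c N (monomial p q r)"
  by (auto simp: ord_ge_def coef_monomial)

lemma ord_ge_var_x: "ord_ge a b c a var_x"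
  and ord_ge_var_y: "ord_ge a b c b var_y"
  and ord_ge_var_eps: "ord_ge a b c c var_eps"
  by (simp_all add: var_x_monomial var_y_monomial var_eps_monomial ord_ge_monomial)

lemma ord_ge_diff_x: "ord_ge a b c N f \<Longrightarrow> ord_ge a b c (N - a) (diff_x f)"
  and ord_ge_diff_y: "ord_ge a b c N f \<Longrightarrow> ord_ge a b c (N - b) (diff_y f)"
  by (auto simp: ord_ge_def less_diff_conv algebra_simps)

abbreviation deg_ge :: "nat \<Rightarrow> series \<Rightarrow> bool" where
  "deg_ge \<equiv> ord_ge 1 1 1"

lemma deg_ge_1_iff: "deg_ge 1 f \<longleftrightarrow> coef f 0 0 0 = 0"
  by (simp add: ord_ge_def)

lemma zero_const_iff: "zero_const \<phi> \<longleftrightarrow> deg_ge 1 (fst \<phi>) \<and> deg_ge 1 (snd \<phi>)"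
  by (simp add: deg_ge_1_iff zero_const_def)

text \<open>A monomial of degree d has weight at most \<open>D * d\<close>. Together with the
  converse estimate below, all gradings with positive weights define the same topology.\<close>

lemma ord_ge_imp_deg_ge:
  assumes "ord_ge a b c (D * N) f" "a \<le> D" "b \<le> D" "c \<le> D" "D > 0"
  shows "deg_ge N f"
  unfolding ord_ge_def
proof (intro allI impI)
  fix i j m
  assume lt: "1 * i + 1 * j + 1 * m < N"
  then have "D * (i + j + m) < D * N"
    using assms by simp
  moreover have "a * i + b * j + c * m \<le> D * (i + j + m)"
    using assms(2-4) by (simp add: distrib_left add_mono mult_le_mono1)
  ultimately show "coef f i j m = 0"
    using ord_geD[OF assms(1), of i j m] by linarith
qed

lemma deg_ge_imp_ord_ge:
  assumes "deg_ge N f" "a > 0" "b > 0" "c > 0"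
  shows "ord_ge a b c N f"
  unfolding ord_ge_def
proof (intro allI impI)
  fix i j m
  assume lt: "a * i + b * j + c * m < N"
  have "i \<le> a * i" "j \<le> b * j" "m \<le> c * m"
    using assms by auto
  then have "i + j + m < N"
    using lt by linarith
  then show "coef f i j m = 0"
    using assms(1) by (simp add: ord_ge_def)
qed

lemma deg_ge_all_imp_zero: "(\<And>N. deg_ge N f) \<Longrightarrow> f = 0"
  by (rule series_eqI) (metis ord_ge_def coef_zero lessI)

section \<open>Continuous linear operators\<close>

text \<open>Linearity is over the reals. Continuity refers to total degree, and \<open>M\<close> may
  exceed \<open>N\<close>: differentiation loses a degree, and exponentials of Lie derivatives are
  controlled in weighted order, not in degree.\<close>

definition cont_lin :: "(series \<Rightarrow> series) \<Rightarrow> bool" where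
  "cont_lin A \<longleftrightarrow> (\<forall>f g. A (f + g) = A f + A g) \<and> (\<forall>c f. A (cst c * f) = cst c * A f) \<and>
     (\<forall>N. \<exists>M. \<forall>f. deg_ge M f \<longrightarrow> deg_ge N (A f))"

lemma cont_linI:
  assumes "\<And>f g. A (f + g) = A f + A g" "\<And>c f. A (cst c * f) = cst c * A f"
    "\<And>N. \<exists>M. \<forall>f. deg_ge M f \<longrightarrow> deg_ge N (A f)"
  shows "cont_lin A"
  using assms by (simp add: cont_lin_def)

lemma cont_lin_add: "cont_lin A \<Longrightarrow> A (f + g) = A f + A g"
  and cont_lin_cst: "cont_lin A \<Longrightarrow> A (cst c * f) = cst c * A f"
  by (simp_all add: cont_lin_def)

lemma cont_lin_0: "cont_lin A \<Longrightarrow> A 0 = 0"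
  using cont_lin_cst[of A 0 0] by simp

lemma cont_lin_uminus: "cont_lin A \<Longrightarrow> A (- f) = - A f"
  using cont_lin_cst[of A "- 1" f] by (simp add: cst_uminus)

lemma cont_lin_diff: "cont_lin A \<Longrightarrow> A (f - g) = A f - A g"
  using cont_lin_add[of A f "- g"] by (simp add: cont_lin_uminus)

lemma cont_lin_sum: "cont_lin A \<Longrightarrow> A (sum f S) = (\<Sum>k\<in>S. A (f k))"
  by (induction S rule: infinite_finite_induct) (simp_all add: cont_lin_0 cont_lin_add)

lemma cont_lin_comp: "cont_lin A \<Longrightarrow> cont_lin B \<Longrightarrow> cont_lin (\<lambda>f. A (B f))"
  unfolding cont_lin_def by metis

lemma cont_lin_plus:
  assumes A: "cont_lin A" and B: "cont_lin B"
  shows "cont_lin (\<lambda>f. A f + B f)"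
proof (rule cont_linI)
  fix N
  obtain M M' where "\<forall>f. deg_ge M f \<longrightarrow> deg_ge N (A f)" "\<forall>f. deg_ge M' f \<longrightarrow> deg_ge N (B f)"
    using A B unfolding cont_lin_def by meson
  then show "\<exists>M. \<forall>f. deg_ge M f \<longrightarrow> deg_ge N (A f + B f)"
    by (intro exI[of _ "max M M'"]) (auto intro!: ord_ge_add dest: ord_ge_mono_le[OF _ max.cobounded1]
        ord_ge_mono_le[OF _ max.cobounded2])
qed (simp_all add: cont_lin_add[OF A] cont_lin_add[OF B] cont_lin_cst[OF A] cont_lin_cst[OF B]
       distrib_left add_ac)

lemma cont_lin_mult: "cont_lin (\<lambda>f. g * f)"
  by (rule cont_linI) (auto simp: distrib_left mult.left_commute intro: ord_ge_mult_left)

lemma cont_lin_mult': "cont_lin (\<lambda>f. f * g)"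
  using cont_lin_mult[of g] by (simp add: mult.commute)

lemma cont_lin_diff_x: "cont_lin diff_x"
proof (rule cont_linI)
  show "\<exists>M. \<forall>f. deg_ge M f \<longrightarrow> deg_ge N (diff_x f)" for N
    using ord_ge_diff_x[of 1 1 1 "N + 1"] by (intro exI[of _ "N + 1"]) simp
qed (rule series_eqI; simp add: distrib_left mult.left_commute)+

lemma cont_lin_diff_y: "cont_lin diff_y"
proof (rule cont_linI)
  show "\<exists>M. \<forall>f. deg_ge M f \<longrightarrow> deg_ge N (diff_y f)" for N
    using ord_ge_diff_y[of 1 1 1 "N + 1"] by (intro exI[of _ "N + 1"]) simp
qed (rule series_eqI; simp add: distrib_left mult.left_commute)+

lemmas diff_x_simps = cont_lin_add[OF cont_lin_diff_x] cont_lin_diff[OF cont_lin_diff_x]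
  cont_lin_uminus[OF cont_lin_diff_x] cont_lin_cst[OF cont_lin_diff_x] cont_lin_0[OF cont_lin_diff_x]

lemmas diff_y_simps = cont_lin_add[OF cont_lin_diff_y] cont_lin_diff[OF cont_lin_diff_y]
  cont_lin_uminus[OF cont_lin_diff_y] cont_lin_cst[OF cont_lin_diff_y] cont_lin_0[OF cont_lin_diff_y]

definition truncation :: "nat \<Rightarrow> series \<Rightarrow> series" where
  "truncation N f = (\<Sum>p<N. \<Sum>q<N. \<Sum>r<N. cst (coef f p q r) * monomial p q r)"

lemma sum_delta3:
  fixes g :: "nat \<Rightarrow> nat \<Rightarrow> nat \<Rightarrow> real"
  assumes "finite S"
  shows "(\<Sum>p\<in>S. \<Sum>q\<in>S. \<Sum>r\<in>S. if p = a \<and> q = b \<and> r = c then g p q r else 0) =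
    (if a \<in> S \<and> b \<in> S \<and> c \<in> S then g a b c else 0)"
proof -
  have r: "(\<Sum>r\<in>S. if p = a \<and> q = b \<and> r = c then g p q r else 0) =
      (if q = b then if p = a \<and> c \<in> S then g p q c else 0 else 0)" for p q
    by (cases "p = a"; cases "q = b") (simp_all add: assms)
  have q: "(\<Sum>q\<in>S. if q = b then if p = a \<and> c \<in> S then g p q c else 0 else 0) =
      (if p = a then if b \<in> S \<and> c \<in> S then g p b c else 0 else 0)" for p
    by (cases "p = a") (simp_all add: assms)
  show ?thesis
    unfolding r q by (simp add: assms)
qed

lemma coef_truncation:
  "coef (truncation N f) i j m = (if i < N \<and> j < N \<and> m < N then coef f i j m else 0)"
proof -
  have "coef (truncation N f) i j m =
    (\<Sum>p<N. \<Sum>q<N. \<Sum>r<N. if p = i \<and> q = j \<and> r = m then coef f p q r else 0)"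
    unfolding truncation_def coef_sum by (intro sum.cong refl) (simp add: coef_monomial)
  then show ?thesis
    by (simp add: sum_delta3)
qed

lemma deg_ge_truncation: "deg_ge N (f - truncation N f)"
  by (simp add: ord_ge_def coef_truncation)

text \<open>All identities for substitutions and time-one maps are checked on monomials and extended by
  continuity.\<close>

lemma cont_lin_eqI:
  assumes A: "cont_lin A" and B: "cont_lin B" and eq: "\<And>p q r. A (monomial p q r) = B (monomial p q r)"
  shows "A f = B f"
proof -
  have "deg_ge N (A f - B f)" for N
  proof -
    obtain M M' where M: "\<forall>f. deg_ge M f \<longrightarrow> deg_ge N (A f)" "\<forall>f. deg_ge M' f \<longrightarrow> deg_ge N (B f)"
      using A B unfolding cont_lin_def by meson
    define t where "t = truncation (max M M') f"
    have "A t = B t"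
      by (simp add: t_def truncation_def cont_lin_sum[OF A] cont_lin_sum[OF B]
          cont_lin_cst[OF A] cont_lin_cst[OF B] eq)
    then have "A f - B f = A (f - t) - B (f - t)"
      by (simp add: cont_lin_diff[OF A] cont_lin_diff[OF B])
    moreover have "deg_ge (max M M') (f - t)"
      unfolding t_def by (rule deg_ge_truncation)
    then have "deg_ge M (f - t)" "deg_ge M' (f - t)"
      by (auto intro: ord_ge_mono_le)
    ultimately show ?thesis
      using M by (simp add: ord_ge_diff)
  qed
  then show ?thesis
    using deg_ge_all_imp_zero by fastforce
qed

section \<open>Continuous derivations of the ring of series\<close>

definition derivation :: "(series \<Rightarrow> series) \<Rightarrow> bool" where
  "derivation D \<longleftrightarrow> cont_lin D \<and> (\<forall>f g. D (f * g) = D f * g + f * D g)"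

lemma derivationD: "derivation D \<Longrightarrow> cont_lin D"
  and derivation_mult: "derivation D \<Longrightarrow> D (f * g) = D f * g + f * D g"
  by (simp_all add: derivation_def)

lemma derivation_1: "derivation D \<Longrightarrow> D 1 = 0"
  using derivation_mult[of D 1 1] by simp

lemma derivation_power: "derivation D \<Longrightarrow> D (f ^ k) = of_nat k * f ^ (k - 1) * D f"
proof (induction k)
  case (Suc k)
  then show ?case
    by (cases k) (simp_all add: derivation_mult algebra_simps)
qed (simp add: derivation_1)

lemma derivation_diff_x: "derivation diff_x"
  by (simp add: derivation_def cont_lin_diff_x) (simp add: diff_x_def)

lemma derivation_diff_y: "derivation diff_y"
proof -
  have "diff_y (f * g) = diff_y f * g + f * diff_y g" for f g
    by (simp add: diff_y_def fps_eq_iff[of "Abs_fps _"] fps_mult_nth sum.distrib fps_deriv_sum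
        add.commute)
  then show ?thesis
    by (simp add: derivation_def cont_lin_diff_y)
qed

lemmas diff_x_mult = derivation_mult[OF derivation_diff_x]
lemmas diff_y_mult = derivation_mult[OF derivation_diff_y]

lemma diff_x_var [simp]: "diff_x var_x = 1" "diff_x var_y = 0" "diff_x var_eps = 0"
  by (rule series_eqI; auto simp: coef_var_x coef_var_y coef_var_eps coef_1)+

lemma diff_y_var [simp]: "diff_y var_x = 0" "diff_y var_y = 1" "diff_y var_eps = 0"
  by (rule series_eqI; auto simp: coef_var_x coef_var_y coef_var_eps coef_1)+

lemma diff_x_diff_y: "diff_x (diff_y f) = diff_y (diff_x f)"
  by (rule series_eqI) simp

lemma diff_cst [simp]: "diff_x (cst c) = 0" "diff_y (cst c) = 0"
  by (rule series_eqI; simp add: coef_cst)+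


section \<open>Substitution\<close>

lemma zero_const_power:
  assumes "zero_const \<phi>"
  shows "deg_ge (p + q + r) (fst \<phi> ^ p * snd \<phi> ^ q * var_eps ^ r)"
  using ord_ge_mult[OF ord_ge_mult[OF ord_ge_power[of 1 1 1 1 "fst \<phi>" p]
        ord_ge_power[of 1 1 1 1 "snd \<phi>" q]] ord_ge_power[OF ord_ge_var_eps[of 1 1 1], of r]] assms
  by (simp add: zero_const_iff)

text \<open>The definition stops the sums at \<open>i + j + m\<close>; a larger bound can be made to
  include the exponents of a given monomial, as \<open>subst_monomial\<close> requires.\<close>

lemma coef_subst:
  assumes "zero_const \<phi>" "i + j + m \<le> N"
  shows "coef (subst f \<phi>) i j m =
    (\<Sum>p\<le>N. \<Sum>q\<le>N. \<Sum>r\<le>N. coef f p q r * coef (fst \<phi> ^ p * snd \<phi> ^ q * var_eps ^ r) i j m)"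
proof -
  define t where "t = (\<lambda>p q r. coef f p q r * coef (fst \<phi> ^ p * snd \<phi> ^ q * var_eps ^ r) i j m)"
  let ?n = "i + j + m"
  have t: "t p q r = 0" if "p + q + r > ?n" for p q r
    using ord_geD[OF zero_const_power[OF assms(1)], of i j m p q r] that by (simp add: t_def)
  have sub: "{..?n} \<subseteq> {..N}"
    using assms(2) by simp
  have "(\<Sum>p\<le>?n. \<Sum>q\<le>?n. \<Sum>r\<le>?n. t p q r) = (\<Sum>p\<le>N. \<Sum>q\<le>N. \<Sum>r\<le>N. t p q r)"
    by (intro sum.mono_neutral_cong_left[OF _ sub] ballI sum.neutral) (simp_all add: t)
  then show ?thesis
    by (simp add: subst_def t_def)
qed

lemma ord_ge_subst:
  assumes "zero_const \<phi>" "ord_ge a b c a (fst \<phi>)" "ord_ge a b c b (snd \<phi>)" "ord_ge a b c N f"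
  shows "ord_ge a b c N (subst f \<phi>)"
  unfolding ord_ge_def
proof (intro allI impI)
  fix i j m
  assume lt: "a * i + b * j + c * m < N"
  have "coef f p q r * coef (fst \<phi> ^ p * snd \<phi> ^ q * var_eps ^ r) i j m = 0" for p q r
  proof (cases "a * p + b * q + c * r < N")
    case True
    then show ?thesis
      using assms(4) by (simp add: ord_ge_def)
  next
    case False
    have "ord_ge a b c (a * p + b * q + c * r) (fst \<phi> ^ p * snd \<phi> ^ q * var_eps ^ r)"
      by (intro ord_ge_mult ord_ge_power assms ord_ge_var_eps)
    then show ?thesis
      using False lt by (simp add: ord_ge_def)
  qed
  then show "coef (subst f \<phi>) i j m = 0"
    unfolding coef_subst[OF assms(1) order_refl] by (intro sum.neutral ballI) simp
qed

lemma deg_ge_subst: "zero_const \<phi> \<Longrightarrow> deg_ge N f \<Longrightarrow> deg_ge N (subst f \<phi>)"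
  by (rule ord_ge_subst) (simp_all add: zero_const_iff)

lemma cont_lin_subst: "zero_const \<phi> \<Longrightarrow> cont_lin (\<lambda>f. subst f \<phi>)"
proof (rule cont_linI)
  show "subst (f + g) \<phi> = subst f \<phi> + subst g \<phi>" for f g
    by (rule series_eqI) (simp add: subst_def sum.distrib distrib_right)
  show "subst (cst c * f) \<phi> = cst c * subst f \<phi>" for c f
    by (rule series_eqI) (simp add: subst_def sum_distrib_left mult.assoc)
  show "\<exists>M. \<forall>f. deg_ge M f \<longrightarrow> deg_ge N (subst f \<phi>)" if "zero_const \<phi>" for N
    using deg_ge_subst[OF that] by blast
qed

lemmas subst_add = cont_lin_add[OF cont_lin_subst]
lemmas subst_diff = cont_lin_diff[OF cont_lin_subst]
lemmas subst_uminus = cont_lin_uminus[OF cont_lin_subst]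
lemmas subst_sum = cont_lin_sum[OF cont_lin_subst]

lemma subst_monomial:
  assumes "zero_const \<phi>"
  shows "subst (monomial p q r) \<phi> = fst \<phi> ^ p * snd \<phi> ^ q * var_eps ^ r"
proof (rule series_eqI)
  fix i j m
  define N where "N = i + j + m + p + q + r"
  have le: "p \<le> N" "q \<le> N" "r \<le> N" "i + j + m \<le> N"
    by (auto simp: N_def)
  let ?t = "\<lambda>p q r. coef (fst \<phi> ^ p * snd \<phi> ^ q * var_eps ^ r) i j m"
  have "coef (subst (monomial p q r) \<phi>) i j m =
      (\<Sum>p'\<le>N. \<Sum>q'\<le>N. \<Sum>r'\<le>N. if p' = p \<and> q' = q \<and> r' = r then ?t p' q' r' else 0)"
    unfolding coef_subst[OF assms le(4)] by (intro sum.cong refl) (simp add: coef_monomial)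
  also have "\<dots> = ?t p q r"
    using le by (simp add: sum_delta3)
  finally show "coef (subst (monomial p q r) \<phi>) i j m = ?t p q r" .
qed

lemma subst_1 [simp]: "zero_const \<phi> \<Longrightarrow> subst 1 \<phi> = 1"
  using subst_monomial[of \<phi> 0 0 0] by simp

lemma subst_cst [simp]: "zero_const \<phi> \<Longrightarrow> subst (cst c) \<phi> = cst c"
  using cont_lin_cst[OF cont_lin_subst, of \<phi> c 1] by simp

lemma subst_var [simp]:
  assumes "zero_const \<phi>"
  shows "subst var_x \<phi> = fst \<phi>" "subst var_y \<phi> = snd \<phi>" "subst var_eps \<phi> = var_eps"
  using subst_monomial[OF assms, of 1 0 0] subst_monomial[OF assms, of 0 1 0] subst_monomial[OF assms, of 0 0 1]
  by (simp_all add: var_x_monomial var_y_monomial) (simp flip: var_eps_monomial)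

text \<open>Both sides are continuous in each factor, so \<open>f\<close> and then \<open>g\<close>
  may be taken to be monomials, where the claim is the law of exponents.\<close>

lemma subst_mult:
  assumes "zero_const \<phi>"
  shows "subst (f * g) \<phi> = subst f \<phi> * subst g \<phi>"
proof (rule cont_lin_eqI[of "\<lambda>f. subst (f * g) \<phi>" "\<lambda>f. subst f \<phi> * subst g \<phi>"])
  fix p q r
  show "subst (monomial p q r * g) \<phi> = subst (monomial p q r) \<phi> * subst g \<phi>"
    by (rule cont_lin_eqI[OF cont_lin_comp[OF cont_lin_subst[OF assms] cont_lin_mult]
          cont_lin_comp[OF cont_lin_mult cont_lin_subst[OF assms]]])
      (simp add: assms monomial_mult subst_monomial power_add ac_simps)
qed (rule cont_lin_comp[OF cont_lin_subst[OF assms] cont_lin_mult']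
       cont_lin_comp[OF cont_lin_mult' cont_lin_subst[OF assms]])+

lemma subst_power: "zero_const \<phi> \<Longrightarrow> subst (f ^ k) \<phi> = subst f \<phi> ^ k"
  by (induction k) (simp_all add: subst_mult)

text \<open>Multiplicativity fixes \<open>T\<close> on monomials and continuity does the rest.
  Associativity of composition, neutrality of \<open>id_map\<close> and the description of
  exponentials as compositions with time-one maps are instances.\<close>

lemma continuous_hom_eq_subst:
  assumes T: "cont_lin T" and mult: "\<And>f g. T (f * g) = T f * T g" and one: "T 1 = 1"
    and eps: "T var_eps = var_eps" and zero: "zero_const (T var_x, T var_y)"
  shows "T f = subst f (T var_x, T var_y)"
proof (rule cont_lin_eqI[of T "\<lambda>f. subst f (T var_x, T var_y)"])
  have pow: "T (f ^ k) = T f ^ k" for f k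
    by (induction k) (simp_all add: one mult)
  show "T (monomial p q r) = subst (monomial p q r) (T var_x, T var_y)" for p q r
    unfolding subst_monomial[OF zero] by (simp add: monomial_def mult pow eps)
qed (simp_all add: T cont_lin_subst zero)

lemma zero_const_subst: "zero_const \<phi> \<Longrightarrow> zero_const \<psi> \<Longrightarrow> zero_const (\<phi> \<circ>\<^sub>f \<psi>)"
  by (simp add: zero_const_iff comp_map_def deg_ge_subst)

lemma zero_const_id [simp]: "zero_const id_map"
  by (simp add: zero_const_def id_map_def coef_var_x coef_var_y)

lemma subst_subst:
  assumes "zero_const \<phi>" "zero_const \<psi>"
  shows "subst (subst f \<phi>) \<psi> = subst f (\<phi> \<circ>\<^sub>f \<psi>)"
  using continuous_hom_eq_subst[of "\<lambda>f. subst (subst f \<phi>) \<psi>" f] zero_const_subst[OF assms] assms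
  by (simp add: cont_lin_comp[of "\<lambda>f. subst f \<psi>"] cont_lin_subst subst_mult comp_map_def)

lemma subst_id [simp]: "subst f id_map = f"
proof -
  have "cont_lin (\<lambda>f. f)"
    by (rule cont_linI) auto
  from continuous_hom_eq_subst[OF this] show ?thesis
    using zero_const_id unfolding id_map_def by metis
qed

lemma comp_map_assoc:
  "zero_const \<phi> \<Longrightarrow> zero_const \<psi> \<Longrightarrow> (F \<circ>\<^sub>f \<phi>) \<circ>\<^sub>f \<psi> = F \<circ>\<^sub>f \<phi> \<circ>\<^sub>f \<psi>"
  by (simp add: comp_map_def subst_subst[of \<phi> \<psi>, unfolded comp_map_def])

lemma comp_map_id [simp]: "F \<circ>\<^sub>f id_map = F"
  by (simp add: comp_map_def)

lemma id_comp_map [simp]: "zero_const F \<Longrightarrow> id_map \<circ>\<^sub>f F = F"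
  by (simp add: comp_map_def id_map_def)

lemma derivation_subst:
  assumes D: "derivation D" and eps: "D var_eps = 0" and zero: "zero_const \<phi>"
  shows "D (subst f \<phi>) = subst (diff_x f) \<phi> * D (fst \<phi>) + subst (diff_y f) \<phi> * D (snd \<phi>)"
proof (rule cont_lin_eqI[of "\<lambda>f. D (subst f \<phi>)"
      "\<lambda>f. subst (diff_x f) \<phi> * D (fst \<phi>) + subst (diff_y f) \<phi> * D (snd \<phi>)"])
  show "cont_lin (\<lambda>f. D (subst f \<phi>))"
    by (rule cont_lin_comp[OF derivationD[OF D] cont_lin_subst[OF zero]])
  show "cont_lin (\<lambda>f. subst (diff_x f) \<phi> * D (fst \<phi>) + subst (diff_y f) \<phi> * D (snd \<phi>))"
    by (rule cont_lin_plus[OF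
          cont_lin_comp[OF cont_lin_mult' cont_lin_comp[OF cont_lin_subst[OF zero] cont_lin_diff_x]]
          cont_lin_comp[OF cont_lin_mult' cont_lin_comp[OF cont_lin_subst[OF zero] cont_lin_diff_y]]])
  have of_nat: "subst (of_nat k) \<phi> = of_nat k" for k
    using subst_cst[OF zero, of "of_nat k"] by (simp add: cst_of_nat)
  show "D (subst (monomial p q r) \<phi>) = subst (diff_x (monomial p q r)) \<phi> * D (fst \<phi>) +
      subst (diff_y (monomial p q r)) \<phi> * D (snd \<phi>)" for p q r
    by (simp add: monomial_def subst_mult subst_power zero derivation_mult[OF D] derivation_power[OF D]
        diff_x_mult diff_y_mult derivation_power[OF derivation_diff_x]
        derivation_power[OF derivation_diff_y] eps of_nat cont_lin_0[OF cont_lin_subst] algebra_simps)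
qed

lemmas diff_x_subst = derivation_subst[OF derivation_diff_x diff_x_var(3)]
lemmas diff_y_subst = derivation_subst[OF derivation_diff_y diff_y_var(3)]

text \<open>The bracket is the Jacobian determinant of the pair, so this is the multiplicativity of
  determinants. With Jacobian 1, substitution preserves brackets and transports Hamiltonian
  dynamics.\<close>

lemma bracket_subst:
  "zero_const \<phi> \<Longrightarrow> bracket (subst f \<phi>) (subst g \<phi>) = subst (bracket f g) \<phi> * jacobian \<phi>"
  by (simp add: bracket_def jacobian_def diff_x_subst diff_y_subst subst_diff subst_mult algebra_simps)

lemma jacobian_bracket: "jacobian \<phi> = bracket (fst \<phi>) (snd \<phi>)"
  by (simp add: jacobian_def bracket_def)

lemma jacobian_comp:
  "zero_const \<phi> \<Longrightarrow> jacobian (F \<circ>\<^sub>f \<phi>) = subst (jacobian F) \<phi> * jacobian \<phi>"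
  unfolding jacobian_bracket[of F] jacobian_bracket[of "F \<circ>\<^sub>f \<phi>"]
  by (simp add: comp_map_def bracket_subst)

lemma jacobian_id [simp]: "jacobian id_map = 1"
  by (simp add: jacobian_def id_map_def)

section \<open>Time-one maps\<close>

abbreviation qord :: "nat \<Rightarrow> nat \<Rightarrow> series \<Rightarrow> bool" where
  "qord n \<equiv> ord_ge 2 n (2 * n)"

text \<open>Orders of Hamiltonians are taken up to functions of the parameter alone, which generate
  no dynamics.\<close>

definition hord :: "nat \<Rightarrow> nat \<Rightarrow> series \<Rightarrow> bool" where
  "hord n N f \<longleftrightarrow>
     (\<forall>i j m. 0 < i + j \<longrightarrow> 2 * i + n * j + 2 * n * m < N \<longrightarrow> coef f i j m = 0)"

lemma hord_mono: "hord n N f \<Longrightarrow> M \<le> N \<Longrightarrow> hord n M f"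
  by (auto simp: hord_def)

lemma qord_imp_hord: "qord n N f \<Longrightarrow> hord n N f"
  by (auto simp: hord_def ord_ge_def)

lemma hord_0 [simp]: "hord n N 0"
  by (simp add: hord_def)

lemma hord_add: "hord n N f \<Longrightarrow> hord n N g \<Longrightarrow> hord n N (f + g)"
  and hord_diff: "hord n N f \<Longrightarrow> hord n N g \<Longrightarrow> hord n N (f - g)"
  and hord_uminus: "hord n N f \<Longrightarrow> hord n N (- f)"
  by (simp_all add: hord_def)

text \<open>Differentiation kills the pure powers of the parameter, about which \<open>hord\<close>
  says nothing, so a full weighted bound results.\<close>

lemma hord_diff_x: "hord n N f \<Longrightarrow> qord n (N - 2) (diff_x f)"
  and hord_diff_y: "hord n N f \<Longrightarrow> qord n (N - n) (diff_y f)"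
  by (auto simp: hord_def ord_ge_def less_diff_conv algebra_simps)

lemma qord_all_imp_zero: "(\<And>N. qord n N f) \<Longrightarrow> f = 0"
  by (rule series_eqI) (metis ord_ge_def coef_zero lessI)

lemma qord_all_imp_eq: "(\<And>N. qord n N (f - g)) \<Longrightarrow> f = g"
  using qord_all_imp_zero[of n "f - g"] by simp

lemma qord_imp_deg_ge: "qord n (2 * n * N) f \<Longrightarrow> 0 < n \<Longrightarrow> deg_ge N f"
  by (rule ord_ge_imp_deg_ge[of 2 n "2 * n" "2 * n"]) simp_all

section \<open>Poisson brackets and Lie derivatives\<close>

lemma bracket_add: "bracket (f + g) h = bracket f h + bracket g h"
  "bracket h (f + g) = bracket h f + bracket h g"
  and bracket_diff: "bracket (f - g) h = bracket f h - bracket g h"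
  "bracket h (f - g) = bracket h f - bracket h g"
  and bracket_uminus: "bracket (- f) h = - bracket f h" "bracket h (- f) = - bracket h f"
  and bracket_cst_mult: "bracket (cst c * f) h = cst c * bracket f h"
  "bracket h (cst c * f) = cst c * bracket h f"
  by (simp_all add: bracket_def diff_x_simps diff_y_simps ring_distribs mult.assoc mult.left_commute)

lemma bracket_anticommute: "bracket f g = - bracket g f"
  by (simp add: bracket_def)

lemma bracket_self [simp]: "bracket f f = 0"
  by (simp add: bracket_def)

lemma bracket_xy [simp]: "bracket var_x var_y = 1"
  by (simp add: bracket_def)

lemma bracket_x: "bracket var_x g = diff_y g" and bracket_y: "bracket var_y g = - diff_x g"
  by (simp_all add: bracket_def)

lemma qord_bracket:
  assumes "qord n N f" "qord n M g"
  shows "qord n (N + M - (n + 2)) (bracket f g)"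
proof -
  have "qord n ((N - 2) + (M - n)) (diff_x f * diff_y g)"
    using assms by (intro ord_ge_mult ord_ge_diff_x ord_ge_diff_y)
  moreover have "qord n ((N - n) + (M - 2)) (diff_y f * diff_x g)"
    using assms by (intro ord_ge_mult ord_ge_diff_x ord_ge_diff_y)
  ultimately show ?thesis
    unfolding bracket_def by (intro ord_ge_diff) (erule ord_ge_mono_le, linarith)+
qed

text \<open>A Hamiltonian of order \<open>n + 2 + p\<close> makes up for the loss
  \<open>n + 2\<close> of the bracket and leaves the gain \<open>p\<close>. Truncated subtraction is
  harmless, as it can only cut off the order of \<open>f\<close>.\<close>

lemma qord_lie:
  assumes "qord n N f" "hord n (n + 2 + p) \<chi>"
  shows "qord n (N + p) (lie \<chi> f)"
proof -
  have "qord n ((N - 2) + (n + 2 + p - n)) (diff_x f * diff_y \<chi>)"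
    using assms by (intro ord_ge_mult ord_ge_diff_x hord_diff_y)
  moreover have "qord n ((N - n) + (n + 2 + p - 2)) (diff_y f * diff_x \<chi>)"
    using assms by (intro ord_ge_mult ord_ge_diff_y hord_diff_x)
  ultimately show ?thesis
    unfolding bracket_def lie_def by (intro ord_ge_diff) (erule ord_ge_mono_le, linarith)+
qed

lemma derivation_lie: "derivation (lie \<chi>)"
proof -
  have "lie \<chi> = (\<lambda>f. diff_y \<chi> * diff_x f + (- diff_x \<chi>) * diff_y f)"
    by (simp add: lie_def bracket_def fun_eq_iff)
  moreover have "cont_lin \<dots>"
    by (rule cont_lin_plus[OF cont_lin_comp[OF cont_lin_mult cont_lin_diff_x]
          cont_lin_comp[OF cont_lin_mult cont_lin_diff_y]])
  moreover have "lie \<chi> (f * g) = lie \<chi> f * g + f * lie \<chi> g" for f g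
    by (simp add: lie_def bracket_def diff_x_mult diff_y_mult algebra_simps)
  ultimately show ?thesis
    by (simp add: derivation_def)
qed

lemmas cont_lin_lie = derivationD[OF derivation_lie]
lemmas lie_mult = derivation_mult[OF derivation_lie]
lemmas lie_simps = cont_lin_add[OF cont_lin_lie] cont_lin_diff[OF cont_lin_lie]
  cont_lin_uminus[OF cont_lin_lie] cont_lin_cst[OF cont_lin_lie] cont_lin_0[OF cont_lin_lie]

lemma lie_var_eps [simp]: "lie \<chi> var_eps = 0" and lie_1 [simp]: "lie \<chi> 1 = 0"
  by (simp_all add: lie_def bracket_def derivation_1[OF derivation_diff_x]
      derivation_1[OF derivation_diff_y])

lemma lie_bracket: "lie \<chi> (bracket f g) = bracket (lie \<chi> f) g + bracket f (lie \<chi> g)"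
  by (simp add: lie_def bracket_def diff_x_simps diff_y_simps diff_x_mult diff_y_mult
      diff_x_diff_y algebra_simps)

lemma cont_lin_funpow: "cont_lin A \<Longrightarrow> cont_lin (A ^^ k)"
proof (induction k)
  case 0
  show ?case
    by (rule cont_linI) auto
next
  case (Suc k)
  then show ?case
    using cont_lin_comp[of A "A ^^ k"] by (simp add: comp_def)
qed

section \<open>Terms and partial sums of the exponential series\<close>

definition exp_term :: "series \<Rightarrow> nat \<Rightarrow> series \<Rightarrow> series" where
  "exp_term \<chi> k f = cst (1 / fact k) * (lie \<chi> ^^ k) f"

definition exp_partial :: "series \<Rightarrow> nat \<Rightarrow> series \<Rightarrow> series" where
  "exp_partial \<chi> K f = (\<Sum>k\<le>K. exp_term \<chi> k f)"

lemma cont_lin_exp_term: "cont_lin (exp_term \<chi> k)"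
  using cont_lin_comp[OF cont_lin_mult cont_lin_funpow[OF cont_lin_lie], of "cst (1 / fact k)" k]
  by (simp add: exp_term_def[abs_def])

lemma exp_term_0 [simp]: "exp_term \<chi> 0 f = f"
  by (simp add: exp_term_def)

lemma exp_term_lie: "exp_term \<chi> k (lie \<chi> f) = cst (real (Suc k)) * exp_term \<chi> (Suc k) f"
proof -
  have "1 / fact k = real (Suc k) * (1 / fact (Suc k))"
    by simp
  then show ?thesis
    unfolding exp_term_def funpow_Suc_right comp_def by (metis cst_mult mult.assoc)
qed

lemma qord_funpow_lie:
  assumes "qord n N f" "hord n (n + 2 + p) \<chi>"
  shows "qord n (N + k * p) ((lie \<chi> ^^ k) f)"
proof (induction k)
  case (Suc k)
  show ?case
    using qord_lie[OF Suc assms(2)] by (simp add: add_ac)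
qed (simp add: assms)

lemma qord_exp_term:
  "qord n N f \<Longrightarrow> hord n (n + 2 + p) \<chi> \<Longrightarrow> qord n (N + k * p) (exp_term \<chi> k f)"
  unfolding exp_term_def by (intro ord_ge_cst_mult qord_funpow_lie)

text \<open>Each Lie derivative gains \<open>p > 0\<close>, so the infinite sum in a coefficient has
  finitely many nonzero terms. The first omitted term, with index \<open>Suc K\<close>, sets the
  order of the error.\<close>

lemma qord_exp_lie_diff:
  assumes "qord n N f" "hord n (n + 2 + p) \<chi>" "0 < p"
  shows "qord n (N + Suc K * p) (exp_lie \<chi> f - exp_partial \<chi> K f)"
  unfolding ord_ge_def
proof (intro allI impI)
  fix i j m
  assume lt: "2 * i + n * j + 2 * n * m < N + Suc K * p"
  have "coef ((lie \<chi> ^^ k) f) i j m / fact k = 0" if "k \<notin> {..K}" for k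
  proof -
    have "Suc K * p \<le> k * p"
      using that by (intro mult_le_mono1) simp
    then show ?thesis
      using ord_geD[OF qord_funpow_lie[OF assms(1,2)], of i j m k] lt by simp
  qed
  then have "(\<Sum>k. coef ((lie \<chi> ^^ k) f) i j m / fact k) =
      (\<Sum>k\<le>K. coef ((lie \<chi> ^^ k) f) i j m / fact k)"
    by (intro suminf_finite) auto
  then show "coef (exp_lie \<chi> f - exp_partial \<chi> K f) i j m = 0"
    by (simp add: exp_lie_def exp_partial_def exp_term_def)
qed

lemma qord_exp_lie_Suc:
  assumes "qord n N f" "hord n (n + 2 + p) \<chi>" "0 < p"
  shows "qord n (N + p) (exp_lie \<chi> f - f)"
  using qord_exp_lie_diff[OF assms, of 0] by (simp add: exp_partial_def)

lemma qord_exp_lie_linear: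
  assumes "qord n N f" "hord n (n + 2 + p) \<chi>" "0 < p"
  shows "qord n (N + 2 * p) (exp_lie \<chi> f - f - lie \<chi> f)"
  using qord_exp_lie_diff[OF assms, of 1]
  by (simp add: exp_partial_def One_nat_def exp_term_def diff_diff_eq mult_2)

text \<open>The Leibniz rule for divided powers. The operation \<open>B\<close> is abstract so that
  one proof serves the product of series and the Poisson bracket.\<close>

lemma exp_term_bilinear:
  assumes add: "\<And>f g h. B (f + g) h = B f h + B g h" "\<And>f g h. B h (f + g) = B h f + B h g"
    and scale: "\<And>c f g. B (cst c * f) g = cst c * B f g" "\<And>c f g. B f (cst c * g) = cst c * B f g"
    and leibniz: "\<And>f g. lie \<chi> (B f g) = B (lie \<chi> f) g + B f (lie \<chi> g)"
  shows "exp_term \<chi> k (B f g) = (\<Sum>i\<le>k. B (exp_term \<chi> i f) (exp_term \<chi> (k - i) g))"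
proof (induction k arbitrary: f g)
  case (Suc k)
  define T where "T = (\<lambda>i. B (exp_term \<chi> i f) (exp_term \<chi> (Suc k - i) g))"
  \<comment> \<open>The factor \<open>Suc k\<close> absorbs one Lie derivative. The term
    \<open>T i\<close> then receives the factor i from the first argument and
    \<open>Suc k - i\<close> from the second.\<close>
  have "cst (real (Suc k)) * exp_term \<chi> (Suc k) (B f g) =
      exp_term \<chi> k (B (lie \<chi> f) g) + exp_term \<chi> k (B f (lie \<chi> g))"
    by (simp only: exp_term_lie[symmetric] leibniz cont_lin_add[OF cont_lin_exp_term])
  also have "exp_term \<chi> k (B (lie \<chi> f) g) = (\<Sum>i\<le>k. cst (real (Suc i)) * T (Suc i))"
    by (simp add: Suc exp_term_lie scale T_def)
  also have "\<dots> = (\<Sum>i\<le>Suc k. cst (real i) * T i)"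
    by (simp add: sum.atMost_Suc_shift del: sum.atMost_Suc)
  also have "exp_term \<chi> k (B f (lie \<chi> g)) = (\<Sum>i\<le>k. cst (real (Suc k - i)) * T i)"
    unfolding Suc by (intro sum.cong refl) (simp add: exp_term_lie scale T_def Suc_diff_le)
  also have "\<dots> = (\<Sum>i\<le>Suc k. cst (real (Suc k - i)) * T i)"
    by simp
  also have "(\<Sum>i\<le>Suc k. cst (real i) * T i) + \<dots> = (\<Sum>i\<le>Suc k. cst (real (Suc k)) * T i)"
    unfolding sum.distrib[symmetric]
    by (intro sum.cong refl) (simp add: distrib_right[symmetric] cst_add[symmetric] of_nat_diff)
  finally have "cst (1 / real (Suc k)) * (cst (real (Suc k)) * exp_term \<chi> (Suc k) (B f g)) =
      cst (1 / real (Suc k)) * (cst (real (Suc k)) * (\<Sum>i\<le>Suc k. T i))"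
    by (simp only: sum_distrib_left)
  then show ?case
    by (simp add: mult.assoc[symmetric] cst_mult[symmetric] T_def del: of_nat_Suc sum.atMost_Suc)
qed simp

section \<open>Exponentials as automorphisms, and time-one maps\<close>

context
  fixes n :: nat and \<chi> :: series
  assumes n: "0 < n" and \<chi>: "hord n (n + 3) \<chi>"
begin

lemma hord_add_3: "hord n (n + 2 + 1) \<chi>"
  using \<chi> by (simp add: numeral_3_eq_3 One_nat_def)

lemma qord_exp_lie_remainder: "qord n N f \<Longrightarrow> qord n (N + Suc K) (exp_lie \<chi> f - exp_partial \<chi> K f)"
  using qord_exp_lie_diff[OF _ hord_add_3, of N f K] by simp

lemma exp_lie_remainder: "K \<le> M \<Longrightarrow> qord n K (exp_lie \<chi> f - exp_partial \<chi> M f)"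
  using qord_exp_lie_remainder[of 0 f M] by (auto elim: ord_ge_mono_le)

lemma qord_exp_lie: "qord n N f \<Longrightarrow> qord n N (exp_lie \<chi> f)"
  using ord_ge_add[OF _ ord_ge_mono_le[OF qord_exp_lie_Suc[OF _ hord_add_3], of N f N]] by fastforce

lemma cont_lin_exp_lie: "cont_lin (exp_lie \<chi>)"
proof (rule cont_linI)
  have partial: "exp_partial \<chi> K (f + g) = exp_partial \<chi> K f + exp_partial \<chi> K g"
    "exp_partial \<chi> K (cst c * f) = cst c * exp_partial \<chi> K f" for K f g c
    by (simp_all add: exp_partial_def cont_lin_add[OF cont_lin_exp_term]
        cont_lin_cst[OF cont_lin_exp_term] sum.distrib sum_distrib_left)
  show "exp_lie \<chi> (f + g) = exp_lie \<chi> f + exp_lie \<chi> g" for f g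
  proof (rule qord_all_imp_eq)
    fix N
    have "qord n N ((exp_lie \<chi> (f + g) - exp_partial \<chi> N (f + g)) -
        ((exp_lie \<chi> f - exp_partial \<chi> N f) + (exp_lie \<chi> g - exp_partial \<chi> N g)))"
      by (intro ord_ge_diff ord_ge_add exp_lie_remainder order_refl)
    then show "qord n N (exp_lie \<chi> (f + g) - (exp_lie \<chi> f + exp_lie \<chi> g))"
      by (simp add: partial algebra_simps)
  qed
  show "exp_lie \<chi> (cst c * f) = cst c * exp_lie \<chi> f" for c f
  proof (rule qord_all_imp_eq)
    fix N
    have "qord n N ((exp_lie \<chi> (cst c * f) - exp_partial \<chi> N (cst c * f)) -
        cst c * (exp_lie \<chi> f - exp_partial \<chi> N f))"
      by (intro ord_ge_diff ord_ge_cst_mult exp_lie_remainder order_refl)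
    then show "qord n N (exp_lie \<chi> (cst c * f) - cst c * exp_lie \<chi> f)"
      by (simp add: partial right_diff_distrib)
  qed
  show "\<exists>M. \<forall>f. deg_ge M f \<longrightarrow> deg_ge N (exp_lie \<chi> f)" for N
    using deg_ge_imp_ord_ge[of "2 * n * N" _ 2 n "2 * n"] n
    by (intro exI[of _ "2 * n * N"] allI impI qord_imp_deg_ge[of n] qord_exp_lie) auto
qed

text \<open>The number \<open>s\<close> is the order that \<open>B\<close> may lose: 0 for the
  product, \<open>n + 2\<close> for the bracket. The product of two partial sums differs from the
  partial sum of the product by the terms of the square of indices outside the triangle
  \<open>i + j \<le> K\<close>, and these have high order.\<close>

lemma exp_lie_bilinear:
  assumes add: "\<And>f g h. B (f + g) h = B f h + B g h" "\<And>f g h. B h (f + g) = B h f + B h g"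
    and scale: "\<And>c f g. B (cst c * f) g = cst c * B f g" "\<And>c f g. B f (cst c * g) = cst c * B f g"
    and leibniz: "\<And>f g. lie \<chi> (B f g) = B (lie \<chi> f) g + B f (lie \<chi> g)"
    and ord: "\<And>N M f g. qord n N f \<Longrightarrow> qord n M g \<Longrightarrow> qord n (N + M - s) (B f g)"
  shows "exp_lie \<chi> (B f g) = B (exp_lie \<chi> f) (exp_lie \<chi> g)"
proof (rule qord_all_imp_eq)
  fix N
  define K where "K = N + s"
  have zero: "B 0 h = 0" "B h 0 = 0" for h
    using scale(1)[of 0 0 h] scale(2)[of h 0 0] by simp_all
  have neg: "B (- f) h = - B f h" "B h (- f) = - B h f" for f h
    using scale(1)[of "- 1" f h] scale(2)[of h "- 1" f] by (simp_all add: cst_uminus)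
  have diff: "B (f - g) h = B f h - B g h" "B h (f - g) = B h f - B h g" for f g h
    using add[of f "- g" h] add(2)[of h f "- g"] by (simp_all add: neg)
  have suml: "B (sum F A) h = (\<Sum>k\<in>A. B (F k) h)" for F :: "nat \<Rightarrow> series" and A h
    by (induction A rule: infinite_finite_induct) (simp_all add: zero add)
  have sumr: "B h (sum F A) = (\<Sum>k\<in>A. B h (F k))" for F :: "nat \<Rightarrow> series" and A h
    by (induction A rule: infinite_finite_induct) (simp_all add: zero add)
  let ?t = "\<lambda>i j. B (exp_term \<chi> i f) (exp_term \<chi> j g)"
  have t: "qord n (i + j - s) (?t i j)" for i j
    using ord[OF qord_exp_term[OF ord_ge_trivial hord_add_3] qord_exp_term[OF ord_ge_trivial hord_add_3]]
    by simp
  have "exp_partial \<chi> K (B f g) = (\<Sum>k\<le>K. \<Sum>i\<le>k. ?t i (k - i))"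
    by (simp add: exp_partial_def exp_term_bilinear[of B, OF add scale leibniz])
  also have "\<dots> = (\<Sum>(i, j)\<in>{(i, j). i + j \<le> K}. ?t i j)"
    by (rule sum.triangle_reindex_eq[symmetric])
  finally have tri: "exp_partial \<chi> K (B f g) = (\<Sum>(i, j)\<in>{(i, j). i + j \<le> K}. ?t i j)" .
  have "B (exp_partial \<chi> K f) (exp_partial \<chi> K g) = (\<Sum>i\<le>K. \<Sum>j\<le>K. ?t i j)"
    by (simp add: exp_partial_def suml sumr) (rule sum.swap)
  also have "\<dots> = (\<Sum>(i, j)\<in>{..K} \<times> {..K}. ?t i j)"
    by (simp add: sum.cartesian_product)
  also have "\<dots> = (\<Sum>(i, j)\<in>{..K} \<times> {..K} - {(i, j). i + j \<le> K}. ?t i j) + exp_partial \<chi> K (B f g)"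
    unfolding tri by (rule sum.subset_diff) auto
  finally have prod: "B (exp_partial \<chi> K f) (exp_partial \<chi> K g) - exp_partial \<chi> K (B f g) =
      (\<Sum>(i, j)\<in>{..K} \<times> {..K} - {(i, j). i + j \<le> K}. ?t i j)"
    by simp
  have 1: "qord n N (B (exp_partial \<chi> K f) (exp_partial \<chi> K g) - exp_partial \<chi> K (B f g))"
    unfolding prod by (rule ord_ge_sum) (auto intro!: ord_ge_mono_le[OF t] simp: K_def)
  have 2: "qord n N (B (exp_lie \<chi> f - exp_partial \<chi> K f) (exp_partial \<chi> K g))"
    using ord[OF exp_lie_remainder[OF order_refl, of K f] ord_ge_trivial] by (simp add: K_def)
  have 3: "qord n N (B (exp_lie \<chi> f) (exp_lie \<chi> g - exp_partial \<chi> K g))"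
    using ord[OF ord_ge_trivial exp_lie_remainder[OF order_refl, of K g]] by (simp add: K_def)
  have 4: "qord n N (exp_lie \<chi> (B f g) - exp_partial \<chi> K (B f g))"
    by (rule exp_lie_remainder) (simp add: K_def)
  have "exp_lie \<chi> (B f g) - B (exp_lie \<chi> f) (exp_lie \<chi> g) =
      (exp_lie \<chi> (B f g) - exp_partial \<chi> K (B f g)) -
      (B (exp_partial \<chi> K f) (exp_partial \<chi> K g) - exp_partial \<chi> K (B f g)) -
      B (exp_lie \<chi> f - exp_partial \<chi> K f) (exp_partial \<chi> K g) -
      B (exp_lie \<chi> f) (exp_lie \<chi> g - exp_partial \<chi> K g)"
    by (simp add: diff)
  then show "qord n N (exp_lie \<chi> (B f g) - B (exp_lie \<chi> f) (exp_lie \<chi> g))"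
    using ord_ge_diff[OF ord_ge_diff[OF ord_ge_diff[OF 4 1] 2] 3] by (simp only:)
qed

lemma exp_lie_mult: "exp_lie \<chi> (f * g) = exp_lie \<chi> f * exp_lie \<chi> g"
proof (rule exp_lie_bilinear[of "(*)" 0])
  show "qord n (N + M - 0) (f * g)" if "qord n N f" "qord n M g" for N M f g
    using ord_ge_mult[OF that] by simp
qed (simp_all add: distrib_left distrib_right mult.assoc mult.left_commute lie_mult)

lemma exp_lie_bracket: "exp_lie \<chi> (bracket f g) = bracket (exp_lie \<chi> f) (exp_lie \<chi> g)"
  by (rule exp_lie_bilinear[OF bracket_add bracket_cst_mult lie_bracket qord_bracket])

lemma exp_lie_fixed:
  assumes "lie \<chi> f = 0"
  shows "exp_lie \<chi> f = f"
proof (rule qord_all_imp_eq)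
  fix N
  have "exp_term \<chi> (Suc k) f = 0" for k
    by (simp add: exp_term_def funpow_Suc_right assms cont_lin_0[OF cont_lin_funpow[OF cont_lin_lie]]
        del: funpow.simps)
  then have "exp_partial \<chi> N f = f"
    by (simp add: exp_partial_def sum.atMost_shift)
  then show "qord n N (exp_lie \<chi> f - f)"
    using exp_lie_remainder[OF order_refl, of N f] by simp
qed

lemma exp_lie_1 [simp]: "exp_lie \<chi> 1 = 1" and exp_lie_var_eps [simp]: "exp_lie \<chi> var_eps = var_eps"
  by (simp_all add: exp_lie_fixed)

lemma zero_const_time_one: "zero_const (time_one \<chi>)"
  using ord_geD[OF qord_exp_lie[OF ord_ge_var_x], of 0 0 0] n
    ord_geD[OF qord_exp_lie[OF ord_ge_var_y], of 0 0 0]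
  by (simp add: zero_const_def time_one_def)

text \<open>The exponential of a derivation is multiplicative, hence a substitution. Operator
  identities become identities of maps, with the order of composition reversed.\<close>

lemma exp_lie_eq_subst: "exp_lie \<chi> f = subst f (time_one \<chi>)"
  unfolding time_one_def
  by (rule continuous_hom_eq_subst[OF cont_lin_exp_lie exp_lie_mult exp_lie_1 exp_lie_var_eps
        zero_const_time_one[unfolded time_one_def]])

lemma jacobian_time_one: "jacobian (time_one \<chi>) = 1"
  using exp_lie_bracket[of var_x var_y] by (simp add: jacobian_bracket time_one_def)

lemma comp_time_one: "F \<circ>\<^sub>f time_one \<chi> = (exp_lie \<chi> (fst F), exp_lie \<chi> (snd F))"
  by (simp add: comp_map_def exp_lie_eq_subst)

end

lemma cst_sum: "cst (sum f A) = (\<Sum>k\<in>A. cst (f k))"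
  by (induction A rule: infinite_finite_induct) (simp_all add: cst_add)

lemma lie_uminus: "lie (- \<chi>) f = - lie \<chi> f"
  by (simp add: lie_def bracket_uminus)

lemma funpow_lie_uminus: "(lie (- \<chi>) ^^ k) f = cst ((- 1) ^ k) * (lie \<chi> ^^ k) f"
  by (induction k) (simp_all add: lie_uminus lie_simps cst_uminus)

text \<open>The terms with \<open>i + j = k\<close> involve the same power of the Lie derivative,
  and their factors add up to an alternating sum of binomial coefficients, which vanishes for
  \<open>k > 0\<close>. The terms with \<open>i + j > N\<close> have order above
  \<open>N\<close>.\<close>

lemma exp_lie_uminus_exp_lie:
  assumes n: "0 < n" and \<chi>: "hord n (n + 3) \<chi>"
  shows "exp_lie (- \<chi>) (exp_lie \<chi> f) = f"
proof (rule qord_all_imp_eq)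
  fix N
  note \<chi>'' = hord_uminus[OF \<chi>]
  let ?t = "\<lambda>i j. exp_term (- \<chi>) i (exp_term \<chi> j f)"
  have t: "qord n (i + j) (?t i j)" for i j
    using qord_exp_term[OF qord_exp_term[OF ord_ge_trivial hord_add_3[OF n \<chi>], of j f] hord_add_3[OF n \<chi>''], of i]
    by (simp add: add.commute)
  have t_eq: "?t i j = cst ((- 1) ^ i * (1 / fact i * (1 / fact j))) * (lie \<chi> ^^ (i + j)) f" for i j
    by (simp add: exp_term_def funpow_lie_uminus cont_lin_cst[OF cont_lin_funpow[OF cont_lin_lie]]
        funpow_add cst_mult[symmetric] mult.assoc[symmetric])
  have diag: "(\<Sum>i\<le>k. ?t i (k - i)) = 0" if "0 < k" for k
  proof -
    have "(\<Sum>i\<le>k. ?t i (k - i)) =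
        cst (\<Sum>i\<le>k. (- 1) ^ i * (1 / fact i * (1 / fact (k - i)))) * (lie \<chi> ^^ k) f"
      unfolding t_eq cst_sum sum_distrib_right by (intro sum.cong refl) simp
    also have "(\<Sum>i\<le>k. (- 1) ^ i * (1 / fact i * (1 / fact (k - i)))) =
        (1 / fact k) * (\<Sum>i\<le>k. (- 1) ^ i * real (k choose i))"
      unfolding sum_distrib_left
      by (intro sum.cong refl) (simp add: binomial_fact field_simps)
    also have "\<dots> = 0"
      using choose_alternating_sum[OF that, where ?'a = real] by simp
    finally show ?thesis
      by simp
  qed
  have "exp_partial (- \<chi>) N (exp_partial \<chi> N f) = (\<Sum>i\<le>N. \<Sum>j\<le>N. ?t i j)"
    by (simp add: exp_partial_def cont_lin_sum[OF cont_lin_exp_term])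
  also have "\<dots> = (\<Sum>(i, j)\<in>{..N} \<times> {..N}. ?t i j)"
    by (simp add: sum.cartesian_product)
  also have "\<dots> = (\<Sum>(i, j)\<in>{..N} \<times> {..N} - {(i, j). i + j \<le> N}. ?t i j) +
      (\<Sum>(i, j)\<in>{(i, j). i + j \<le> N}. ?t i j)"
    by (rule sum.subset_diff) auto
  also have "(\<Sum>(i, j)\<in>{(i, j). i + j \<le> N}. ?t i j) = (\<Sum>k\<le>N. \<Sum>i\<le>k. ?t i (k - i))"
    by (rule sum.triangle_reindex_eq)
  also have "\<dots> = (\<Sum>k\<le>N. if k = 0 then f else 0)"
    by (rule sum.cong) (use diag in auto)
  also have "\<dots> = f"
    by simp
  finally have "exp_partial (- \<chi>) N (exp_partial \<chi> N f) - f =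
      (\<Sum>(i, j)\<in>{..N} \<times> {..N} - {(i, j). i + j \<le> N}. ?t i j)"
    by simp
  then have 1: "qord n N (exp_partial (- \<chi>) N (exp_partial \<chi> N f) - f)"
    by (simp only:) (rule ord_ge_sum, auto intro!: ord_ge_mono_le[OF t])
  have 2: "qord n N (exp_lie (- \<chi>) (exp_lie \<chi> f - exp_partial \<chi> N f))"
    by (rule qord_exp_lie[OF n \<chi>'' exp_lie_remainder[OF n \<chi> order_refl]])
  have 3: "qord n N (exp_lie (- \<chi>) (exp_partial \<chi> N f) - exp_partial (- \<chi>) N (exp_partial \<chi> N f))"
    by (rule exp_lie_remainder[OF n \<chi>'' order_refl])
  show "qord n N (exp_lie (- \<chi>) (exp_lie \<chi> f) - f)"
    using ord_ge_add[OF 1 ord_ge_add[OF 2 3]]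
    by (simp add: cont_lin_diff[OF cont_lin_exp_lie[OF n \<chi>'']])
qed

lemma time_one_uminus_comp:
  assumes "0 < n" "hord n (n + 3) \<chi>"
  shows "time_one (- \<chi>) \<circ>\<^sub>f time_one \<chi> = id_map" "time_one \<chi> \<circ>\<^sub>f time_one (- \<chi>) = id_map"
proof -
  show "time_one \<chi> \<circ>\<^sub>f time_one (- \<chi>) = id_map"
    unfolding comp_time_one[OF assms(1) hord_uminus[OF assms(2)]]
    by (simp add: exp_lie_uminus_exp_lie[OF assms] time_one_def id_map_def)
  show "time_one (- \<chi>) \<circ>\<^sub>f time_one \<chi> = id_map"
    unfolding comp_time_one[OF assms]
    using exp_lie_uminus_exp_lie[OF assms(1) hord_uminus[OF assms(2)]]
    by (simp add: time_one_def id_map_def)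
qed

text \<open>With Jacobian 1 the iterated Lie derivatives for \<open>subst h \<phi>\<close> are
  pullbacks of those for \<open>h\<close>. No weighted order of \<open>subst h \<phi>\<close> is
  assumed; the sums are finite because the iterates for \<open>h\<close> have growing total degree,
  which substitution does not lower.\<close>

lemma exp_lie_subst:
  assumes n: "0 < n" and h: "hord n (n + 3) h" and zero: "zero_const \<phi>" and jac: "jacobian \<phi> = 1"
  shows "exp_lie (subst h \<phi>) (subst f \<phi>) = subst (exp_lie h f) \<phi>"
proof (rule series_eqI)
  fix i j m
  let ?h = "subst h \<phi>"
  have "lie ?h (subst g \<phi>) = subst (lie h g) \<phi>" for g
    by (simp add: lie_def bracket_subst[OF zero] jac)
  then have iter: "(lie ?h ^^ k) (subst f \<phi>) = subst ((lie h ^^ k) f) \<phi>" for k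
    by (induction k) simp_all
  define K where "K = 2 * n * Suc (i + j + m)"
  have "coef (subst ((lie h ^^ k) f) \<phi>) i j m / fact k = 0" if "k \<notin> {..K}" for k
  proof -
    have "qord n (2 * n * Suc (i + j + m)) ((lie h ^^ k) f)"
      using qord_funpow_lie[OF ord_ge_trivial hord_add_3[OF n h], of k f] that
      by (auto elim!: ord_ge_mono_le simp: K_def)
    then show ?thesis
      using ord_geD[OF deg_ge_subst[OF zero qord_imp_deg_ge], of n "Suc (i + j + m)" _ i j m] n
      by simp
  qed
  then have "coef (exp_lie ?h (subst f \<phi>)) i j m =
      (\<Sum>k\<le>K. coef (subst ((lie h ^^ k) f) \<phi>) i j m / fact k)"
    unfolding exp_lie_def coef_mk_series iter by (intro suminf_finite) auto
  also have "\<dots> = coef (subst (exp_partial h K f) \<phi>) i j m"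
    by (simp add: exp_partial_def exp_term_def subst_sum[OF zero]
        cont_lin_cst[OF cont_lin_subst[OF zero]])
  also have "\<dots> = coef (subst (exp_lie h f) \<phi>) i j m"
  proof -
    have "qord n (2 * n * Suc (i + j + m)) (exp_lie h f - exp_partial h K f)"
      by (rule exp_lie_remainder[OF n h]) (simp add: K_def)
    from ord_geD[OF deg_ge_subst[OF zero qord_imp_deg_ge[OF this n]], of i j m] show ?thesis
      by (simp add: subst_diff[OF zero])
  qed
  finally show "coef (exp_lie ?h (subst f \<phi>)) i j m = coef (subst (exp_lie h f) \<phi>) i j m" .
qed

section \<open>Perturbation of the Hamiltonian\<close>

lemma lie_add_ham: "lie (\<chi> + w) f = lie \<chi> f + lie w f"
  and lie_diff_ham: "lie (\<chi> - w) f = lie \<chi> f - lie w f"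
  by (simp_all add: lie_def bracket_add bracket_diff)

text \<open>In the difference of the two exponentials every term contains \<open>w\<close>, gaining
  \<open>p\<close>, and from the second power on a further Lie derivative gains at least 1. So
  \<open>lie w f\<close> is the whole difference at order \<open>q + p\<close>.\<close>

lemma qord_exp_lie_perturb:
  assumes n: "0 < n" and \<chi>: "hord n (n + 3) \<chi>" and w: "hord n (n + 2 + p) w" and p: "0 < p"
    and f: "qord n q f"
  shows "qord n (q + p + 1) (exp_lie (\<chi> + w) f - exp_lie \<chi> f - lie w f)"
proof -
  have \<chi>w: "hord n (n + 3) (\<chi> + w)"
    using w p by (intro hord_add \<chi>) (auto elim: hord_mono)
  define A where "A = (\<lambda>k. (lie (\<chi> + w) ^^ k) f - (lie \<chi> ^^ k) f)"
  have A_Suc: "A (Suc k) = lie (\<chi> + w) (A k) + lie w ((lie \<chi> ^^ k) f)" for k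
    by (simp add: A_def lie_add_ham lie_simps)
  have A: "qord n (q + p + k) (A (Suc k))" for k
  proof (induction k)
    case 0
    have "A (Suc 0) = lie w f"
      by (simp add: A_def lie_add_ham)
    then show ?case
      using qord_lie[OF f w] by simp
  next
    case (Suc k)
    have "qord n (q + p + Suc k) (lie (\<chi> + w) (A (Suc k)))"
      using qord_lie[OF Suc hord_add_3[OF n \<chi>w]] by (simp add: One_nat_def)
    moreover have "qord n (q + p + Suc k) (lie w ((lie \<chi> ^^ Suc k) f))"
      using qord_lie[OF qord_funpow_lie[OF f hord_add_3[OF n \<chi>], of "Suc k"] w] by (simp add: add_ac)
    ultimately show ?case
      unfolding A_Suc[of "Suc k"] by (rule ord_ge_add)
  qed
  define D where "D = (\<lambda>K. exp_partial (\<chi> + w) K f - exp_partial \<chi> K f)"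
  have D_Suc: "D (Suc K) = D K + cst (1 / fact (Suc K)) * A (Suc K)" for K
    by (simp add: D_def exp_partial_def exp_term_def A_def right_diff_distrib del: funpow.simps)
  have D: "qord n (q + p + 1) (D (Suc K) - lie w f)" for K
  proof (induction K)
    case 0
    then show ?case
      by (simp add: D_def exp_partial_def exp_term_def lie_add_ham)
  next
    case (Suc K)
    have "D (Suc (Suc K)) - lie w f =
        (D (Suc K) - lie w f) + cst (1 / fact (Suc (Suc K))) * A (Suc (Suc K))"
      unfolding D_Suc[of "Suc K"] by simp
    moreover have "qord n (q + p + 1) (A (Suc (Suc K)))"
      using A[of "Suc K"] by (rule ord_ge_mono_le) simp
    ultimately show ?case
      using Suc by (simp only: ord_ge_add ord_ge_cst_mult)
  qed
  define K where "K = q + p + 1"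
  have "qord n (q + p + 1) ((exp_lie (\<chi> + w) f - exp_partial (\<chi> + w) (Suc K) f) -
      (exp_lie \<chi> f - exp_partial \<chi> (Suc K) f) + (D (Suc K) - lie w f))"
    by (intro ord_ge_add ord_ge_diff D exp_lie_remainder[OF n \<chi>] exp_lie_remainder[OF n \<chi>w])
      (simp_all add: K_def)
  then show ?thesis
    by (simp add: D_def algebra_simps)
qed

lemma qord_exp_lie_perturb':
  assumes "0 < n" "hord n (n + 3) \<chi>" "hord n (n + 2 + p) w" "0 < p" "qord n q f"
  shows "qord n (q + p) (exp_lie (\<chi> + w) f - exp_lie \<chi> f)"
proof -
  have "qord n (q + p) (exp_lie (\<chi> + w) f - exp_lie \<chi> f - lie w f + lie w f)"
    using qord_exp_lie_perturb[OF assms] qord_lie[OF assms(5,3)]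
    by (intro ord_ge_add) (auto elim: ord_ge_mono_le)
  then show ?thesis
    by simp
qed

lemma hord_telescope:
  assumes "\<And>k. hord n (N + k) (X (Suc k) - X k)" "a \<le> b"
  shows "hord n (N + a) (X b - X a)"
  using assms(2)
proof (induction b rule: dec_induct)
  case (step b)
  have "hord n (N + a) ((X (Suc b) - X b) + (X b - X a))"
    using step by (intro hord_add hord_mono[OF assms(1)[of b]]) simp_all
  then show ?case
    by simp
qed simp

text \<open>Hamiltonians are corrected one order at a time and summed.\<close>

lemma hord_successive_approximation:
  assumes base: "P 0 0"
    and step: "\<And>k \<chi>. hord n N \<chi> \<Longrightarrow> P k \<chi> \<Longrightarrow> \<exists>w. hord n (N + k) w \<and> P (Suc k) (\<chi> + w)"
  obtains \<chi> where "hord n N \<chi>"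
    "\<And>k. \<exists>\<chi>'. hord n N \<chi>' \<and> P k \<chi>' \<and> hord n (N + k) (\<chi> - \<chi>')"
proof -
  have "\<exists>X. \<forall>k. (hord n N (X k) \<and> P k (X k)) \<and> hord n (N + k) (X (Suc k) - X k)"
  proof (rule dependent_nat_choice)
    show "\<exists>\<chi>. hord n N \<chi> \<and> P 0 \<chi>"
      using base by (intro exI[of _ 0]) simp
  next
    fix \<chi> k
    assume \<chi>: "hord n N \<chi> \<and> P k \<chi>"
    then obtain w where "hord n (N + k) w" "P (Suc k) (\<chi> + w)"
      using step by blast
    then show "\<exists>\<chi>'. (hord n N \<chi>' \<and> P (Suc k) \<chi>') \<and> hord n (N + k) (\<chi>' - \<chi>)"
      using \<chi> by (intro exI[of _ "\<chi> + w"]) (auto intro!: hord_add elim: hord_mono)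
  qed
  then obtain X where X: "\<And>k. hord n N (X k)" "\<And>k. P k (X k)"
    "\<And>k. hord n (N + k) (X (Suc k) - X k)"
    by blast
  \<comment> \<open>Changes from step k on have order \<open>N + k\<close>, so a coefficient of
    weight W is constant from step W + 1 on; the \<open>Suc\<close> covers \<open>N = 0\<close>. The
    predicate itself is not passed to the limit, which each application does by continuity.\<close>
  define \<chi> where "\<chi> = mk_series (\<lambda>i j m. coef (X (Suc (2 * i + n * j + 2 * n * m))) i j m)"
  have lim: "hord n (N + k) (\<chi> - X k)" for k
    unfolding hord_def
  proof (intro allI impI)
    fix i j m
    assume ij: "0 < i + j" and lt: "2 * i + n * j + 2 * n * m < N + k"
    let ?W = "Suc (2 * i + n * j + 2 * n * m)"
    have "coef (X ?W) i j m = coef (X k) i j m"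
    proof (cases "k \<le> ?W")
      case True
      then show ?thesis
        using hord_telescope[OF X(3) True] ij lt unfolding hord_def coef_diff by fastforce
    next
      case False
      then show ?thesis
        using hord_telescope[OF X(3), of ?W k] ij unfolding hord_def coef_diff by fastforce
    qed
    then show "coef (\<chi> - X k) i j m = 0"
      by (simp add: \<chi>_def)
  qed
  have "hord n N (\<chi> - X 0 + X 0)"
    using lim[of 0] X(1)[of 0] by (intro hord_add) simp_all
  then show ?thesis
    using X(1,2) lim by (intro that[of \<chi>] exI[of _ "X _"] conjI) simp_all
qed


section \<open>Interpolating Hamiltonians\<close>

text \<open>The gradient determines a Hamiltonian up to functions of the parameter, hence
  \<open>hord\<close> in the conclusion.\<close>

lemma hordI:
  assumes "qord n (N + n) (diff_x f)" "qord n (N + 2) (diff_y f)"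
  shows "hord n (N + n + 2) f"
  unfolding hord_def
proof (intro allI impI)
  fix i j m
  assume ij: "0 < i + j" and lt: "2 * i + n * j + 2 * n * m < N + n + 2"
  show "coef f i j m = 0"
  proof (cases i)
    case (Suc i')
    then have "coef (diff_x f) i' j m = 0"
      using lt by (intro ord_geD[OF assms(1)]) simp
    then show ?thesis
      by (simp add: Suc One_nat_def)
  next
    case 0
    then obtain j' where j': "j = Suc j'"
      using ij by (cases j) auto
    then have "coef (diff_y f) i j' m = 0"
      using lt by (intro ord_geD[OF assms(2)]) simp
    then show ?thesis
      by (simp add: j' One_nat_def)
  qed
qed

text \<open>At leading order the difference of the maps is given by the gradient of the difference
  \<open>w\<close> of the Hamiltonians, so equal maps force the order of \<open>w\<close> up by one,
  again and again. As \<open>N\<close> is arbitrary, \<open>w\<close> depends on the parameter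
  alone.\<close>

lemma time_one_inj:
  assumes "0 < n" "hord n (n + 3) h" "hord n (n + 3) h'" "time_one h = time_one h'"
  shows "hord n N (h' - h)"
proof -
  define w where "w = h' - h"
  have "hord n (n + 3 + s) w" for s
  proof (induction s)
    case 0
    show ?case
      using assms by (simp add: w_def hord_diff)
  next
    case (Suc s)
    have w: "hord n (n + 2 + Suc s) w"
      using Suc by (simp add: numeral_3_eq_3)
    have eq: "exp_lie (h + w) var_x = exp_lie h var_x" "exp_lie (h + w) var_y = exp_lie h var_y"
      using assms(4) by (simp_all add: w_def time_one_def)
    have "qord n (2 + Suc s + 1) (lie w var_x)"
      using qord_exp_lie_perturb[OF assms(1,2) w zero_less_Suc ord_ge_var_x] ord_ge_uminus
      unfolding eq by fastforce
    moreover have "qord n (n + Suc s + 1) (lie w var_y)"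
      using qord_exp_lie_perturb[OF assms(1,2) w zero_less_Suc ord_ge_var_y] ord_ge_uminus
      unfolding eq by fastforce
    ultimately have "qord n (s + 2 + 2) (diff_y w)" "qord n (s + 2 + n) (diff_x w)"
      using ord_ge_uminus[of 2 n "2 * n" _ "- diff_x w"]
      by (simp_all add: lie_def bracket_x bracket_y add_ac One_nat_def)
    from hordI[OF this(2,1)] show ?case
      by (simp add: add_ac numeral_3_eq_3)
  qed
  from hord_mono[OF this[of N], of N] show ?thesis
    by (simp add: w_def)
qed

text \<open>The difference between an area-preserving map and a time-one map that approximates it is, at
  leading order, a divergence-free vector field; its Hamiltonian is the next correction.\<close>

lemma interpolation_step:
  assumes n: "0 < n" and \<chi>: "hord n (n + 3) \<chi>" and jac: "bracket X Y = 1" and s: "0 < s"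
    and X: "qord n (2 + s) (X - exp_lie \<chi> var_x)" and Y: "qord n (n + s) (Y - exp_lie \<chi> var_y)"
  obtains w where "hord n (n + 2 + s) w" "qord n (2 + s + 1) (X - exp_lie (\<chi> + w) var_x)"
    "qord n (n + s + 1) (Y - exp_lie (\<chi> + w) var_y)"
proof -
  define \<xi> where "\<xi> = X - exp_lie \<chi> var_x"
  define \<eta> where "\<eta> = Y - exp_lie \<chi> var_y"
  define X1 where "X1 = exp_lie \<chi> var_x - var_x"
  define Y1 where "Y1 = Y - var_y"
  have X1: "qord n 3 X1"
    using qord_exp_lie_Suc[OF ord_ge_var_x hord_add_3[OF n \<chi>]] by (simp add: X1_def)
  have "Y1 = \<eta> + (exp_lie \<chi> var_y - var_y)"
    by (simp add: Y1_def \<eta>_def)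
  moreover have "qord n (n + 1) \<eta>"
    using Y s unfolding \<eta>_def by (auto elim: ord_ge_mono_le)
  moreover have "qord n (n + 1) (exp_lie \<chi> var_y - var_y)"
    using qord_exp_lie_Suc[OF ord_ge_var_y hord_add_3[OF n \<chi>]] by simp
  ultimately have Y1: "qord n (n + 1) Y1"
    by (simp add: ord_ge_add)
  \<comment> \<open>Both pairs have bracket 1; expanding the difference around the identity leaves
    the divergence of \<open>(\<xi>, \<eta>)\<close> and terms of higher order.\<close>
  have "bracket \<xi> Y + bracket (exp_lie \<chi> var_x) \<eta> =
      bracket X Y - bracket (exp_lie \<chi> var_x) (exp_lie \<chi> var_y)"
    by (simp add: \<xi>_def \<eta>_def bracket_diff)
  also have "\<dots> = 0"
    by (simp add: jac exp_lie_bracket[OF n \<chi>, symmetric] exp_lie_1[OF n \<chi>])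
  finally have "bracket \<xi> (var_y + Y1) + bracket (var_x + X1) \<eta> = 0"
    by (simp add: X1_def Y1_def)
  then have "diff_x \<xi> + diff_y \<eta> = - (bracket \<xi> Y1 + bracket X1 \<eta>)"
    unfolding eq_neg_iff_add_eq_0
    by (simp add: bracket_add bracket_x bracket_anticommute[of \<xi> var_y] bracket_y add_ac)
  moreover have "qord n (s + 1) (bracket \<xi> Y1)"
    using qord_bracket[OF X[folded \<xi>_def] Y1] by (simp add: add_ac)
  moreover have "qord n (s + 1) (bracket X1 \<eta>)"
    using qord_bracket[OF X1 Y[folded \<eta>_def]] by (simp add: add_ac One_nat_def)
  ultimately have div: "qord n (s + 1) (diff_x \<xi> + diff_y \<eta>)"
    by (simp only: ord_ge_add ord_ge_uminus)
  \<comment> \<open>Integrating \<open>\<xi>\<close> in y makes \<open>diff_y w = \<xi>\<close>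
    exact, and the part free of y is chosen so that \<open>diff_x w = - \<eta>\<close> is exact at y
    = 0. Elsewhere the second equation follows from the divergence, up to higher order.\<close>
  define w where "w = mk_series (\<lambda>i j m.
    if j = 0 then (if i = 0 then 0 else - coef \<eta> (i - 1) 0 m / real i)
    else coef \<xi> i (j - 1) m / real j)"
  have wy: "diff_y w = \<xi>"
    by (rule series_eqI) (simp add: w_def)
  have wx: "qord n (n + s + 1) (diff_x w + \<eta>)"
    unfolding ord_ge_def
  proof (intro allI impI)
    fix i j m
    assume lt: "2 * i + n * j + 2 * n * m < n + s + 1"
    show "coef (diff_x w + \<eta>) i j m = 0"
    proof (cases j)
      case 0
      then show ?thesis
        by (simp add: w_def)
    next
      case (Suc j')
      then have "coef (diff_x \<xi> + diff_y \<eta>) i j' m = 0"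
        using lt by (intro ord_geD[OF div]) simp
      then have "(real i + 1) * coef \<xi> (Suc i) j' m + (real j' + 1) * coef \<eta> i (Suc j') m = 0"
        by (simp add: One_nat_def add.commute)
      then show ?thesis
        by (simp add: w_def Suc One_nat_def field_simps)
    qed
  qed
  have w: "hord n (n + 2 + s) w"
  proof -
    have "qord n (s + 2) (diff_y w)"
      using X by (simp add: wy \<xi>_def add_ac)
    moreover have "qord n (s + n) (diff_x w + \<eta> - \<eta>)"
      using wx Y by (intro ord_ge_diff) (auto elim: ord_ge_mono_le simp: \<eta>_def)
    ultimately show ?thesis
      using hordI[of n s w] by (simp add: add_ac)
  qed
  note perturb = qord_exp_lie_perturb[OF n \<chi> w s]
  have "qord n (2 + s + 1) (- (exp_lie (\<chi> + w) var_x - exp_lie \<chi> var_x - lie w var_x))"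
    by (intro ord_ge_uminus perturb ord_ge_var_x)
  then have 1: "qord n (2 + s + 1) (X - exp_lie (\<chi> + w) var_x)"
    by (simp add: lie_def bracket_x wy \<xi>_def)
  have "qord n (n + s + 1) ((diff_x w + \<eta>) - (exp_lie (\<chi> + w) var_y - exp_lie \<chi> var_y - lie w var_y))"
    by (intro ord_ge_diff wx perturb ord_ge_var_y)
  then have 2: "qord n (n + s + 1) (Y - exp_lie (\<chi> + w) var_y)"
    by (simp add: lie_def bracket_y \<eta>_def)
  from that[OF w 1 2] show ?thesis .
qed

text \<open>The closeness \<open>p\<close> of \<open>F\<close> to the identity is passed on to the
  Hamiltonian. A composition of time-one maps can thus be written as a single one with control of
  the order, without the Baker-Campbell-Hausdorff formula.\<close>

lemma interpolating_hamiltonian: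
  assumes n: "0 < n" and jac: "jacobian F = 1" and p: "0 < p"
    and X: "qord n (2 + p) (fst F - var_x)" and Y: "qord n (n + p) (snd F - var_y)"
  obtains \<chi> where "hord n (n + 2 + p) \<chi>" "time_one \<chi> = F"
proof -
  define P where "P = (\<lambda>k \<chi>. qord n (2 + p + k) (fst F - exp_lie \<chi> var_x) \<and>
    qord n (n + p + k) (snd F - exp_lie \<chi> var_y))"
  have weak: "hord n (n + 3) \<chi>" if "hord n (n + 2 + p) \<chi>" for \<chi>
    using that p by (auto elim: hord_mono)
  have base: "P 0 0"
    using X Y by (simp add: P_def exp_lie_fixed[OF n hord_0] lie_def bracket_def diff_x_simps
        diff_y_simps)
  obtain \<chi> where \<chi>: "hord n (n + 2 + p) \<chi>" "\<And>k. \<exists>\<chi>'. hord n (n + 2 + p) \<chi>' \<and>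
      P k \<chi>' \<and> hord n (n + 2 + p + k) (\<chi> - \<chi>')"
  proof (rule hord_successive_approximation[of P n "n + 2 + p", OF base])
    fix k \<chi>
    assume \<chi>: "hord n (n + 2 + p) \<chi>" and "P k \<chi>"
    then obtain w where "hord n (n + 2 + (p + k)) w"
      "qord n (2 + (p + k) + 1) (fst F - exp_lie (\<chi> + w) var_x)"
      "qord n (n + (p + k) + 1) (snd F - exp_lie (\<chi> + w) var_y)"
      using interpolation_step[OF n weak[OF \<chi>] jac[unfolded jacobian_bracket], of "p + k"] p
      by (auto simp: P_def add.assoc)
    then show "\<exists>w. hord n (n + 2 + p + k) w \<and> P (Suc k) (\<chi> + w)"
      by (intro exI[of _ w]) (simp add: P_def add_ac One_nat_def)
  qed (rule that)
  have "exp_lie \<chi> var_x = fst F \<and> exp_lie \<chi> var_y = snd F"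
  proof (intro conjI; rule qord_all_imp_eq)
    fix k
    obtain \<chi>' where \<chi>': "hord n (n + 2 + p) \<chi>'" "P k \<chi>'" "hord n (n + 2 + (p + k)) (\<chi> - \<chi>')"
      using \<chi>(2)[of k] by (auto simp: add.assoc)
    have pk: "0 < p + k"
      using p by simp
    note perturb = qord_exp_lie_perturb'[OF n weak[OF \<chi>'(1)] \<chi>'(3) pk]
    have "qord n k ((exp_lie \<chi> var_x - exp_lie \<chi>' var_x) - (fst F - exp_lie \<chi>' var_x))"
      using perturb[OF ord_ge_var_x] \<chi>'(2)
      by (intro ord_ge_diff[of _ _ _ _ "_ - _" "_ - _"]) (auto simp: P_def elim: ord_ge_mono_le)
    then show "qord n k (exp_lie \<chi> var_x - fst F)"
      by simp
    have "qord n k ((exp_lie \<chi> var_y - exp_lie \<chi>' var_y) - (snd F - exp_lie \<chi>' var_y))"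
      using perturb[OF ord_ge_var_y] \<chi>'(2)
      by (intro ord_ge_diff[of _ _ _ _ "_ - _" "_ - _"]) (auto simp: P_def elim: ord_ge_mono_le)
    then show "qord n k (exp_lie \<chi> var_y - snd F)"
      by simp
  qed
  then show ?thesis
    using that[OF \<chi>(1)] by (simp add: time_one_def)
qed

section \<open>The homological equation\<close>

text \<open>The case \<open>b = 0\<close> is included: the reduction to \<open>g_ham\<close> takes n
  = 3 and the coefficient of x^3, which may vanish.\<close>

definition leading :: "nat \<Rightarrow> real \<Rightarrow> series" where
  "leading n b = cst (1/2) * var_y ^ 2 + cst b * var_x ^ n"

lemma leading_monomial: "leading n b = cst (1/2) * monomial 0 2 0 + cst b * monomial n 0 0"
  by (simp add: leading_def monomial_def)

lemma qord_leading: "qord n (2 * n) (leading n b)"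
  unfolding leading_monomial by (intro ord_ge_add ord_ge_cst_mult ord_ge_monomial) auto

lemma diff_x_monomial: "diff_x (monomial p q r) = cst (real p) * monomial (p - 1) q r"
  by (rule series_eqI) (auto simp: coef_monomial)

lemma diff_y_monomial: "diff_y (monomial p q r) = cst (real q) * monomial p (q - 1) r"
  by (rule series_eqI) (auto simp: coef_monomial)

lemma diff_x_leading: "diff_x (leading n b) = cst (n * b) * monomial (n - 1) 0 0"
  and diff_y_leading: "diff_y (leading n b) = var_y"
  by (simp_all add: leading_monomial diff_x_simps diff_y_simps diff_x_monomial diff_y_monomial
      var_y_monomial cst_mult[symmetric] mult.assoc[symmetric] mult.commute One_nat_def)

lemma bracket_leading:
  "bracket w (leading n b) = diff_x w * var_y - cst (n * b) * (diff_y w * monomial (n - 1) 0 0)"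
  by (simp add: bracket_def diff_x_leading diff_y_leading mult_ac)

lemma coef_bracket_leading:
  "coef (bracket w (leading n b)) i j m =
    (if j = 0 then 0 else real (i + 1) * coef w (i + 1) (j - 1) m) -
    (if n - 1 \<le> i then n * b * real (j + 1) * coef w (i - (n - 1)) (j + 1) m else 0)"
  unfolding bracket_leading
  by (simp add: mult.commute[of _ var_y] mult.commute[of _ "monomial _ _ _"] coef_monomial_mult)

lemma bracket_monomial_leading:
  "bracket (monomial p q r) (leading n b) =
    cst (real p) * monomial (p - 1) (q + 1) r - cst (n * b * q) * monomial (p + (n - 1)) (q - 1) r"
  by (simp add: bracket_leading diff_x_monomial diff_y_monomial var_y_monomial mult.assoc
      monomial_mult cst_mult)

text \<open>For \<open>b \<noteq> 0\<close> the monomials \<open>x\<^sup>i\<close> with \<open>i \<equiv> -1 (mod n)\<close> are removed along with all those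
  divisible by \<open>y\<close>.\<close>

definition reduced :: "nat \<Rightarrow> real \<Rightarrow> nat \<Rightarrow> nat \<Rightarrow> bool" where
  "reduced n b i j \<longleftrightarrow> j = 0 \<and> (b \<noteq> 0 \<longrightarrow> \<not> n dvd i + 1)"

text \<open>The bracket with a part of weight \<open>2 * n\<close> raises the order by
  \<open>2 * n - (n + 2) = n - 2\<close>, so a solution of order \<open>q + 2\<close> matches a
  right-hand side of order \<open>q + n\<close>.\<close>

definition solvable :: "nat \<Rightarrow> real \<Rightarrow> nat \<Rightarrow> series \<Rightarrow> bool" where
  "solvable n b q f \<longleftrightarrow> (\<exists>w. qord n (q + 2) w \<and>
     (\<forall>i j m. coef (f - bracket w (leading n b)) i j m \<noteq> 0 \<longrightarrow> reduced n b i j))"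

lemma solvable_add:
  assumes "solvable n b q f" "solvable n b q g"
  shows "solvable n b q (f + g)"
proof -
  obtain v w where v: "qord n (q + 2) v" "\<And>i j m. coef (f - bracket v (leading n b)) i j m \<noteq> 0 \<Longrightarrow> reduced n b i j"
    and w: "qord n (q + 2) w" "\<And>i j m. coef (g - bracket w (leading n b)) i j m \<noteq> 0 \<Longrightarrow> reduced n b i j"
    using assms unfolding solvable_def by blast
  have "coef (f + g - bracket (v + w) (leading n b)) i j m =
      coef (f - bracket v (leading n b)) i j m + coef (g - bracket w (leading n b)) i j m" for i j m
    by (simp add: bracket_add)
  then show ?thesis
    unfolding solvable_def using v w by (intro exI[of _ "v + w"]) (metis add_0 ord_ge_add)
qed

lemma solvable_cst_mult:
  assumes "solvable n b q f"
  shows "solvable n b q (cst c * f)"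
proof -
  obtain w where w: "qord n (q + 2) w" "\<And>i j m. coef (f - bracket w (leading n b)) i j m \<noteq> 0 \<Longrightarrow> reduced n b i j"
    using assms unfolding solvable_def by blast
  have "coef (cst c * f - bracket (cst c * w) (leading n b)) i j m =
      c * coef (f - bracket w (leading n b)) i j m" for i j m
    by (simp add: bracket_cst_mult right_diff_distrib)
  then show ?thesis
    unfolding solvable_def using w by (intro exI[of _ "cst c * w"]) (metis mult_zero_right ord_ge_cst_mult)
qed

lemma solvable_0: "solvable n b q 0"
  by (auto simp: solvable_def bracket_def diff_x_simps diff_y_simps intro!: exI[of _ 0])

lemma solvable_sum: "(\<And>k. k \<in> A \<Longrightarrow> solvable n b q (f k)) \<Longrightarrow> solvable n b q (sum f A)"
  by (induction A rule: infinite_finite_induct) (simp_all add: solvable_0 solvable_add)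

lemma solvable_bracket: "qord n (q + 2) w \<Longrightarrow> solvable n b q (bracket w (leading n b))"
  by (auto simp: solvable_def)

lemma solvable_reduced_monomial: "reduced n b i j \<Longrightarrow> solvable n b q (monomial i j m)"
  unfolding solvable_def
  by (intro exI[of _ 0]) (simp add: bracket_def diff_x_simps diff_y_simps coef_monomial)

text \<open>The bracket of a monomial with the leading part relates two monomials of equal weight; if the
  one is solvable, so is the other.\<close>

lemma solvable_transfer:
  assumes "bracket w (leading n b) = cst c * f + g" "qord n (q + 2) w" "c \<noteq> 0" "solvable n b q g"
  shows "solvable n b q f"
proof -
  have "f = cst (1 / c) * (bracket w (leading n b) + cst (- 1) * g)"
    using assms(3) by (simp add: assms(1) cst_uminus mult.assoc[symmetric] cst_mult[symmetric])
  moreover have "solvable n b q \<dots>"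
    using assms by (intro solvable_cst_mult solvable_add solvable_bracket)
  ultimately show ?thesis
    by simp
qed

text \<open>The bracket of x^(n+nl) y^(j+1) trades x^(n-1+n(l+1)) y^j for x^(n-1+nl) y^(j+2),
  dividing by b. The chain ends with a pure power of y, whose bracket is a single monomial.\<close>

lemma solvable_power_minus_one:
  assumes n: "2 \<le> n" and b: "b \<noteq> 0"
  shows "q + n \<le> 2 * (n - 1 + n * l) + n * j + 2 * n * m \<Longrightarrow> solvable n b q (monomial (n - 1 + n * l) j m)"
proof (induction l arbitrary: j)
  case 0
  have "bracket (monomial 0 (j + 1) m) (leading n b) =
      cst (- (n * b * (j + 1))) * monomial (n - 1 + n * 0) j m + 0"
    by (simp add: bracket_monomial_leading cst_uminus del: of_nat_add)
  then show ?case
  proof (rule solvable_transfer)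
    show "qord n (q + 2) (monomial 0 (j + 1) m)"
      using 0 n by (intro ord_ge_monomial) (simp add: algebra_simps)
    show "- (n * b * (j + 1)) \<noteq> 0"
      using b n by (simp del: of_nat_add)
  qed (rule solvable_0)
next
  case (Suc l)
  let ?w = "monomial (n + n * l) (j + 1) m"
  let ?g = "cst (real (n + n * l)) * monomial (n - 1 + n * l) (j + 2) m"
  have "bracket ?w (leading n b) = cst (- (n * b * (j + 1))) * monomial (n - 1 + n * Suc l) j m + ?g"
    using n by (simp add: bracket_monomial_leading cst_uminus add_ac One_nat_def del: of_nat_add of_nat_mult)
  then show ?case
  proof (rule solvable_transfer)
    show "qord n (q + 2) ?w"
      using Suc.prems n by (intro ord_ge_monomial) (simp add: algebra_simps)
    show "solvable n b q ?g"
      using Suc.prems by (intro solvable_cst_mult Suc.IH) (simp add: algebra_simps)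
  qed (use n b in auto)
qed

text \<open>The bracket of x^(i+1) y^(j-1) trades x^i y^j for x^(i+n) y^(j-2), and for j = 1 the
  second term is absent. What remains is a pure power of x, either reduced or of the kind treated in
  the previous lemma.\<close>

lemma solvable_monomial:
  assumes n: "2 \<le> n"
  shows "q + n \<le> 2 * i + n * j + 2 * n * m \<Longrightarrow> solvable n b q (monomial i j m)"
proof (induction j arbitrary: i rule: less_induct)
  case (less j)
  show ?case
  proof (cases j)
    case 0
    show ?thesis
    proof (cases "reduced n b i j")
      case False
      then obtain l' where l': "i + 1 = n * l'" and b: "b \<noteq> 0"
        using 0 by (auto simp: reduced_def)
      then obtain l where l: "i + 1 = n * Suc l"
        by (cases l') (auto intro: that)
      then have "i = n - 1 + n * l"
        using n by simp
      then show ?thesis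
        using solvable_power_minus_one[OF n b] less.prems by blast
    qed (rule solvable_reduced_monomial)
  next
    case (Suc j')
    let ?w = "monomial (i + 1) j' m"
    let ?g = "cst (- (n * b * j')) * monomial (i + n) (j' - 1) m"
    have "bracket ?w (leading n b) = cst (real (i + 1)) * monomial i j m + ?g"
      using n by (simp add: bracket_monomial_leading cst_uminus Suc One_nat_def del: of_nat_add of_nat_mult)
    then show ?thesis
    proof (rule solvable_transfer)
      show "qord n (q + 2) ?w"
        using less.prems by (intro ord_ge_monomial) (simp add: Suc)
      show "solvable n b q ?g"
      proof (cases j')
        case (Suc j'')
        then show ?thesis
          using less.prems \<open>j = Suc j'\<close> by (intro solvable_cst_mult less.IH) (auto simp: algebra_simps)
      qed (simp add: solvable_0)
    qed simp
  qed
qed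

text \<open>Only the homogeneous component of weight \<open>q + n\<close> is treated. With positive
  weights it is a polynomial, so finitely many monomial solutions suffice.\<close>

lemma homological_equation:
  assumes n: "2 \<le> n"
  obtains w where "qord n (q + 2) w"
    "\<And>i j m. 2 * i + n * j + 2 * n * m = q + n \<Longrightarrow>
       coef (G - bracket w (leading n b)) i j m \<noteq> 0 \<Longrightarrow> reduced n b i j"
proof -
  define H where "H = mk_series (\<lambda>i j m. if 2 * i + n * j + 2 * n * m = q + n then coef G i j m else 0)"
  have "H = truncation (q + n + 1) H"
  proof (rule series_eqI)
    fix i j m
    have "i < q + n + 1 \<and> j < q + n + 1 \<and> m < q + n + 1" if "2 * i + n * j + 2 * n * m = q + n"
    proof -
      have "j \<le> n * j" "m \<le> 2 * n * m"
        using n by simp_all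
      then show ?thesis
        using that by linarith
    qed
    then show "coef H i j m = coef (truncation (q + n + 1) H) i j m"
      by (auto simp: coef_truncation H_def)
  qed
  moreover have "solvable n b q (truncation (q + n + 1) H)"
    unfolding truncation_def
  proof (intro solvable_sum)
    fix i j m
    show "solvable n b q (cst (coef H i j m) * monomial i j m)"
    proof (cases "2 * i + n * j + 2 * n * m = q + n")
      case True
      then show ?thesis
        by (intro solvable_cst_mult solvable_monomial[OF n]) simp
    qed (simp add: H_def solvable_0)
  qed
  ultimately obtain w where w: "qord n (q + 2) w"
    "\<And>i j m. coef (H - bracket w (leading n b)) i j m \<noteq> 0 \<Longrightarrow> reduced n b i j"
    unfolding solvable_def by auto
  show ?thesis
  proof (rule that[OF w(1)])
    fix i j m
    assume "2 * i + n * j + 2 * n * m = q + n" "coef (G - bracket w (leading n b)) i j m \<noteq> 0"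
    then show "reduced n b i j"
      using w(2)[of i j m] by (simp add: H_def)
  qed
qed


section \<open>Normal form\<close>

definition normal_upto :: "nat \<Rightarrow> real \<Rightarrow> nat \<Rightarrow> series \<Rightarrow> bool" where
  "normal_upto n b M f \<longleftrightarrow> (\<forall>i j m. 2 * n < 2 * i + n * j + 2 * n * m \<longrightarrow>
     2 * i + n * j + 2 * n * m < M \<longrightarrow> coef f i j m \<noteq> 0 \<longrightarrow> reduced n b i j)"

text \<open>Weights up to \<open>2 * n\<close> are prescribed by the leading part, whose y^2 is not
  reduced; the condition on monomials therefore starts above.\<close>

definition normal :: "nat \<Rightarrow> real \<Rightarrow> series \<Rightarrow> bool" where
  "normal n b f \<longleftrightarrow> qord n (2 * n + 1) (f - leading n b) \<and>
     (\<forall>i j m. 2 * n < 2 * i + n * j + 2 * n * m \<longrightarrow> coef f i j m \<noteq> 0 \<longrightarrow> reduced n b i j)"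

lemma qord_of_leading: "qord n (2 * n + 1) (g - leading n b) \<Longrightarrow> qord n (2 * n) g"
  using ord_ge_add[OF ord_ge_mono_le[of 2 n "2 * n" "2 * n + 1" "g - leading n b" "2 * n"]
      qord_leading[of n b]] by simp

lemma normalization_step:
  assumes n: "2 \<le> n" and g: "qord n (2 * n + 1) (g - leading n b)"
    and \<chi>: "hord n (n + 3) \<chi>" and normal: "normal_upto n b (2 * n + 1 + k) (exp_lie \<chi> g)"
  obtains w where "hord n (n + 3 + k) w" "normal_upto n b (2 * n + 1 + Suc k) (exp_lie (\<chi> + w) g)"
proof -
  let ?G = "exp_lie \<chi> g"
  \<comment> \<open>The equation is solved at \<open>q + n = 2 * n + 1 + k\<close>, the first weight
    that need not be normal yet.\<close>
  obtain w where w: "qord n (n + 1 + k + 2) w"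
    "\<And>i j m. 2 * i + n * j + 2 * n * m = n + 1 + k + n \<Longrightarrow>
       coef (?G - bracket w (leading n b)) i j m \<noteq> 0 \<Longrightarrow> reduced n b i j"
    using homological_equation[OF n, where q = "n + 1 + k" and G = ?G and b = b] by metis
  have hw: "hord n (n + 2 + (k + 1)) w"
    using qord_imp_hord[OF w(1)] by (simp add: add_ac)
  have n0: "0 < n" and k0: "0 < k + 1"
    using n by simp_all
  have 1: "qord n (2 * n + k + 2) (exp_lie (\<chi> + w) g - ?G - lie w g)"
    using qord_exp_lie_perturb[OF n0 \<chi> hw k0 qord_of_leading[OF g]] by (simp add: add_ac)
  have 2: "qord n (2 * n + k + 2) (bracket w (g - leading n b))"
    using qord_bracket[OF w(1) g] by (rule ord_ge_mono_le) simp
  have 3: "qord n (2 * n + k + 1) (bracket w (leading n b))"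
    using qord_bracket[OF w(1) qord_leading] by (rule ord_ge_mono_le) simp
  \<comment> \<open>As \<open>lie w g\<close> is minus the bracket of \<open>w\<close> with
    \<open>g\<close>, adding \<open>w\<close> to the Hamiltonian subtracts the bracket with the
    leading part, up to higher order.\<close>
  have "exp_lie (\<chi> + w) g - (?G - bracket w (leading n b)) =
      (exp_lie (\<chi> + w) g - ?G - lie w g) - bracket w (g - leading n b)"
    by (simp add: lie_def bracket_anticommute[of g w] bracket_diff)
  then have 4: "qord n (2 * n + k + 2) (exp_lie (\<chi> + w) g - (?G - bracket w (leading n b)))"
    using ord_ge_diff[OF 1 2] by (simp only:)
  have "normal_upto n b (2 * n + 1 + Suc k) (exp_lie (\<chi> + w) g)"
    unfolding normal_upto_def
  proof (intro allI impI)
    fix i j m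
    let ?W = "2 * i + n * j + 2 * n * m"
    assume gt: "2 * n < ?W" and lt: "?W < 2 * n + 1 + Suc k" and nz: "coef (exp_lie (\<chi> + w) g) i j m \<noteq> 0"
    then have nz': "coef (?G - bracket w (leading n b)) i j m \<noteq> 0"
      using ord_geD[OF 4, of i j m] by simp
    show "reduced n b i j"
    proof (cases "?W = n + 1 + k + n")
      case True
      then show ?thesis
        using w(2) nz' by blast
    next
      case False
      then have lt': "?W < 2 * n + k + 1"
        using lt by simp
      then have "coef ?G i j m \<noteq> 0"
        using nz' ord_geD[OF 3, of i j m] by simp
      then show ?thesis
        using normal gt lt' by (auto simp: normal_upto_def add_ac)
    qed
  qed
  moreover have "hord n (n + 3 + k) w"
    using hw by (simp add: numeral_3_eq_3 numeral_2_eq_2 One_nat_def)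
  ultimately show ?thesis
    by (rule that[rotated])
qed

lemma normalizing_hamiltonian:
  assumes n: "2 \<le> n" and g: "qord n (2 * n + 1) (g - leading n b)"
  obtains \<chi> where "hord n (n + 3) \<chi>" "normal n b (exp_lie \<chi> g)"
proof -
  have n0: "0 < n"
    using n by simp
  define P where "P = (\<lambda>k \<chi>. normal_upto n b (2 * n + 1 + k) (exp_lie \<chi> g))"
  have base: "P 0 0"
    by (simp add: P_def normal_upto_def)
  obtain \<chi> where \<chi>: "hord n (n + 3) \<chi>" "\<And>k. \<exists>\<chi>'. hord n (n + 3) \<chi>' \<and>
      P k \<chi>' \<and> hord n (n + 3 + k) (\<chi> - \<chi>')"
  proof (rule hord_successive_approximation[of P n "n + 3", OF base])
    fix k \<chi>
    assume "hord n (n + 3) \<chi>" "P k \<chi>"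
    then show "\<exists>w. hord n (n + 3 + k) w \<and> P (Suc k) (\<chi> + w)"
      using normalization_step[OF n g] unfolding P_def by metis
  qed (rule that)
  have "qord n (2 * n + 1) (exp_lie \<chi> g - g)"
    using qord_exp_lie_Suc[OF qord_of_leading[OF g] hord_add_3[OF n0 \<chi>(1)]] by simp
  then have "qord n (2 * n + 1) ((exp_lie \<chi> g - g) + (g - leading n b))"
    by (rule ord_ge_add[OF _ g])
  moreover have "reduced n b i j"
    if gt: "2 * n < 2 * i + n * j + 2 * n * m" and nz: "coef (exp_lie \<chi> g) i j m \<noteq> 0" for i j m
  proof -
    define k where "k = 2 * i + n * j + 2 * n * m"
    obtain \<chi>' where \<chi>': "hord n (n + 3) \<chi>'" "P k \<chi>'" "hord n (n + 2 + (k + 1)) (\<chi> - \<chi>')"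
      using \<chi>(2)[of k] by (auto simp: numeral_3_eq_3 numeral_2_eq_2 One_nat_def)
    have "qord n (2 * n + (k + 1)) (exp_lie (\<chi>' + (\<chi> - \<chi>')) g - exp_lie \<chi>' g)"
      by (rule qord_exp_lie_perturb'[OF n0 \<chi>'(1,3) _ qord_of_leading[OF g]]) simp
    then have "coef (exp_lie \<chi>' g) i j m \<noteq> 0"
      using nz ord_geD[of 2 n "2 * n" "2 * n + (k + 1)" _ i j m] by (fastforce simp: k_def)
    then show ?thesis
      using \<chi>'(2) gt by (auto simp: P_def normal_upto_def k_def)
  qed
  ultimately have "normal n b (exp_lie \<chi> g)"
    by (auto simp: normal_def)
  with \<chi>(1) show ?thesis
    by (rule that)
qed


section \<open>Uniqueness of the normal form\<close>

text \<open>The vanishing of the mixed coefficients of the bracket links the coefficient of \<chi>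
  at (I, J) to that at (I - n, J + 2), so each chain vanishes with one member. If n does not divide
  I, the chain meets 0 < I < n, where the second term of the bracket is absent. If n divides I and J
  is odd, it meets J = 1, whose image is a nonzero multiple of a power of x that
  \<open>reduced\<close> excludes. If n divides I and J is even, it ends on the axis I = 0; this is
  the only freedom, and the last hypothesis removes it.\<close>

lemma bracket_leading_kernel:
  assumes n: "2 \<le> n" and b: "b \<noteq> 0" and \<chi>: "hord n (n + 2 + p) \<chi>"
    and red: "\<And>i j m. 2 * i + n * j + 2 * n * m = 2 * n + p \<Longrightarrow>
      coef (bracket \<chi> (leading n b)) i j m \<noteq> 0 \<Longrightarrow> reduced n b i j"
    and even: "\<And>a m. 0 < a \<Longrightarrow> 2 * n * a + 2 * n * m = n + 2 + p \<Longrightarrow> coef \<chi> 0 (2 * a) m = 0"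
  shows "hord n (n + 3 + p) \<chi>"
proof -
  have small: "coef \<chi> I J m = 0" if "2 * I + n * J + 2 * n * m = n + 2 + p" "0 < I" "I < n" for I J m
  proof -
    have "2 * (I - 1) + n * (J + 1) + 2 * n * m = 2 * n + p"
      using that by (cases I) (simp_all add: algebra_simps)
    from red[OF this] have "coef (bracket \<chi> (leading n b)) (I - 1) (J + 1) m = 0"
      by (auto simp: reduced_def)
    moreover have "\<not> n - 1 \<le> I - 1" "real (I - 1 + 1) = real I" "I - 1 + 1 = I"
      using that by auto
    ultimately show ?thesis
      using that by (simp add: coef_bracket_leading)
  qed
  have rec: "real I * coef \<chi> I J m = n * b * (J + 2) * coef \<chi> (I - n) (J + 2) m"
    if "2 * I + n * J + 2 * n * m = n + 2 + p" "n \<le> I" for I J m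
  proof -
    have "2 * (I - 1) + n * (J + 1) + 2 * n * m = 2 * n + p"
      using that n by (cases I) (simp_all add: algebra_simps)
    from red[OF this] have "coef (bracket \<chi> (leading n b)) (I - 1) (J + 1) m = 0"
      by (auto simp: reduced_def)
    moreover have "real (I - 1 + 1) = real I" "I - 1 + 1 = I" "n - 1 \<le> I - 1"
      "I - 1 - (n - 1) = I - n" "J + 1 - 1 = J" "J + 1 + 1 = J + 2"
      using that n by simp_all
    ultimately show ?thesis
      unfolding coef_bracket_leading by simp
  qed
  have odd: "coef \<chi> (n * l) (2 * t + 1) m = 0"
    if "2 * (n * l) + n * (2 * t + 1) + 2 * n * m = n + 2 + p" for l t m
    using that
  proof (induction t arbitrary: l)
    case 0
    then have "2 * (n * l + (n - 1)) + n * 0 + 2 * n * m = 2 * n + p"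
      using n by simp
    moreover have "\<not> reduced n b (n * l + (n - 1)) 0"
      using b n by (simp add: reduced_def)
    ultimately have "coef (bracket \<chi> (leading n b)) (n * l + (n - 1)) 0 m = 0"
      using red by blast
    then show ?case
      using n b by (cases n) (simp_all add: coef_bracket_leading)
  next
    case (Suc t)
    have w: "2 * (n * Suc l) + n * (2 * t + 1) + 2 * n * m = n + 2 + p"
      using Suc.prems by (simp add: algebra_simps)
    have "n * b * (2 * t + 1 + 2) * coef \<chi> (n * Suc l - n) (2 * t + 1 + 2) m = 0"
      using rec[OF w] Suc.IH[OF w] by simp
    then have "coef \<chi> (n * l) (2 * t + 1 + 2) m = 0"
      using n b by (simp add: add_eq_0_iff)
    then show ?case
      by (simp add: add_ac numeral_2_eq_2)
  qed
  have zero: "coef \<chi> I J m = 0" if "2 * I + n * J + 2 * n * m = n + 2 + p" "0 < I + J" for I J m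
    using that
  proof (induction I arbitrary: J rule: less_induct)
    case (less I)
    show ?case
    proof (cases "I = 0")
      case True
      show ?thesis
      proof (cases "even J")
        case e: True
        then obtain a where "J = 2 * a"
          by (elim evenE)
        then show ?thesis
          using less.prems True even[of a m] by (simp add: mult_ac)
      next
        case False
        then obtain t where "J = 2 * t + 1"
          by (elim oddE)
        then show ?thesis
          using less.prems True odd[of 0 t m] by simp
      qed
    next
      case False
      show ?thesis
      proof (cases "I < n")
        case True
        then show ?thesis
          using small less.prems False by simp
      next
        case ge: False
        have "2 * (I - n) + n * (J + 2) + 2 * n * m = n + 2 + p"
          using less.prems ge by (simp add: algebra_simps)
        then have "coef \<chi> (I - n) (J + 2) m = 0"
          using ge False n by (intro less.IH) simp_all
        then show ?thesis
          using rec[of I J m] less.prems ge False by simp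
      qed
    qed
  qed
  show ?thesis
    unfolding hord_def
  proof (intro allI impI)
    fix i j m
    assume "0 < i + j" "2 * i + n * j + 2 * n * m < n + 3 + p"
    then show "coef \<chi> i j m = 0"
      using zero[of i j m] \<chi> unfolding hord_def
      by (cases "2 * i + n * j + 2 * n * m = n + 2 + p") auto
  qed
qed

section \<open>Functions of the Hamiltonian, and the induction for uniqueness\<close>

lemma lie_cst: "lie h (cst c) = 0"
  by (simp add: lie_def bracket_def)

lemma power_add_x_mult: "\<exists>g'. (f + var_x * g) ^ k = f ^ k + var_x * g'"
proof (induction k)
  case 0
  show ?case
    by (intro exI[of _ 0]) simp
next
  case (Suc k)
  then obtain g' where "(f + var_x * g) ^ k = f ^ k + var_x * g'"
    by blast
  then show ?case
    by (intro exI[of _ "f * g' + g * (f ^ k + var_x * g')"]) (simp add: algebra_simps)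
qed

lemma ord_ge_power_diff:
  assumes "ord_ge a b c N f" "ord_ge a b c N g" "ord_ge a b c (N + 1) (f - g)"
  shows "ord_ge a b c (N * k + 1) (f ^ k - g ^ k)"
proof (induction k)
  case (Suc k)
  have "ord_ge a b c (N + (N * k + 1)) (f * (f ^ k - g ^ k))"
    "ord_ge a b c ((N + 1) + N * k) ((f - g) * g ^ k)"
    using Suc assms by (simp_all only: ord_ge_mult ord_ge_power)
  then have "ord_ge a b c (N * Suc k + 1) (f * (f ^ k - g ^ k) + (f - g) * g ^ k)"
    by (intro ord_ge_add) (simp_all add: add_ac)
  then show ?case
    by (simp add: algebra_simps)
qed simp

text \<open>In weight \<open>2 * n * a\<close> only the leading part of \<open>h\<close> counts, and
  modulo x its double is y^2.\<close>

lemma coef_energy_power: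
  assumes n: "0 < n" and h: "qord n (2 * n + 1) (h - leading n b)"
    and w: "n * j + 2 * n * m = 2 * n * a"
  shows "coef ((cst 2 * h) ^ a) 0 j m = (if j = 2 * a \<and> m = 0 then 1 else 0)"
proof -
  have "qord n (2 * n + 1) (cst 2 * (h - leading n b))"
    by (intro ord_ge_cst_mult h)
  then have "qord n (2 * n + 1) (cst 2 * h - cst 2 * leading n b)"
    by (simp add: right_diff_distrib)
  then have "qord n (2 * n * a + 1) ((cst 2 * h) ^ a - (cst 2 * leading n b) ^ a)"
    by (intro ord_ge_power_diff ord_ge_cst_mult qord_of_leading[OF h] qord_leading)
  then have eq: "coef ((cst 2 * h) ^ a) 0 j m = coef ((cst 2 * leading n b) ^ a) 0 j m"
    using ord_geD[of 2 n "2 * n" "2 * n * a + 1" _ 0 j m] w by fastforce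
  have "cst 2 * leading n b = monomial 0 2 0 + var_x * (cst (2 * b) * monomial (n - 1) 0 0)"
    using n by (intro series_eqI) (auto simp: leading_monomial coef_monomial)
  then obtain g where "(cst 2 * leading n b) ^ a = monomial 0 2 0 ^ a + var_x * g"
    using power_add_x_mult by metis
  moreover have "monomial 0 2 0 ^ a = monomial 0 (2 * a) 0"
    by (simp add: monomial_def power_mult)
  ultimately show ?thesis
    by (simp add: eq coef_monomial)
qed

text \<open>Functions of \<open>h\<close> and the parameter commute with \<open>h\<close>. As \<open>(2h)\<^sup>a\<close> has the leading term \<open>y\<^sup>2\<^sup>a\<close>
  on the axis \<open>x = 0\<close>, their leading coefficients there can be prescribed.\<close>

lemma commuting_hamiltonian:
  assumes n: "0 < n" and h: "qord n (2 * n + 1) (h - leading n b)"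
  obtains W where "qord n N W" "lie W h = 0"
    "\<And>a m. 0 < a \<Longrightarrow> 2 * n * a + 2 * n * m = N \<Longrightarrow> coef W 0 (2 * a) m = c a m"
proof -
  define t where "t = (\<lambda>a m. if 0 < a \<and> 2 * n * a + 2 * n * m = N then c a m else 0)"
  define W where "W = (\<Sum>a\<le>N. \<Sum>m\<le>N. cst (t a m) * ((cst 2 * h) ^ a * var_eps ^ m))"
  have h2: "qord n (2 * n) (cst 2 * h)"
    by (intro ord_ge_cst_mult qord_of_leading[OF h])
  have "qord n N (cst (t a m) * ((cst 2 * h) ^ a * var_eps ^ m))" for a m
  proof (cases "2 * n * a + 2 * n * m = N")
    case True
    then show ?thesis
      using ord_ge_mult[OF ord_ge_power[OF h2, of a] ord_ge_power[OF ord_ge_var_eps[of 2 n "2 * n"], of m]]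
      by (intro ord_ge_cst_mult) simp
  qed (simp add: t_def)
  then have 1: "qord n N W"
    unfolding W_def by (intro ord_ge_sum)
  have "lie h h = 0"
    by (simp add: lie_def)
  then have "lie h W = 0"
    by (simp add: W_def cont_lin_sum[OF cont_lin_lie] lie_mult lie_cst
        derivation_power[OF derivation_lie])
  then have 2: "lie W h = 0"
    by (simp add: lie_def bracket_anticommute[of h W])
  have 3: "coef W 0 (2 * a) m = c a m" if a: "0 < a" "2 * n * a + 2 * n * m = N" for a m
  proof -
    have le: "a \<le> N" "m \<le> N"
    proof -
      have "a \<le> 2 * n * a" "m \<le> 2 * n * m"
        using n by simp_all
      then show "a \<le> N" "m \<le> N"
        using a by linarith+
    qed
    have summand: "coef (cst (t a' m') * ((cst 2 * h) ^ a' * var_eps ^ m')) 0 (2 * a) m =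
        (if a' = a then if m' = m then t a m else 0 else 0)" for a' m'
    proof (cases "0 < a' \<and> 2 * n * a' + 2 * n * m' = N \<and> m' \<le> m")
      case True
      have "n * (2 * a) + 2 * n * (m - m') = 2 * n * a'"
        using True a by (auto simp: algebra_simps dest!: le_Suc_ex)
      from coef_energy_power[OF n h this] show ?thesis
        using True coef_monomial_mult[of 0 0 m' "(cst 2 * h) ^ a'" 0 "2 * a" m]
        by (auto simp: monomial_def mult.commute)
    next
      case False
      then show ?thesis
        using coef_monomial_mult[of 0 0 m' "(cst 2 * h) ^ a'" 0 "2 * a" m] a
        by (auto simp: t_def monomial_def mult.commute)
    qed
    have "coef W 0 (2 * a) m = (\<Sum>a'\<le>N. if a' = a then t a m else 0)"
      unfolding W_def coef_sum summand using le by (intro sum.cong refl) simp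
    then show ?thesis
      using le a by (simp add: t_def)
  qed
  from that[OF 1 2 3] show ?thesis .
qed

text \<open>In weight \<open>2 * n + p\<close> the bracket of \<chi> with the leading part is
  \<open>h - h'\<close>, hence reduced. The function \<open>W\<close> commutes with \<open>h\<close>
  and matches \<chi> on the axis x = 0, so \<open>\<chi> - W\<close> has higher order by the kernel
  lemma. Composing the time-one maps of \<open>- W\<close> and \<chi> gives a map with the same
  effect on \<open>h\<close>, and its Hamiltonian has higher order.\<close>

lemma uniqueness_step:
  assumes n: "2 \<le> n" and b: "b \<noteq> 0" and h: "normal n b h" and h': "normal n b h'"
    and p: "0 < p" and \<chi>: "hord n (n + 2 + p) \<chi>"
    and eq: "\<And>i j m. 0 < i + j \<Longrightarrow> coef (exp_lie \<chi> h) i j m = coef h' i j m"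
  obtains \<chi>' where "hord n (n + 2 + (p + 1)) \<chi>'" "exp_lie \<chi>' h = exp_lie \<chi> h"
    "hord n (2 * n + p + 1) (h' - h)"
proof -
  have n0: "0 < n"
    using n by simp
  have \<chi>3: "hord n (n + 3) \<chi>"
    using \<chi> p by (auto elim: hord_mono)
  have h0: "qord n (2 * n + 1) (h - leading n b)" "qord n (2 * n + 1) (h' - leading n b)"
    using h h' by (auto simp: normal_def)
  note hq = qord_of_leading[OF h0(1)]
  have "qord n (2 * n + p + 1) (exp_lie \<chi> h - h - lie \<chi> h)"
    using qord_exp_lie_linear[OF hq \<chi> p] p by (auto elim: ord_ge_mono_le)
  moreover have "qord n (2 * n + p + 1) (lie \<chi> (h - leading n b))"
    using qord_lie[OF h0(1) \<chi>] by (simp add: add_ac)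
  ultimately have "qord n (2 * n + p + 1) (exp_lie \<chi> h - h - lie \<chi> h + lie \<chi> (h - leading n b))"
    by (rule ord_ge_add)
  moreover have "bracket \<chi> (leading n b) = - lie \<chi> (leading n b)"
    unfolding lie_def by (rule bracket_anticommute)
  ultimately have lin: "qord n (2 * n + p + 1) (exp_lie \<chi> h - h + bracket \<chi> (leading n b))"
    by (simp add: lie_simps algebra_simps)
  have coef_T: "coef (bracket \<chi> (leading n b)) i j m = coef h i j m - coef h' i j m"
    if "2 * i + n * j + 2 * n * m = 2 * n + p" "0 < i + j" for i j m
    using ord_geD[OF lin, of i j m] that eq[of i j m] by simp
  have red: "reduced n b i j"
    if w: "2 * i + n * j + 2 * n * m = 2 * n + p" and nz: "coef (bracket \<chi> (leading n b)) i j m \<noteq> 0"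
    for i j m
  proof -
    \<comment> \<open>The hypothesis \<open>eq\<close> does not control pure powers of the
      parameter, but the bracket with the leading part contains none.\<close>
    have ij: "0 < i + j"
      using nz n by (intro Nat.gr0I) (simp add: coef_bracket_leading)
    have "coef h i j m \<noteq> 0 \<or> coef h' i j m \<noteq> 0"
      using coef_T[OF w ij] nz by auto
    then show ?thesis
      using h h' w p unfolding normal_def by (metis less_add_same_cancel1)
  qed
  obtain W where W: "qord n (n + 2 + p) W" "lie W h = 0"
    "\<And>a m. 0 < a \<Longrightarrow> 2 * n * a + 2 * n * m = n + 2 + p \<Longrightarrow> coef W 0 (2 * a) m = coef \<chi> 0 (2 * a) m"
    using commuting_hamiltonian[OF n0 h0(1), of "n + 2 + p" "\<lambda>a m. coef \<chi> 0 (2 * a) m"] by metis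
  note hW = qord_imp_hord[OF W(1)]
  have "bracket W (leading n b) = - bracket W (h - leading n b)"
    using W(2) by (simp add: lie_def bracket_anticommute[of h W] bracket_diff)
  then have TW: "qord n (2 * n + 1 + p) (bracket W (leading n b))"
    using ord_ge_uminus[OF qord_bracket[OF W(1) h0(1)]] by (simp add: add_ac One_nat_def)
  have T_eq: "coef (bracket (\<chi> - W) (leading n b)) i j m = coef (bracket \<chi> (leading n b)) i j m"
    if "2 * i + n * j + 2 * n * m = 2 * n + p" for i j m
    using ord_geD[OF TW, of i j m] that by (simp add: bracket_diff)
  have \<chi>W: "hord n (n + 3 + p) (\<chi> - W)"
  proof (rule bracket_leading_kernel[OF n b hord_diff[OF \<chi> hW]])
    show "reduced n b i j" if "2 * i + n * j + 2 * n * m = 2 * n + p"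
      "coef (bracket (\<chi> - W) (leading n b)) i j m \<noteq> 0" for i j m
      using red[OF that(1)] that T_eq[OF that(1)] by simp
    show "coef (\<chi> - W) 0 (2 * a) m = 0" if "0 < a" "2 * n * a + 2 * n * m = n + 2 + p" for a m
      using W(3)[OF that] by simp
  qed
  then have \<chi>W': "hord n (n + 2 + (p + 1)) (\<chi> - W)"
    by (simp add: numeral_3_eq_3 numeral_2_eq_2 One_nat_def)
  \<comment> \<open>To first order the composition is governed by \<open>\<chi> - W\<close>, which
    gains p + 1; the quadratic terms gain 2p, and p > 0 gives 2p \<ge> p + 1.\<close>
  have close: "qord n (q + (p + 1)) (exp_lie \<chi> (exp_lie (- W) f) - f)" if f: "qord n q f" for f q
  proof -
    have W3: "hord n (n + 3) (- W)"
      using hord_uminus[OF hW] p by (auto elim: hord_mono)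
    define z where "z = exp_lie (- W) f"
    have z: "qord n q z"
      unfolding z_def by (rule qord_exp_lie[OF n0 W3 f])
    have "qord n (q + p) (z - f)"
      using qord_exp_lie_Suc[OF f hord_uminus[OF hW] p] by (simp add: z_def)
    then have "qord n (q + p + p) (lie \<chi> (z - f))"
      by (rule qord_lie[OF _ \<chi>])
    then have 1: "qord n (q + (p + 1)) (lie \<chi> (z - f))"
      by (rule ord_ge_mono_le) (use p in simp)
    have 2: "qord n (q + (p + 1)) (z - f - lie (- W) f)"
      using qord_exp_lie_linear[OF f hord_uminus[OF hW] p] p
      unfolding z_def by (auto elim: ord_ge_mono_le)
    have 3: "qord n (q + (p + 1)) (exp_lie \<chi> z - z - lie \<chi> z)"
      using qord_exp_lie_linear[OF z \<chi> p] p by (auto elim: ord_ge_mono_le)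
    have 4: "qord n (q + (p + 1)) (lie (\<chi> - W) f)"
      by (rule qord_lie[OF f \<chi>W'])
    have "exp_lie \<chi> z - f = (exp_lie \<chi> z - z - lie \<chi> z) + (z - f - lie (- W) f) +
        lie \<chi> (z - f) + lie (\<chi> - W) f"
      by (simp add: lie_simps lie_diff_ham lie_uminus)
    then show ?thesis
      using ord_ge_add[OF ord_ge_add[OF ord_ge_add[OF 3 2] 1] 4] unfolding z_def by (simp only:)
  qed
  have W3: "hord n (n + 3) (- W)"
    using hord_uminus[OF hW] p by (auto elim: hord_mono)
  define F where "F = time_one (- W) \<circ>\<^sub>f time_one \<chi>"
  have F: "F = (exp_lie \<chi> (exp_lie (- W) var_x), exp_lie \<chi> (exp_lie (- W) var_y))"
    unfolding F_def comp_time_one[OF n0 \<chi>3] by (simp add: time_one_def)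
  have "jacobian F = 1"
    unfolding F_def jacobian_comp[OF zero_const_time_one[OF n0 \<chi>3]]
    by (simp add: jacobian_time_one[OF n0 \<chi>3] jacobian_time_one[OF n0 W3]
        subst_1[OF zero_const_time_one[OF n0 \<chi>3]])
  then obtain \<chi>' where \<chi>': "hord n (n + 2 + (p + 1)) \<chi>'" "time_one \<chi>' = F"
    using interpolating_hamiltonian[OF n0, of F "p + 1"] close[OF ord_ge_var_x] close[OF ord_ge_var_y]
    by (auto simp: F)
  have \<chi>'3: "hord n (n + 3) \<chi>'"
    using \<chi>'(1) by (auto elim: hord_mono)
  have "exp_lie \<chi>' h = subst (subst h (time_one (- W))) (time_one \<chi>)"
    unfolding exp_lie_eq_subst[OF n0 \<chi>'3] \<chi>'(2) F_def
    by (rule subst_subst[symmetric]) (intro zero_const_time_one[OF n0] W3 \<chi>3)+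
  also have "\<dots> = exp_lie \<chi> h"
    using exp_lie_fixed[OF n0 W3, of h] W(2)
    by (simp add: exp_lie_eq_subst[OF n0 W3, symmetric] exp_lie_eq_subst[OF n0 \<chi>3, symmetric]
        lie_uminus)
  finally have 2: "exp_lie \<chi>' h = exp_lie \<chi> h" .
  have "qord n (2 * n + p + 1) (exp_lie \<chi>' h - h)"
    using qord_exp_lie_Suc[OF hq \<chi>'(1)] by (simp add: add_ac)
  then have "hord n (2 * n + p + 1) (h' - h)"
    unfolding hord_def using 2 eq by (metis coef_diff ord_geD)
  from that[OF \<chi>'(1) 2 this] show ?thesis .
qed

lemma normal_form_unique:
  assumes n: "2 \<le> n" and b: "b \<noteq> 0" and h: "normal n b h" and h': "normal n b h'"
    and \<chi>: "hord n (n + 3) \<chi>"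
    and eq: "\<And>i j m. 0 < i + j \<Longrightarrow> coef (exp_lie \<chi> h) i j m = coef h' i j m"
    and ij: "0 < i + j"
  shows "coef h' i j m = coef h i j m"
proof -
  have ex: "\<exists>\<chi>'. hord n (n + 2 + Suc p) \<chi>' \<and> exp_lie \<chi>' h = exp_lie \<chi> h" for p
  proof (induction p)
    case 0
    show ?case
      using \<chi> by (intro exI[of _ \<chi>]) (simp add: numeral_3_eq_3)
  next
    case (Suc p)
    then obtain \<chi>' where "hord n (n + 2 + Suc p) \<chi>'" "exp_lie \<chi>' h = exp_lie \<chi> h"
      by blast
    from uniqueness_step[OF n b h h' zero_less_Suc this(1)] this(2) eq show ?case
      by (metis Suc_eq_plus1)
  qed
  define p where "p = 2 * i + n * j + 2 * n * m"
  obtain \<chi>' where "hord n (n + 2 + Suc p) \<chi>'" "exp_lie \<chi>' h = exp_lie \<chi> h"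
    using ex by blast
  from uniqueness_step[OF n b h h' zero_less_Suc this(1)] this(2) eq
  have "hord n (2 * n + Suc p + 1) (h' - h)"
    by metis
  then have "coef (h' - h) i j m = 0"
    using ij unfolding hord_def p_def by (metis less_add_Suc2 add_Suc_right Suc_eq_plus1 less_SucI)
  then show ?thesis
    by simp
qed

section \<open>Conjugacy\<close>

lemma is_inverseD:
  assumes "is_inverse \<theta> \<psi>"
  shows "zero_const \<theta>" "\<theta> \<circ>\<^sub>f \<psi> = id_map" "\<psi> \<circ>\<^sub>f \<theta> = id_map"
  using assms by (simp_all add: is_inverse_def)

lemma canonicalD: "canonical \<psi> \<Longrightarrow> zero_const \<psi>"
  by (simp add: canonical_def)

lemma conjugated_by_intertwine:
  assumes "zero_const \<psi>" "zero_const F" "zero_const G" "conjugated_by \<psi> F G"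
  shows "\<psi> \<circ>\<^sub>f F = G \<circ>\<^sub>f \<psi>"
proof -
  obtain \<theta> where \<theta>: "is_inverse \<theta> \<psi>" and F: "F = \<theta> \<circ>\<^sub>f G \<circ>\<^sub>f \<psi>"
    using assms(4) by (auto simp: conjugated_by_def)
  have "\<psi> \<circ>\<^sub>f F = (\<psi> \<circ>\<^sub>f \<theta>) \<circ>\<^sub>f (G \<circ>\<^sub>f \<psi>)"
    unfolding F by (intro comp_map_assoc[symmetric] is_inverseD(1)[OF \<theta>] zero_const_subst assms)
  then show ?thesis
    using assms by (simp add: is_inverseD(3)[OF \<theta>] zero_const_subst)
qed

lemma intertwine_conjugated_by:
  assumes "zero_const \<psi>" "zero_const F" "is_inverse \<theta> \<psi>" "\<psi> \<circ>\<^sub>f F = G \<circ>\<^sub>f \<psi>"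
  shows "conjugated_by \<psi> F G"
proof -
  have "\<theta> \<circ>\<^sub>f G \<circ>\<^sub>f \<psi> = (\<theta> \<circ>\<^sub>f \<psi>) \<circ>\<^sub>f F"
    unfolding assms(4)[symmetric] by (rule comp_map_assoc[symmetric]) (intro assms)+
  then have "F = \<theta> \<circ>\<^sub>f G \<circ>\<^sub>f \<psi>"
    by (simp add: is_inverseD(2)[OF assms(3)] assms(2))
  then show ?thesis
    using assms(3) unfolding conjugated_by_def by blast
qed

lemma is_inverse_comp:
  assumes "is_inverse \<theta> \<psi>" "is_inverse \<theta>' \<psi>'" "zero_const \<psi>" "zero_const \<psi>'"
  shows "is_inverse (\<theta> \<circ>\<^sub>f \<theta>') (\<psi>' \<circ>\<^sub>f \<psi>)"
proof -
  note z = is_inverseD(1)[OF assms(1)] is_inverseD(1)[OF assms(2)] assms(3,4) zero_const_subst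
  have "(\<theta> \<circ>\<^sub>f \<theta>') \<circ>\<^sub>f (\<psi>' \<circ>\<^sub>f \<psi>) = \<theta> \<circ>\<^sub>f (\<theta>' \<circ>\<^sub>f \<psi>') \<circ>\<^sub>f \<psi>"
    by (simp add: comp_map_assoc z)
  moreover have "(\<psi>' \<circ>\<^sub>f \<psi>) \<circ>\<^sub>f (\<theta> \<circ>\<^sub>f \<theta>') = \<psi>' \<circ>\<^sub>f (\<psi> \<circ>\<^sub>f \<theta>) \<circ>\<^sub>f \<theta>'"
    by (simp add: comp_map_assoc z)
  ultimately show ?thesis
    using z by (simp add: is_inverse_def is_inverseD(2,3)[OF assms(1)] is_inverseD(2,3)[OF assms(2)])
qed

lemma conjugated_by_trans:
  assumes "zero_const \<psi>" "zero_const \<phi>" "zero_const F" "zero_const G" "zero_const H"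
    and "conjugated_by \<psi> F G" "conjugated_by \<phi> G H"
  shows "conjugated_by (\<phi> \<circ>\<^sub>f \<psi>) F H"
proof -
  obtain \<theta> \<theta>' where inv: "is_inverse \<theta> \<psi>" "is_inverse \<theta>' \<phi>"
    using assms(6,7) by (auto simp: conjugated_by_def)
  have "(\<phi> \<circ>\<^sub>f \<psi>) \<circ>\<^sub>f F = \<phi> \<circ>\<^sub>f G \<circ>\<^sub>f \<psi>"
    using conjugated_by_intertwine[OF assms(1,3,4,6)] by (simp add: comp_map_assoc assms)
  also have "\<dots> = (H \<circ>\<^sub>f \<phi>) \<circ>\<^sub>f \<psi>"
    using conjugated_by_intertwine[OF assms(2,4,5,7)] comp_map_assoc[of G \<psi> \<phi>] assms by simp
  also have "\<dots> = H \<circ>\<^sub>f (\<phi> \<circ>\<^sub>f \<psi>)"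
    by (simp add: comp_map_assoc assms)
  finally show ?thesis
    by (intro intertwine_conjugated_by[OF _ _ is_inverse_comp[OF inv]] zero_const_subst assms)
qed

lemma conjugated_by_inverse:
  assumes "zero_const \<psi>" "zero_const F" "zero_const G" "conjugated_by \<psi> F G"
  obtains \<theta> where "is_inverse \<theta> \<psi>" "conjugated_by \<theta> G F"
proof -
  obtain \<theta> where \<theta>: "is_inverse \<theta> \<psi>" and F: "F = \<theta> \<circ>\<^sub>f G \<circ>\<^sub>f \<psi>"
    using assms(4) by (auto simp: conjugated_by_def)
  note z = is_inverseD(1)[OF \<theta>]
  have "F \<circ>\<^sub>f \<theta> = \<theta> \<circ>\<^sub>f G \<circ>\<^sub>f \<psi> \<circ>\<^sub>f \<theta>"
    unfolding F by (simp add: comp_map_assoc z assms zero_const_subst)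
  then have "\<theta> \<circ>\<^sub>f G = F \<circ>\<^sub>f \<theta>"
    by (simp add: is_inverseD(3)[OF \<theta>])
  moreover have "is_inverse \<psi> \<theta>"
    using \<theta> assms(1) by (simp add: is_inverse_def)
  ultimately have "conjugated_by \<theta> G F"
    by (intro intertwine_conjugated_by z assms)
  with \<theta> show ?thesis
    by (rule that)
qed

lemma canonical_comp: "canonical \<psi> \<Longrightarrow> canonical \<phi> \<Longrightarrow> canonical (\<phi> \<circ>\<^sub>f \<psi>)"
  by (auto simp: canonical_def zero_const_subst jacobian_comp subst_uminus)

lemma canonical_inverse:
  assumes "canonical \<psi>" "is_inverse \<theta> \<psi>"
  shows "canonical \<theta>"
proof -
  note z = is_inverseD(1)[OF assms(2)]
  have "subst (jacobian \<psi>) \<theta> * jacobian \<theta> = 1"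
    using jacobian_comp[OF z, of \<psi>] by (simp add: is_inverseD(3)[OF assms(2)])
  moreover have "subst (jacobian \<psi>) \<theta> = 1 \<or> subst (jacobian \<psi>) \<theta> = - 1"
    using assms(1) z by (auto simp: canonical_def subst_uminus)
  ultimately have "jacobian \<theta> = 1 \<or> jacobian \<theta> = - 1"
    by (auto simp: minus_equation_iff)
  then show ?thesis
    using z by (simp add: canonical_def)
qed

lemma time_one_subst:
  assumes "0 < n" "hord n (n + 3) h" "0 < n'" "hord n' (n' + 3) (subst h \<phi>)"
    "zero_const \<phi>" "jacobian \<phi> = 1"
  shows "\<phi> \<circ>\<^sub>f time_one (subst h \<phi>) = time_one h \<circ>\<^sub>f \<phi>"
proof -
  have "exp_lie (subst h \<phi>) (fst \<phi>) = subst (exp_lie h var_x) \<phi>"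
    "exp_lie (subst h \<phi>) (snd \<phi>) = subst (exp_lie h var_y) \<phi>"
    using exp_lie_subst[OF assms(1,2,5,6), of var_x] exp_lie_subst[OF assms(1,2,5,6), of var_y]
      assms(5) by simp_all
  then show ?thesis
    unfolding comp_time_one[OF assms(3,4)] by (simp add: comp_map_def time_one_def)
qed

lemma lie_cong:
  assumes "\<And>i j m. 0 < i + j \<Longrightarrow> coef f i j m = coef g i j m"
  shows "lie f = lie g"
proof -
  have "diff_x f = diff_x g" "diff_y f = diff_y g"
    by (rule series_eqI; simp add: assms)+
  then show ?thesis
    by (simp add: lie_def bracket_def fun_eq_iff)
qed

lemma time_one_cong:
  "(\<And>i j m. 0 < i + j \<Longrightarrow> coef f i j m = coef g i j m) \<Longrightarrow> time_one f = time_one g"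
  using lie_cong[of f g] by (simp add: time_one_def exp_lie_def)

text \<open>From n \<ge> 3 follows 2n \<ge> n + 3, so \<open>g\<close> and \<open>N\<close> have
  enough order for their own exponentials. Since \<open>N\<close> is the pullback of
  \<open>g\<close> by \<open>time_one \<chi>\<close>, the conjugating map is the inverse
  \<open>time_one (- \<chi>)\<close>.\<close>

lemma conjugate_to_normal_form:
  assumes n: "3 \<le> n" and g: "qord n (2 * n + 1) (g - leading n b)"
  obtains \<psi> N where "canonical \<psi>" "conjugated_by \<psi> (time_one g) (time_one N)" "normal n b N"
proof -
  have n0: "0 < n" and n2: "2 \<le> n"
    using n by simp_all
  obtain \<chi> where \<chi>: "hord n (n + 3) \<chi>" "normal n b (exp_lie \<chi> g)"
    by (rule normalizing_hamiltonian[OF n2 g])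
  have ham: "hord n (n + 3) f" if "qord n (2 * n + 1) (f - leading n b)" for f
    using hord_mono[OF qord_imp_hord[OF qord_of_leading[OF that]]] n by simp
  define N where "N = exp_lie \<chi> g"
  have hN: "hord n (n + 3) N"
    using \<chi>(2) by (intro ham) (simp add: N_def normal_def)
  note z = zero_const_time_one[OF n0 \<chi>(1)] zero_const_time_one[OF n0 hord_uminus[OF \<chi>(1)]]
    zero_const_time_one[OF n0 hN] zero_const_time_one[OF n0 ham[OF g]]
  have inv: "is_inverse (time_one \<chi>) (time_one (- \<chi>))"
    using z time_one_uminus_comp[OF n0 \<chi>(1)] by (simp add: is_inverse_def)
  have N_subst: "N = subst g (time_one \<chi>)"
    by (simp add: N_def exp_lie_eq_subst[OF n0 \<chi>(1)])
  have tw: "time_one \<chi> \<circ>\<^sub>f time_one N = time_one g \<circ>\<^sub>f time_one \<chi>"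
    unfolding N_subst
    by (rule time_one_subst[OF n0 ham[OF g] n0 hN[unfolded N_subst] z(1) jacobian_time_one[OF n0 \<chi>(1)]])
  have "time_one (- \<chi>) \<circ>\<^sub>f time_one g =
      time_one (- \<chi>) \<circ>\<^sub>f (time_one g \<circ>\<^sub>f time_one \<chi>) \<circ>\<^sub>f time_one (- \<chi>)"
    by (simp add: comp_map_assoc z time_one_uminus_comp[OF n0 \<chi>(1)])
  also have "\<dots> = (time_one (- \<chi>) \<circ>\<^sub>f time_one \<chi>) \<circ>\<^sub>f time_one N \<circ>\<^sub>f time_one (- \<chi>)"
    unfolding tw[symmetric] by (simp add: comp_map_assoc z zero_const_subst)
  also have "\<dots> = time_one N \<circ>\<^sub>f time_one (- \<chi>)"
    by (simp add: time_one_uminus_comp[OF n0 \<chi>(1)] z zero_const_subst)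
  finally have "conjugated_by (time_one (- \<chi>)) (time_one g) (time_one N)"
    by (intro intertwine_conjugated_by[OF _ _ inv] z)
  moreover have "canonical (time_one (- \<chi>))"
    using z by (simp add: canonical_def jacobian_time_one[OF n0 hord_uminus[OF \<chi>(1)]])
  ultimately show ?thesis
    using that \<chi>(2) by (simp add: N_def)
qed

lemma coef_leading:
  "coef (leading n b) i j m =
    (if i = 0 \<and> j = 2 \<and> m = 0 then 1 / 2 else 0) + (if i = n \<and> j = 0 \<and> m = 0 then b else 0)"
  by (simp add: leading_monomial coef_monomial)

lemma coef_g_ham:
  "coef (g_ham u) i j m = (if i = 0 \<and> j = 2 \<and> m = 0 then 1 / 2 else 0) +
     (if j = 0 \<and> 3 \<le> i + 3 * m then u i m else 0)"
proof -
  have "var_y ^ 2 = monomial 0 2 0"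
    by (simp add: monomial_def)
  then show ?thesis
    by (simp add: g_ham_def coef_monomial coef_potential g_index_def)
qed

lemma h_index_iff: "(k, m) \<in> h_index n \<longleftrightarrow> n < k + n * m \<and> \<not> n dvd k + 1"
proof -
  have "[int k = - 1] (mod int n) \<longleftrightarrow> int n dvd int k - (- 1)"
    by (rule cong_iff_dvd_diff)
  also have "int k - (- 1) = int (k + 1)"
    by simp
  also have "int n dvd int (k + 1) \<longleftrightarrow> n dvd k + 1"
    by (rule int_dvd_int_iff)
  finally show ?thesis
    by (simp add: h_index_def)
qed

lemma coef_h_ham:
  "coef (h_ham n b u) i j m =
    coef (leading n b) i j m + (if j = 0 \<and> (i, m) \<in> h_index n then u i m else 0)"
  by (simp add: h_ham_def leading_def coef_potential)

lemma coef_normal: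
  assumes "normal n b N"
  shows "coef N i j m = (if 2 * i + n * j + 2 * n * m \<le> 2 * n then coef (leading n b) i j m
    else if j = 0 \<and> (b \<noteq> 0 \<longrightarrow> \<not> n dvd i + 1) then coef N i 0 m else 0)"
proof (cases "2 * i + n * j + 2 * n * m \<le> 2 * n")
  case True
  then have "coef (N - leading n b) i j m = 0"
    using assms by (intro ord_geD[of 2 n "2 * n" "2 * n + 1"]) (auto simp: normal_def)
  then show ?thesis
    using True by simp
next
  case False
  then have "coef N i j m \<noteq> 0 \<Longrightarrow> reduced n b i j"
    using assms unfolding normal_def by (metis not_le)
  then show ?thesis
    using False by (cases "reduced n b i j") (auto simp: reduced_def)
qed

text \<open>The weight of x^k \<epsilon>^m is 2(k + nm), so \<open>k + n * m > n\<close> says that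
  the monomial lies above the leading weight, and the congruence makes it reduced.\<close>

lemma normal_h_ham:
  assumes "0 < n"
  shows "normal n b (h_ham n b u)"
proof -
  have "qord n (2 * n + 1) (h_ham n b u - leading n b)"
    unfolding ord_ge_def
  proof (intro allI impI)
    fix i j m
    assume lt: "2 * i + n * j + 2 * n * m < 2 * n + 1"
    then have "(i, m) \<notin> h_index n" if "j = 0"
      using that by (auto simp: h_index_iff)
    then show "coef (h_ham n b u - leading n b) i j m = 0"
      by (auto simp: coef_h_ham)
  qed
  moreover have "reduced n b i j"
    if "2 * n < 2 * i + n * j + 2 * n * m" "coef (h_ham n b u) i j m \<noteq> 0" for i j m
    using that by (auto simp: coef_h_ham coef_leading reduced_def h_index_iff split: if_splits)
  ultimately show ?thesis
    by (auto simp: normal_def)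
qed

lemma normal_eq_h_ham:
  assumes n: "0 < n" and b: "b \<noteq> 0" and N: "normal n b N"
  shows "N = h_ham n b (\<lambda>k m. coef N k 0 m)"
proof (rule series_eqI)
  fix i j m
  show "coef N i j m = coef (h_ham n b (\<lambda>k m. coef N k 0 m)) i j m"
  proof (cases "2 * i + n * j + 2 * n * m \<le> 2 * n")
    case True
    then show ?thesis
      using coef_normal[OF N, of i j m] by (auto simp: coef_h_ham h_index_iff)
  next
    case False
    then have lead: "coef (leading n b) i j m = 0"
      by (auto simp: coef_leading)
    show ?thesis
    proof (cases "j = 0 \<and> \<not> n dvd i + 1")
      case True
      then have "(i, m) \<in> h_index n"
        using False by (auto simp: h_index_iff)
      then show ?thesis
        using True lead by (auto simp: coef_h_ham)
    next
      case nred: False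
      then show ?thesis
        using coef_normal[OF N, of i j m] False b by (auto simp: coef_h_ham lead h_index_iff)
    qed
  qed
qed


section \<open>Linear parts\<close>

lemma coef_0_mult: "coef (f * g) 0 0 0 = coef f 0 0 0 * coef g 0 0 0"
  by (simp add: coef_mult)

lemma coef_0_subst: "zero_const \<phi> \<Longrightarrow> coef (subst f \<phi>) 0 0 0 = coef f 0 0 0"
  using coef_subst[of \<phi> 0 0 0 0 f] by (simp add: coef_1)

lemma linear_coef_subst:
  assumes "zero_const \<phi>"
  shows "coef (subst f \<phi>) 1 0 0 =
      coef f 1 0 0 * coef (fst \<phi>) 1 0 0 + coef f 0 1 0 * coef (snd \<phi>) 1 0 0"
    "coef (subst f \<phi>) 0 1 0 =
      coef f 1 0 0 * coef (fst \<phi>) 0 1 0 + coef f 0 1 0 * coef (snd \<phi>) 0 1 0"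
  using arg_cong[OF diff_x_subst[OF assms, of f], of "\<lambda>f. coef f 0 0 0"]
    arg_cong[OF diff_y_subst[OF assms, of f], of "\<lambda>f. coef f 0 0 0"]
  by (simp_all add: coef_0_mult coef_0_subst[OF assms])

lemma coef_0_jacobian:
  "coef (jacobian F) 0 0 0 =
    coef (fst F) 1 0 0 * coef (snd F) 0 1 0 - coef (fst F) 0 1 0 * coef (snd F) 1 0 0"
  by (simp add: jacobian_def coef_0_mult)

lemma qord_less_3_iff: "ord_ge 2 3 6 3 f \<longleftrightarrow> coef f 0 0 0 = 0 \<and> coef f 1 0 0 = 0"
proof -
  have "2 * i + 3 * j + 6 * m < 3 \<longleftrightarrow> (i = 0 \<or> i = 1) \<and> j = 0 \<and> m = 0" for i j m :: nat
    by auto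
  then show ?thesis
    unfolding ord_ge_def by auto
qed

lemma qord_less_4_iff:
  "ord_ge 2 3 6 4 f \<longleftrightarrow> coef f 0 0 0 = 0 \<and> coef f 1 0 0 = 0 \<and> coef f 0 1 0 = 0"
proof -
  have "2 * i + 3 * j + 6 * m < 4 \<longleftrightarrow>
      (i = 0 \<and> j = 0 \<and> m = 0) \<or> (i = 1 \<and> j = 0 \<and> m = 0) \<or> (i = 0 \<and> j = 1 \<and> m = 0)" for i j m :: nat
    by auto
  then show ?thesis
    unfolding ord_ge_def by auto
qed

text \<open>In the weights 2, 3, 6 the increments of x and y have orders 3 and 4, so the linear part
  is a shear, and only the coefficient of y^2 enters.\<close>

lemma linear_coef_time_one:
  assumes "hord 3 6 h"
  shows "coef (fst (time_one h)) 1 0 0 = 1" "coef (fst (time_one h)) 0 1 0 = 2 * coef h 0 2 0"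
    "coef (snd (time_one h)) 1 0 0 = 0" "coef (snd (time_one h)) 0 1 0 = 1"
proof -
  have h: "hord 3 (3 + 2 + 1) h"
    using assms by simp
  have "qord 3 4 (exp_lie h var_x - var_x - lie h var_x)"
    using qord_exp_lie_linear[OF ord_ge_var_x h] by simp
  moreover have "qord 3 3 (lie h var_x)"
    using qord_lie[OF ord_ge_var_x h] by simp
  ultimately show "coef (fst (time_one h)) 1 0 0 = 1" "coef (fst (time_one h)) 0 1 0 = 2 * coef h 0 2 0"
    by (simp_all add: qord_less_3_iff qord_less_4_iff time_one_def lie_def bracket_x coef_var_x)
  have "qord 3 4 (exp_lie h var_y - var_y)"
    using qord_exp_lie_Suc[OF ord_ge_var_y h] by simp
  then show "coef (snd (time_one h)) 1 0 0 = 0" "coef (snd (time_one h)) 0 1 0 = 1"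
    by (simp_all add: qord_less_4_iff time_one_def coef_var_y)
qed

section \<open>Linear canonical maps and unipotent matrices\<close>

definition lin :: "real \<Rightarrow> real \<Rightarrow> real \<Rightarrow> real \<Rightarrow> fmap" where
  "lin a b c d = (cst a * var_x + cst b * var_y, cst c * var_x + cst d * var_y)"

lemma zero_const_lin [simp]: "zero_const (lin a b c d)"
  by (simp add: zero_const_def lin_def coef_var_x coef_var_y)

lemma linear_coef_lin [simp]:
  "coef (fst (lin a b c d)) 1 0 0 = a" "coef (fst (lin a b c d)) 0 1 0 = b"
  "coef (snd (lin a b c d)) 1 0 0 = c" "coef (snd (lin a b c d)) 0 1 0 = d"
  by (simp_all add: lin_def coef_var_x coef_var_y)

lemma jacobian_lin: "jacobian (lin a b c d) = cst (a * d - b * c)"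
  by (simp add: jacobian_def lin_def diff_x_simps diff_y_simps cst_diff cst_mult)

lemma lin_comp_lin:
  "lin a b c d \<circ>\<^sub>f lin a' b' c' d' =
    lin (a * a' + b * c') (a * b' + b * d') (c * a' + d * c') (c * b' + d * d')"
  by (simp add: comp_map_def lin_def[of a] subst_add cont_lin_cst[OF cont_lin_subst])
    (simp add: lin_def cst_add cst_mult algebra_simps)

lemma lin_id: "lin 1 0 0 1 = id_map"
  by (simp add: lin_def id_map_def)

lemma is_inverse_lin:
  assumes "a * d - b * c = D" "D * D = 1"
  shows "is_inverse (lin (d * D) (- b * D) (- c * D) (a * D)) (lin a b c d)"
proof -
  have "d * D * a + - b * D * c = (a * d - b * c) * D" "- c * D * b + a * D * d = (a * d - b * c) * D"
    "a * (d * D) + b * (- c * D) = (a * d - b * c) * D" "c * (- b * D) + d * (a * D) = (a * d - b * c) * D"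
    by (simp_all add: algebra_simps)
  then have "d * D * a + - b * D * c = 1" "- c * D * b + a * D * d = 1"
    "a * (d * D) + b * (- c * D) = 1" "c * (- b * D) + d * (a * D) = 1"
    using assms by simp_all
  then show ?thesis
    by (simp add: is_inverse_def lin_comp_lin mult_ac flip: lin_id)
qed

lemma parabolic_trace:
  assumes det: "p * s - q * r = (1 :: real)"
    and root: "order 1 (char_poly (mat_of_rows_list 2 [[p, q], [r, s]])) = 2"
  shows "p + s = 2"
proof -
  define A where "A = mat_of_rows_list 2 [[p, q], [r, s]]"
  have A: "A \<in> carrier_mat 2 2"
    by (auto simp: A_def mat_of_rows_list_def)
  have "poly (char_poly A) 1 = 0"
    using root unfolding A_def[symmetric] by (simp add: order_root)
  then have "eigenvalue A 1"
    by (simp add: eigenvalue_root_char_poly[OF A])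
  then obtain v where v: "v \<in> carrier_vec 2" "v \<noteq> 0\<^sub>v 2" "A *\<^sub>v v = 1 \<cdot>\<^sub>v v"
    using A by (auto simp: eigenvalue_def eigenvector_def)
  define v0 v1 where "v0 = v $ 0" "v1 = v $ 1"
  have nz: "v0 \<noteq> 0 \<or> v1 \<noteq> 0"
  proof (rule ccontr)
    assume "\<not> ?thesis"
    then have "v = 0\<^sub>v 2"
      using v(1) by (intro eq_vecI) (auto simp: v0_v1_def less_2_cases_iff One_nat_def)
    with v(2) show False ..
  qed
  have "(A *\<^sub>v v) $ 0 = v0" "(A *\<^sub>v v) $ 1 = v1"
    using v by (simp_all add: v0_v1_def)
  then have "p * v0 + q * v1 = v0" "r * v0 + s * v1 = v1"
    using v(1) by (simp_all add: A_def mat_of_rows_list_def scalar_prod_def v0_v1_def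
        numeral_2_eq_2 One_nat_def)
  then have "(p - 1) * v0 + q * v1 = 0" "r * v0 + (s - 1) * v1 = 0"
    by (simp_all add: algebra_simps)
  \<comment> \<open>Applying the adjugate of A - 1 to (A - 1) v = 0 gives det (A - 1) v = 0, and for
    determinant 1 one has det (A - 1) = 2 - trace.\<close>
  moreover have
    "((p - 1) * (s - 1) - q * r) * v0 = (s - 1) * ((p - 1) * v0 + q * v1) - q * (r * v0 + (s - 1) * v1)"
    "((p - 1) * (s - 1) - q * r) * v1 = (p - 1) * (r * v0 + (s - 1) * v1) - r * ((p - 1) * v0 + q * v1)"
    by (simp_all add: algebra_simps)
  ultimately have "((p - 1) * (s - 1) - q * r) * v0 = 0" "((p - 1) * (s - 1) - q * r) * v1 = 0"
    by simp_all
  then have "(p - 1) * (s - 1) - q * r = 0"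
    using nz by auto
  then show ?thesis
    using det by (simp add: algebra_simps)
qed

text \<open>For a unipotent matrix \<open>A = 1 + N\<close> with \<open>N \<noteq> 0\<close>, the rows of the conjugating matrix are a
  row vector \<open>v\<close> with \<open>v N \<noteq> 0\<close> and \<open>v N\<close>; the scale of \<open>v\<close> is chosen to make the determinant
  \<open>\<plusminus>1\<close>.\<close>

lemma parabolic_normal_form:
  assumes det: "p * s - q * r = (1 :: real)" and tr: "p + s = 2"
    and nid: "\<not> (p = 1 \<and> q = 0 \<and> r = 0 \<and> s = 1)"
  obtains a b c d D where "a * d - b * c = D" "D * D = 1" "a * p + b * r = a + c" "a * q + b * s = b + d"
    "c * p + d * r = c" "c * q + d * s = d"
proof -
  define t where "t = p - 1"
  have ps: "p = 1 + t" "s = 1 - t"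
    using tr by (simp_all add: t_def)
  have sq: "t * t + q * r = 0"
    using det by (simp add: ps algebra_simps)
  show ?thesis
  proof (cases "q = 0")
    case False
    define k where "k = 1 / sqrt \<bar>q\<bar>"
    have k: "k * k * \<bar>q\<bar> = 1"
      using False by (simp add: k_def)
    show ?thesis
    proof (rule that[of k "k * q" 0 "k * t" "k * (k * q)"])
      have "k * (k * q) * (k * (k * q)) = (k * k * \<bar>q\<bar>) * (k * k * \<bar>q\<bar>)"
        by (cases "0 \<le> q") (simp_all add: mult_ac)
      then show "k * (k * q) * (k * (k * q)) = 1"
        by (simp add: k)
      have "k * t * p + k * q * r = k * t + k * (t * t + q * r)"
        by (simp add: ps algebra_simps)
      then show "k * t * p + k * q * r = k * t"
        by (simp add: sq)
    qed (simp_all add: ps algebra_simps)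
  next
    case True
    then have t: "t = 0"
      using sq by simp
    then have r: "r \<noteq> 0"
      using nid True by (simp add: ps)
    define k where "k = 1 / sqrt \<bar>r\<bar>"
    have k: "k * k * \<bar>r\<bar> = 1"
      using r by (simp add: k_def)
    show ?thesis
    proof (rule that[of 0 0 k "k * r" "- (k * (k * r))"])
      have "k * (k * r) * (k * (k * r)) = (k * k * \<bar>r\<bar>) * (k * k * \<bar>r\<bar>)"
        by (cases "0 \<le> r") (simp_all add: mult_ac)
      then have "k * (k * r) * (k * (k * r)) = 1"
        by (simp add: k)
      then show "- (k * (k * r)) * - (k * (k * r)) = 1"
        by simp
    qed (simp_all add: ps t True)
  qed
qed

section \<open>Existence of both normal forms\<close>

lemma not_diagonalisable_linear_part:
  assumes "\<not> diagonalisable (linear_part F)"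
  shows "\<not> (coef (fst F) 1 0 0 = 1 \<and> coef (fst F) 0 1 0 = 0 \<and> coef (snd F) 1 0 0 = 0 \<and> coef (snd F) 0 1 0 = 1)"
proof
  assume id: "coef (fst F) 1 0 0 = 1 \<and> coef (fst F) 0 1 0 = 0 \<and> coef (snd F) 1 0 0 = 0 \<and>
    coef (snd F) 0 1 0 = 1"
  have A: "linear_part F \<in> carrier_mat 2 2"
    by (auto simp: linear_part_def mat_of_rows_list_def)
  have "diagonal_mat (linear_part F)"
    using id by (auto simp: linear_part_def mat_of_rows_list_def diagonal_mat_def numeral_2_eq_2 less_Suc_eq)
  then show False
    using assms similar_mat_refl[OF A] by (auto simp: diagonalisable_def)
qed

text \<open>A linear change makes the linear part the shear (x + y, y). As y weighs more than x,
  this is the identity at leading order in the weights 2, 3, 6, and interpolation and normalisation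
  apply with n = 3.\<close>

lemma existence_g_ham:
  assumes jac: "jacobian F = 1" and zero: "zero_const F"
    and root: "order 1 (char_poly (linear_part F)) = 2" and nd: "\<not> diagonalisable (linear_part F)"
  shows "\<exists>\<psi> u. canonical \<psi> \<and> conjugated_by \<psi> F (time_one (g_ham u))"
proof -
  define p q r s where pqrs: "p = coef (fst F) 1 0 0" "q = coef (fst F) 0 1 0"
    "r = coef (snd F) 1 0 0" "s = coef (snd F) 0 1 0"
  have det: "p * s - q * r = 1"
    using coef_0_jacobian[of F] by (simp add: jac coef_1 pqrs)
  have "p + s = 2"
    using parabolic_trace[OF det] root by (simp add: linear_part_def pqrs)
  \<comment> \<open>The last four equations say that the new matrix times the linear part equals the
    shear times the new matrix.\<close>
  then obtain a b c d D where C: "a * d - b * c = D" "D * D = 1" "a * p + b * r = a + c"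
    "a * q + b * s = b + d" "c * p + d * r = c" "c * q + d * s = d"
    using parabolic_normal_form[OF det] not_diagonalisable_linear_part[OF nd]
    unfolding pqrs[symmetric] by metis
  define L where "L = lin a b c d"
  define L' where "L' = lin (d * D) (- b * D) (- c * D) (a * D)"
  have inv: "is_inverse L' L"
    unfolding L_def L'_def by (rule is_inverse_lin[OF C(1,2)])
  define G where "G = L \<circ>\<^sub>f F \<circ>\<^sub>f L'"
  have z: "zero_const L" "zero_const L'" "zero_const (F \<circ>\<^sub>f L')"
    by (simp_all add: L_def L'_def zero zero_const_subst)
  then have zG: "zero_const G"
    by (simp add: G_def zero_const_subst)
  have "L \<circ>\<^sub>f F = G \<circ>\<^sub>f L"
    unfolding G_def by (simp add: comp_map_assoc z zero zero_const_subst is_inverseD(2)[OF inv])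
  then have conj1: "conjugated_by L F G"
    by (intro intertwine_conjugated_by[OF z(1) zero inv])
  have D: "D = 1 \<or> D = - 1"
    using C(2) by (simp add: square_eq_1_iff)
  have can1: "canonical L"
    using D by (auto simp: canonical_def L_def jacobian_lin C(1) cst_uminus)
  have "jacobian L' = cst (D * (a * d - b * c) * D)"
    unfolding L'_def jacobian_lin by (simp add: algebra_simps)
  then have jacG: "jacobian G = 1"
    using C(2) D
    by (auto simp: G_def jacobian_comp z jac subst_mult L_def jacobian_lin C(1) cst_mult[symmetric])
  have FL: "coef (fst (F \<circ>\<^sub>f L')) 1 0 0 = p * (d * D) + q * (- c * D)"
    "coef (fst (F \<circ>\<^sub>f L')) 0 1 0 = p * (- b * D) + q * (a * D)"
    "coef (snd (F \<circ>\<^sub>f L')) 1 0 0 = r * (d * D) + s * (- c * D)"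
    "coef (snd (F \<circ>\<^sub>f L')) 0 1 0 = r * (- b * D) + s * (a * D)"
    by (simp_all add: comp_map_def linear_coef_subst z L'_def pqrs)
  have lin: "coef (fst G) 1 0 0 = 1" "coef (fst G) 0 1 0 = 1" "coef (snd G) 1 0 0 = 0" "coef (snd G) 0 1 0 = 1"
  proof -
    have G: "fst G = subst (fst L) (F \<circ>\<^sub>f L')" "snd G = subst (snd L) (F \<circ>\<^sub>f L')"
      by (simp_all add: G_def comp_map_def)
    have "coef (fst G) 1 0 0 = a * (p * (d * D) + q * (- c * D)) + b * (r * (d * D) + s * (- c * D))"
      by (simp only: G linear_coef_subst[OF z(3)] FL) (simp add: L_def)
    also have "\<dots> = D * (d * (a * p + b * r) - c * (a * q + b * s))"
      by (simp add: algebra_simps)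
    also have "\<dots> = D * (a * d - b * c)"
      unfolding C(3-6) by (simp add: algebra_simps)
    finally show "coef (fst G) 1 0 0 = 1"
      using C(1,2) by simp
    have "coef (fst G) 0 1 0 = a * (p * (- b * D) + q * (a * D)) + b * (r * (- b * D) + s * (a * D))"
      by (simp only: G linear_coef_subst[OF z(3)] FL) (simp add: L_def)
    also have "\<dots> = D * (a * (a * q + b * s) - b * (a * p + b * r))"
      by (simp add: algebra_simps)
    also have "\<dots> = D * (a * d - b * c)"
      unfolding C(3-6) by (simp add: algebra_simps)
    finally show "coef (fst G) 0 1 0 = 1"
      using C(1,2) by simp
    have "coef (snd G) 1 0 0 = c * (p * (d * D) + q * (- c * D)) + d * (r * (d * D) + s * (- c * D))"
      by (simp only: G linear_coef_subst[OF z(3)] FL) (simp add: L_def)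
    also have "\<dots> = D * (d * (c * p + d * r) - c * (c * q + d * s))"
      by (simp add: algebra_simps)
    also have "\<dots> = 0"
      unfolding C(3-6) by (simp add: algebra_simps)
    finally show "coef (snd G) 1 0 0 = 0" .
    have "coef (snd G) 0 1 0 = c * (p * (- b * D) + q * (a * D)) + d * (r * (- b * D) + s * (a * D))"
      by (simp only: G linear_coef_subst[OF z(3)] FL) (simp add: L_def)
    also have "\<dots> = D * (a * (c * q + d * s) - b * (c * p + d * r))"
      by (simp add: algebra_simps)
    also have "\<dots> = D * (a * d - b * c)"
      unfolding C(3-6) by (simp add: algebra_simps)
    finally show "coef (snd G) 0 1 0 = 1"
      using C(1,2) by simp
  qed
  have "qord 3 (2 + 1) (fst G - var_x)" "qord 3 (3 + 1) (snd G - var_y)"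
    using zG by (simp_all add: qord_less_3_iff qord_less_4_iff lin coef_var_x coef_var_y zero_const_def)
  then obtain \<chi> where \<chi>: "hord 3 (3 + 2 + 1) \<chi>" "time_one \<chi> = G"
    using interpolating_hamiltonian[of 3 G 1] jacG by auto
  have h6: "hord 3 6 \<chi>"
    using \<chi>(1) by simp
  have half: "coef \<chi> 0 2 0 = 1 / 2"
    using linear_coef_time_one(2)[OF h6] lin(2) by (simp add: \<chi>(2))
  \<comment> \<open>The parameter has weight 6, like the leading part, so its pure powers are
    dropped to make \<open>leading 3 e\<close> the whole part of weight 6.\<close>
  define g where "g = mk_series (\<lambda>i j m. if i + j = 0 then 0 else coef \<chi> i j m)"
  define e where "e = coef \<chi> 3 0 0"
  have "time_one g = G"
    unfolding \<chi>(2)[symmetric] by (rule time_one_cong) (auto simp: g_def)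
  have "qord 3 (2 * 3 + 1) (g - leading 3 e)"
    unfolding ord_ge_def
  proof (intro allI impI)
    fix i j m :: nat
    assume lt: "2 * i + 3 * j + 2 * 3 * m < 2 * 3 + 1"
    show "coef (g - leading 3 e) i j m = 0"
    proof (cases "2 * i + 3 * j + 2 * 3 * m < 6")
      case True
      then show ?thesis
        using h6 by (auto simp: g_def coef_leading hord_def)
    next
      case False
      then have "(i = 3 \<and> j = 0 \<and> m = 0) \<or> (i = 0 \<and> j = 2 \<and> m = 0) \<or> (i = 0 \<and> j = 0 \<and> m = 1)"
        using lt by presburger
      then show ?thesis
        by (auto simp: g_def coef_leading e_def half)
    qed
  qed
  then obtain \<psi> N where \<psi>: "canonical \<psi>" "conjugated_by \<psi> (time_one g) (time_one N)" "normal 3 e N"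
    using conjugate_to_normal_form[of 3 g e] by auto
  have "coef N i j m = coef (g_ham (\<lambda>k m. coef N k 0 m)) i j m" if "0 < i + j" for i j m
    using coef_normal[OF \<psi>(3), of i j m] that by (auto simp: coef_g_ham coef_leading split: if_splits)
  then have tN: "time_one N = time_one (g_ham (\<lambda>k m. coef N k 0 m))"
    by (rule time_one_cong)
  have "hord 3 (3 + 3) N"
    using hord_mono[OF qord_imp_hord[OF qord_of_leading], of 3 N e 6] \<psi>(3) by (simp add: normal_def)
  then have "zero_const (time_one N)"
    by (rule zero_const_time_one[rotated]) simp
  then have "conjugated_by (\<psi> \<circ>\<^sub>f L) F (time_one N)"
    using conj1 \<psi>(2) \<open>time_one g = G\<close>
    by (intro conjugated_by_trans[of L \<psi> F G]) (simp_all add: z zero zG canonicalD[OF \<psi>(1)])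
  moreover have "canonical (\<psi> \<circ>\<^sub>f L)"
    by (rule canonical_comp[OF can1 \<psi>(1)])
  ultimately show ?thesis
    unfolding tN by blast
qed

text \<open>In the weights for n, monomials divisible by x and \<epsilon> lie above
  \<open>2 * n\<close>, and the powers of x below x^n are absent by hypothesis. Without the pure
  powers of \<epsilon> the leading part is y^2/2 + b x^n.\<close>

lemma existence_h_ham:
  assumes zero: "zero_const F" and \<psi>: "canonical \<psi>" "conjugated_by \<psi> F (time_one (g_ham u))"
    and n: "3 \<le> n" and low: "\<And>k. 3 \<le> k \<Longrightarrow> k < n \<Longrightarrow> u k 0 = 0" and b: "u n 0 \<noteq> 0"
  shows "\<exists>\<phi> v. canonical \<phi> \<and> conjugated_by \<phi> F (time_one (h_ham n (u n 0) v))"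
proof -
  define g where "g = g_ham (\<lambda>k m. if k = 0 then 0 else u k m)"
  have tg: "time_one (g_ham u) = time_one g"
    by (rule time_one_cong) (auto simp: g_def coef_g_ham)
  have g: "qord n (2 * n + 1) (g - leading n (u n 0))"
    unfolding ord_ge_def
  proof (intro allI impI)
    fix i j m
    assume lt: "2 * i + n * j + 2 * n * m < 2 * n + 1"
    show "coef (g - leading n (u n 0)) i j m = 0"
    proof (cases "j = 0 \<and> 0 < i")
      case True
      have "m = 0"
      proof (rule ccontr)
        assume "m \<noteq> 0"
        then have "2 * n \<le> 2 * n * m"
          by simp
        then show False
          using lt True by linarith
      qed
      then show ?thesis
        using True lt low n by (auto simp: g_def coef_g_ham coef_leading)
    next
      case False
      then show ?thesis
        using n by (auto simp: g_def coef_g_ham coef_leading)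
    qed
  qed
  obtain \<phi> N where \<phi>: "canonical \<phi>" "conjugated_by \<phi> (time_one g) (time_one N)" "normal n (u n 0) N"
    by (rule conjugate_to_normal_form[OF n g])
  have n0: "0 < n"
    using n by simp
  have ham: "hord n (n + 3) f" if "qord n (2 * n + 1) (f - leading n (u n 0))" for f
    using hord_mono[OF qord_imp_hord[OF qord_of_leading[OF that]]] n by simp
  have "zero_const (time_one g)" "zero_const (time_one N)"
    using g \<phi>(3) by (intro zero_const_time_one[OF n0] ham; simp add: normal_def)+
  then have "conjugated_by (\<phi> \<circ>\<^sub>f \<psi>) F (time_one N)"
    using \<psi>(2) \<phi>(2) tg
    by (intro conjugated_by_trans[of \<psi> \<phi> F "time_one g"])
      (simp_all add: zero canonicalD[OF \<psi>(1)] canonicalD[OF \<phi>(1)])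
  moreover have "N = h_ham n (u n 0) (\<lambda>k m. coef N k 0 m)"
    by (rule normal_eq_h_ham[OF n0 b \<phi>(3)])
  ultimately show ?thesis
    using canonical_comp[OF \<psi>(1) \<phi>(1)] by metis
qed

section \<open>Hamiltonians conjugate by a canonical map\<close>

text \<open>One weight system for all n \<ge> 3, in which normal forms with different exponents can
  be compared.\<close>

lemma qord_h_ham:
  assumes "3 \<le> n"
  shows "qord 3 6 (h_ham n b u)"
  unfolding ord_ge_def
proof (intro allI impI)
  fix i j m :: nat
  assume lt: "2 * i + 3 * j + 2 * 3 * m < 6"
  then show "coef (h_ham n b u) i j m = 0"
    using assms by (cases m) (auto simp: coef_h_ham coef_leading h_index_iff)
qed

text \<open>At first order the conjugating map commutes with the shear \<open>(x + y, y)\<close>.\<close>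

lemma conjugating_map_linear:
  assumes h: "hord 3 6 h" "coef h 0 2 0 = 1 / 2" and h': "hord 3 6 h'" "coef h' 0 2 0 = 1 / 2"
    and can: "canonical \<Psi>" and tw: "\<Psi> \<circ>\<^sub>f time_one h = time_one h' \<circ>\<^sub>f \<Psi>"
  obtains a where "a * a = 1" "coef (fst \<Psi>) 1 0 0 = a" "coef (snd \<Psi>) 1 0 0 = 0"
    "coef (snd \<Psi>) 0 1 0 = a" "jacobian \<Psi> = 1"
proof -
  have z: "zero_const (time_one h)" "zero_const \<Psi>"
    using zero_const_time_one[of 3 h] h canonicalD[OF can] by simp_all
  define a c e f where ace: "a = coef (fst \<Psi>) 1 0 0" "c = coef (fst \<Psi>) 0 1 0"
    "e = coef (snd \<Psi>) 1 0 0" "f = coef (snd \<Psi>) 0 1 0"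
  note lin = linear_coef_time_one[OF h(1)] linear_coef_time_one[OF h'(1)]
  have eq: "subst (fst \<Psi>) (time_one h) = subst (fst (time_one h')) \<Psi>"
    using tw by (simp add: comp_map_def)
  from arg_cong[OF eq, of "\<lambda>f. coef f 1 0 0"] have e: "e = 0"
    by (simp add: linear_coef_subst z lin h h' ace)
  from arg_cong[OF eq, of "\<lambda>f. coef f 0 1 0"] have f: "f = a"
    by (simp add: linear_coef_subst z lin h h' ace)
  \<comment> \<open>With e = 0 and f = a the determinant is a square, so the Jacobian cannot be
    -1.\<close>
  have jac: "coef (jacobian \<Psi>) 0 0 0 = a * a"
    using e f by (simp add: coef_0_jacobian ace)
  have "jacobian \<Psi> = 1"
  proof (rule ccontr)
    assume "jacobian \<Psi> \<noteq> 1"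
    then have "a * a = - 1"
      using can jac by (auto simp: canonical_def coef_1)
    then show False
      using zero_le_square[of a] by simp
  qed
  moreover from this have "a * a = 1"
    using jac by (simp add: coef_1)
  ultimately show ?thesis
    using e f unfolding ace by (intro that[of "coef (fst \<Psi>) 1 0 0"]) simp_all
qed

text \<open>The pullback of \<open>h'\<close> by \<Psi> generates the same time-one map as
  \<open>h\<close>, which determines it up to functions of the parameter. It has enough order
  because the second component of \<Psi> has no term linear in x alone.\<close>

lemma conjugate_hamiltonians:
  assumes h: "qord 3 6 h" "coef h 0 2 0 = 1 / 2" and h': "qord 3 6 h'" "coef h' 0 2 0 = 1 / 2"
    and can: "canonical \<Psi>" and conj: "conjugated_by \<Psi> (time_one h) (time_one h')"
  obtains a where "a * a = 1" "coef (fst \<Psi>) 1 0 0 = a" "coef (snd \<Psi>) 1 0 0 = 0"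
    "coef (snd \<Psi>) 0 1 0 = a" "jacobian \<Psi> = 1"
    "\<And>i j m. 0 < i + j \<Longrightarrow> coef (subst h' \<Psi>) i j m = coef h i j m"
proof -
  have ord: "hord 3 (3 + 3) h" "hord 3 (3 + 3) h'"
    using qord_imp_hord[OF h(1)] qord_imp_hord[OF h'(1)] by simp_all
  have z\<Psi>: "zero_const \<Psi>"
    by (rule canonicalD[OF can])
  have z: "zero_const (time_one h)" "zero_const (time_one h')"
    by (rule zero_const_time_one[of 3], simp, rule ord)+
  have tw: "\<Psi> \<circ>\<^sub>f time_one h = time_one h' \<circ>\<^sub>f \<Psi>"
    by (rule conjugated_by_intertwine[OF z\<Psi> z conj])
  have ord6: "hord 3 6 h" "hord 3 6 h'"
    using ord by simp_all
  obtain a where a: "a * a = 1" "coef (fst \<Psi>) 1 0 0 = a" "coef (snd \<Psi>) 1 0 0 = 0"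
    "coef (snd \<Psi>) 0 1 0 = a" "jacobian \<Psi> = 1"
    by (rule conjugating_map_linear[OF ord6(1) h(2) ord6(2) h'(2) can tw])
  have "ord_ge 2 3 (2 * 3) 2 (fst \<Psi>)"
    unfolding ord_ge_def
  proof (intro allI impI)
    fix i j m :: nat
    assume "2 * i + 3 * j + 2 * 3 * m < 2"
    then have "i = 0" "j = 0" "m = 0"
      by simp_all
    then show "coef (fst \<Psi>) i j m = 0"
      using z\<Psi> by (simp add: zero_const_def)
  qed
  moreover have "ord_ge 2 3 (2 * 3) 3 (snd \<Psi>)"
    using z\<Psi> a(3) by (simp add: qord_less_3_iff zero_const_def)
  ultimately have "hord 3 (3 + 3) (subst h' \<Psi>)"
    using ord_ge_subst[OF z\<Psi> _ _ h'(1)] qord_imp_hord by simp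
  note sub = this
  obtain \<theta> where \<theta>: "is_inverse \<theta> \<Psi>"
    using conj by (auto simp: conjugated_by_def)
  have "\<Psi> \<circ>\<^sub>f time_one (subst h' \<Psi>) = \<Psi> \<circ>\<^sub>f time_one h"
    unfolding tw by (rule time_one_subst[OF _ ord(2) _ sub z\<Psi> a(5)]) simp_all
  then have "(\<theta> \<circ>\<^sub>f \<Psi>) \<circ>\<^sub>f time_one (subst h' \<Psi>) = (\<theta> \<circ>\<^sub>f \<Psi>) \<circ>\<^sub>f time_one h"
    using z\<Psi> z zero_const_time_one[OF _ sub] by (simp add: comp_map_assoc)
  then have "time_one h = time_one (subst h' \<Psi>)"
    using z zero_const_time_one[OF _ sub] by (simp add: is_inverseD(2)[OF \<theta>])
  then have "hord 3 N (subst h' \<Psi> - h)" for N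
    by (intro time_one_inj ord sub) simp_all
  then have "coef (subst h' \<Psi>) i j m = coef h i j m" if "0 < i + j" for i j m
    using that unfolding hord_def coef_diff by (metis eq_iff_diff_eq_0 lessI)
  with a show ?thesis
    by (intro that) simp_all
qed

text \<open>Weights in which a given monomial of a series becomes leading give its contribution to the
  leading coefficients of powers.\<close>

lemma coef_power_x:
  assumes "coef X 0 0 0 = 0"
  shows "coef (X ^ k) k 0 0 = coef X 1 0 0 ^ k"
proof -
  let ?a = "cst (coef X 1 0 0)"
  have "ord_ge 1 2 2 (1 + 1) (X - ?a * var_x)"
    unfolding ord_ge_def
  proof (intro allI impI)
    fix i j m :: nat
    assume "1 * i + 2 * j + 2 * m < 1 + 1"
    then have "i = 0 \<or> i = 1" "j = 0" "m = 0"
      by auto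
    then show "coef (X - ?a * var_x) i j m = 0"
      using assms by (auto simp: coef_var_x)
  qed
  moreover have "ord_ge 1 2 2 1 X"
    using assms by (auto simp: ord_ge_def)
  ultimately have "ord_ge 1 2 2 (1 * k + 1) (X ^ k - (?a * var_x) ^ k)"
    by (intro ord_ge_power_diff ord_ge_cst_mult ord_ge_var_x)
  then have "coef (X ^ k) k 0 0 = coef ((?a * var_x) ^ k) k 0 0"
    using ord_geD[of 1 2 2 "k + 1" _ k 0 0] by fastforce
  also have "(?a * var_x) ^ k = cst (coef X 1 0 0 ^ k) * monomial k 0 0"
    by (simp add: power_mult_distrib cst_power monomial_def)
  finally show ?thesis
    by (simp add: coef_monomial)
qed

text \<open>In the weights 1, r, r + 1 the leading part of \<open>Y\<close> consists of x^r and y,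
  which share the weight r; the coefficient is the cross term of its square.\<close>

lemma coef_square_xy:
  assumes r: "0 < r" and low: "\<And>i. i < r \<Longrightarrow> coef Y i 0 0 = 0"
  shows "coef (Y ^ 2) r 1 0 = 2 * coef Y r 0 0 * coef Y 0 1 0"
proof -
  let ?L = "cst (coef Y r 0 0) * monomial r 0 0 + cst (coef Y 0 1 0) * monomial 0 1 0"
  have 1: "ord_ge 1 r (r + 1) (r + 1) (Y - ?L)"
    unfolding ord_ge_def
  proof (intro allI impI)
    fix i j m
    assume lt: "1 * i + r * j + (r + 1) * m < r + 1"
    then have m: "m = 0"
      by (cases m) simp_all
    have "j < 2"
    proof (rule ccontr)
      assume "\<not> j < 2"
      then have "r * 2 \<le> r * j"
        by simp
      then show False
        using lt r by linarith
    qed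
    then consider "j = 0" "i \<le> r" | "j = 1" "i = 0"
      using lt m by (auto simp: less_2_cases_iff)
    then show "coef (Y - ?L) i j m = 0"
      by cases (use m r low in \<open>auto simp: coef_monomial le_less\<close>)
  qed
  have 2: "ord_ge 1 r (r + 1) r ?L"
    by (intro ord_ge_add ord_ge_cst_mult ord_ge_monomial) simp_all
  have 3: "ord_ge 1 r (r + 1) r Y"
    using ord_ge_add[OF ord_ge_mono_le[OF 1, of r] 2] by simp
  have "ord_ge 1 r (r + 1) (r * 2 + 1) (Y ^ 2 - ?L ^ 2)"
    by (rule ord_ge_power_diff[OF 3 2 1])
  then have "coef (Y ^ 2) r 1 0 = coef (?L ^ 2) r 1 0"
    using ord_geD[of 1 r "r + 1" "r * 2 + 1" _ r 1 0] by fastforce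
  also have "?L ^ 2 = (cst (coef Y r 0 0) * cst (coef Y r 0 0)) * (monomial r 0 0 * monomial r 0 0) +
      (2 * cst (coef Y r 0 0) * cst (coef Y 0 1 0)) * (monomial r 0 0 * monomial 0 1 0) +
      (cst (coef Y 0 1 0) * cst (coef Y 0 1 0)) * (monomial 0 1 0 * monomial 0 1 0)"
    by (simp add: power2_eq_square algebra_simps)
  also have "\<dots> = cst (coef Y r 0 0 * coef Y r 0 0) * monomial (r + r) 0 0 +
      cst (2 * coef Y r 0 0 * coef Y 0 1 0) * monomial r 1 0 +
      cst (coef Y 0 1 0 * coef Y 0 1 0) * monomial 0 2 0"
    by (simp add: monomial_mult cst_mult cst_numeral)
  finally show ?thesis
    using r by (simp add: coef_monomial)
qed

lemma coef_subst_low: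
  assumes zero: "zero_const \<phi>" and R: "\<And>p q. coef R p q 0 \<noteq> 0 \<Longrightarrow> M \<le> p" and lt: "i + j < M"
  shows "coef (subst R \<phi>) i j 0 = 0"
proof -
  have "coef R p q r * coef (fst \<phi> ^ p * snd \<phi> ^ q * var_eps ^ r) i j 0 = 0" for p q r
  proof (cases "r = 0")
    case True
    show ?thesis
    proof (cases "M \<le> p")
      case le: True
      have "coef (fst \<phi> ^ p * snd \<phi> ^ q * var_eps ^ r) i j 0 = 0"
        by (rule ord_geD[OF zero_const_power[OF zero]]) (use le lt in simp)
      then show ?thesis
        by simp
    next
      case False
      then show ?thesis
        using R[of p q] True by auto
    qed
  next
    case False
    then show ?thesis
      using coef_monomial_mult[of 0 0 r "fst \<phi> ^ p * snd \<phi> ^ q" i j 0]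
      by (simp add: monomial_def mult.commute)
  qed
  then show ?thesis
    unfolding coef_subst[OF zero order_refl] by (intro sum.neutral ballI) simp
qed

text \<open>Comparing the coefficients of \<open>x\<^sup>r y\<close> shows that the second component of the conjugating map
  has no monomials \<open>x\<^sup>r\<close> with \<open>r < n - 1\<close>; the coefficients of \<open>x\<^sup>k\<close> then give \<open>n\<close> and \<open>b\<close>.\<close>

lemma leading_unique:
  assumes n: "3 \<le> n" "3 \<le> n'" and b: "b \<noteq> 0" "b' \<noteq> 0" and zero: "zero_const \<Psi>"
    and a: "a * a = 1" "coef (fst \<Psi>) 1 0 0 = a" "coef (snd \<Psi>) 0 1 0 = a"
    and eq: "\<And>i j m. 0 < i + j \<Longrightarrow> coef (subst (h_ham n' b' u') \<Psi>) i j m = coef (h_ham n b u) i j m"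
  shows "n' = n" "b = b' * a ^ n" "\<And>r. r < n - 1 \<Longrightarrow> coef (snd \<Psi>) r 0 0 = 0"
proof -
  define X Y where XY: "X = fst \<Psi>" "Y = snd \<Psi>"
  define R where "R = cst b' * var_x ^ n' + potential (h_index n') u'"
  define R2 where "R2 = potential (h_index n') u'"
  have a0: "a \<noteq> 0"
    using a(1) by auto
  have x_power: "var_x ^ n' = monomial n' 0 0"
    by (simp add: monomial_def)
  have sub: "subst (h_ham n' b' u') \<Psi> = cst (1 / 2) * Y ^ 2 + subst R \<Psi>"
    by (simp add: h_ham_def R_def subst_add[OF zero] cont_lin_cst[OF cont_lin_subst[OF zero]]
        subst_power[OF zero] subst_var[OF zero] XY)
  have R2: "n' + 1 \<le> p" if "coef R2 p q 0 \<noteq> 0" for p q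
    using that by (auto simp: R2_def coef_potential h_index_iff split: if_splits)
  have R: "n' \<le> p" if "coef R p q 0 \<noteq> 0" for p q
    using that R2[of p q] by (auto simp: R_def R2_def x_power coef_monomial split: if_splits)
  have R_low: "coef (subst R \<Psi>) i j 0 = 0" if "i + j < n'" for i j
    by (rule coef_subst_low[OF zero R that])
  have "coef (subst R2 \<Psi>) n' 0 0 = 0"
    by (rule coef_subst_low[OF zero R2]) simp_all
  then have R_n': "coef (subst R \<Psi>) n' 0 0 = b' * a ^ n'"
    using coef_power_x[of X n'] zero a(2)
    by (simp add: R_def flip: R2_def)
      (simp add: subst_add[OF zero] cont_lin_cst[OF cont_lin_subst[OF zero]]
        subst_power[OF zero] subst_var[OF zero] XY zero_const_def)
  have Y_low: "coef Y r 0 0 = 0" if "r < n' - 1" for r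
    using that
  proof (induction r rule: less_induct)
    case (less r)
    show ?case
    proof (cases "r = 0")
      case True
      then show ?thesis
        using zero by (simp add: zero_const_def XY)
    next
      case False
      \<comment> \<open>Normal forms contain no x^r y, and the substituted potential contributes
        none because r + 1 < n'. Only the square remains, with 2a times the coefficient of x^r in
        Y.\<close>
      have "coef (h_ham n b u) r 1 0 = 0"
        using n by (simp add: coef_h_ham coef_leading)
      moreover have "coef (subst R \<Psi>) r 1 0 = 0"
        by (rule R_low) (use less.prems in simp)
      ultimately have "coef (Y ^ 2) r 1 0 = 0"
        using eq[of r 1 0] by (simp add: sub)
      moreover have "coef (Y ^ 2) r 1 0 = 2 * coef Y r 0 0 * coef Y 0 1 0"
        using False less by (intro coef_square_xy) simp_all
      ultimately show ?thesis
        using a0 a(3) by (simp add: XY)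
    qed
  qed
  \<comment> \<open>The square of Y now starts on the x-axis at degree 2(n' - 1) > n', beyond the
    coefficients to be compared.\<close>
  have "ord_ge 1 (n' - 1) (n' - 1) (n' - 1) Y"
    unfolding ord_ge_def
  proof (intro allI impI)
    fix i j m
    assume lt: "1 * i + (n' - 1) * j + (n' - 1) * m < n' - 1"
    then have "j = 0" "m = 0"
      by (cases j; cases m; simp)+
    then show "coef Y i j m = 0"
      using Y_low lt by simp
  qed
  then have "ord_ge 1 (n' - 1) (n' - 1) ((n' - 1) * 2) (Y ^ 2)"
    by (rule ord_ge_power)
  then have Y2: "coef (Y ^ 2) k 0 0 = 0" if "k \<le> n'" for k
    by (rule ord_geD) (use that n in simp)
  have low: "coef (h_ham n b u) k 0 0 = 0" if "0 < k" "k < n'" for k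
    using eq[of k 0 0] that Y2[of k] R_low[of k 0] by (simp add: sub)
  have top: "coef (h_ham n b u) n' 0 0 = b' * a ^ n'"
    using eq[of n' 0 0] n Y2[of n'] R_n' by (simp add: sub)
  have h_low: "coef (h_ham n b u) k 0 0 = (if k = n then b else 0)" if "k \<le> n" for k
    using that by (auto simp: coef_h_ham coef_leading h_index_iff)
  show nn: "n' = n"
  proof (rule linorder_cases[of n n'])
    assume "n < n'"
    then show ?thesis
      using low[of n] h_low[of n] n b by simp
  next
    assume "n' < n"
    then show ?thesis
      using top h_low[of n'] a0 b by simp
  qed simp
  show "b = b' * a ^ n"
    using top h_low[of n] by (simp add: nn)
  show "coef (snd \<Psi>) r 0 0 = 0" if "r < n - 1" for r
    using Y_low[of r] that by (simp add: nn XY)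
qed

section \<open>Uniqueness up to a simultaneous change of sign of x and y\<close>

lemma subst_scaling: "subst f (lin a 0 0 a) = mk_series (\<lambda>i j m. a ^ (i + j) * coef f i j m)"
proof (rule cont_lin_eqI[of "\<lambda>f. subst f (lin a 0 0 a)"])
  show "cont_lin (\<lambda>f. subst f (lin a 0 0 a))"
    by (rule cont_lin_subst) simp
  show "cont_lin (\<lambda>f. mk_series (\<lambda>i j m. a ^ (i + j) * coef f i j m))"
  proof (rule cont_linI)
    show "\<exists>M. \<forall>f. deg_ge M f \<longrightarrow> deg_ge N (mk_series (\<lambda>i j m. a ^ (i + j) * coef f i j m))" for N
      by (intro exI[of _ N]) (simp add: ord_ge_def)
  qed (rule series_eqI; simp add: distrib_left)+
  fix p q r
  have "subst (monomial p q r) (lin a 0 0 a) = (cst a * var_x) ^ p * (cst a * var_y) ^ q * var_eps ^ r"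
    unfolding subst_monomial[OF zero_const_lin] by (simp add: lin_def)
  also have "\<dots> = cst (a ^ (p + q)) * monomial p q r"
    by (simp add: monomial_def power_mult_distrib cst_power cst_mult power_add mult_ac)
  finally show "subst (monomial p q r) (lin a 0 0 a) =
      mk_series (\<lambda>i j m. a ^ (i + j) * coef (monomial p q r) i j m)"
    by (intro series_eqI) (simp add: coef_monomial)
qed

text \<open>Composing \<Psi> with the sign \<open>S\<close> gives a map \<open>F\<close> that is the
  identity at leading order in the weights for n: by \<open>Y_low\<close> its second component
  contains no x^r of weight at most n. The Hamiltonian of \<open>F\<close> takes the pullback of the
  primed normal form by \<open>S\<close>, again a normal form with leading coefficient b, to the
  unprimed one, up to functions of the parameter.\<close>

lemma conjugate_normal_forms:
  assumes n: "3 \<le> n" and b: "b \<noteq> 0" and zero: "zero_const \<Psi>" and jac: "jacobian \<Psi> = 1"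
    and a: "a * a = 1" "coef (fst \<Psi>) 1 0 0 = a" "coef (snd \<Psi>) 0 1 0 = a"
    and Y_low: "\<And>r. r < n - 1 \<Longrightarrow> coef (snd \<Psi>) r 0 0 = 0" and bb: "b = b' * a ^ n"
    and eq: "\<And>i j m. 0 < i + j \<Longrightarrow> coef (subst (h_ham n b' u') \<Psi>) i j m = coef (h_ham n b u) i j m"
    and ij: "0 < i + j"
  shows "coef (h_ham n b u) i j m = a ^ (i + j) * coef (h_ham n b' u') i j m"
proof -
  let ?h = "h_ham n b u" and ?h' = "h_ham n b' u'"
  define S where "S = lin a 0 0 a"
  define F where "F = S \<circ>\<^sub>f \<Psi>"
  have zS: "zero_const S"
    by (simp add: S_def)
  have n0: "0 < n" and n2: "2 \<le> n"
    using n by simp_all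
  have a_pow: "a ^ k * a ^ k = 1" for k
    using a(1) by (simp add: power_mult_distrib[symmetric])
  have jacF: "jacobian F = 1"
    using a(1) by (simp add: F_def jacobian_comp[OF zero] jac S_def jacobian_lin zero)
  have F: "fst F = cst a * fst \<Psi>" "snd F = cst a * snd \<Psi>"
    by (simp_all add: F_def S_def comp_map_def lin_def subst_add[OF zero]
        cont_lin_cst[OF cont_lin_subst[OF zero]] subst_var[OF zero] cont_lin_0[OF cont_lin_subst[OF zero]])
  have "qord n (2 + 1) (fst F - var_x)"
    unfolding ord_ge_def
  proof (intro allI impI)
    fix i j m
    assume lt: "2 * i + n * j + 2 * n * m < 2 + 1"
    have "j = 0"
      using lt n by (cases j) simp_all
    moreover have "m = 0"
      using lt n by (cases m) simp_all
    moreover have "i = 0 \<or> i = 1"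
      using lt by auto
    ultimately show "coef (fst F - var_x) i j m = 0"
      using a(1,2) zero by (auto simp: F coef_var_x zero_const_def)
  qed
  moreover have "qord n (n + 1) (snd F - var_y)"
    unfolding ord_ge_def
  proof (intro allI impI)
    fix i j m
    assume lt: "2 * i + n * j + 2 * n * m < n + 1"
    have m: "m = 0"
      using lt n by (cases m) simp_all
    have "j < 2"
    proof (rule ccontr)
      assume "\<not> j < 2"
      then have "n * 2 \<le> n * j"
        by simp
      then show False
        using lt n by linarith
    qed
    then consider "j = 0" "i < n - 1" | "j = 1" "i = 0"
      using lt m n by (auto simp: less_2_cases_iff)
    then show "coef (snd F - var_y) i j m = 0"
      by cases (use m a Y_low in \<open>auto simp: F coef_var_y\<close>)
  qed
  ultimately obtain \<chi> where \<chi>: "hord n (n + 2 + 1) \<chi>" "time_one \<chi> = F"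
    using interpolating_hamiltonian[OF n0 jacF, of 1] by auto
  have \<chi>3: "hord n (n + 3) \<chi>"
    using \<chi>(1) by (auto elim: hord_mono)
  define h where "h = subst ?h' S"
  have coef_h: "coef h i j m = a ^ (i + j) * coef ?h' i j m" for i j m
    by (simp add: h_def S_def subst_scaling)
  have "h = h_ham n b (\<lambda>k m. a ^ k * u' k m)"
    using a(1) by (intro series_eqI) (auto simp: coef_h coef_h_ham coef_leading bb power2_eq_square
        distrib_left)
  then have norm_h: "normal n b h"
    using normal_h_ham[OF n0] by simp
  have "h = mk_series (\<lambda>i j m. a ^ (i + j) * coef ?h' i j m)"
    by (simp add: h_def S_def subst_scaling)
  then have "subst h S = ?h'"
    by (intro series_eqI) (simp add: S_def subst_scaling mult.assoc[symmetric] a_pow)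
  then have "exp_lie \<chi> h = subst ?h' \<Psi>"
    unfolding exp_lie_eq_subst[OF n0 \<chi>3] \<chi>(2) F_def
    by (simp flip: subst_subst[OF zS zero])
  then have "coef (exp_lie \<chi> h) i j m = coef ?h i j m" if "0 < i + j" for i j m
    using eq that by simp
  from normal_form_unique[OF n2 b norm_h normal_h_ham[OF n0] \<chi>3 this ij] show ?thesis
    by (simp add: coef_h)
qed

text \<open>The sign cannot be avoided: the map (-x, -y) is canonical and turns the potential U(x)
  into U(-x). The bound k \<ge> 1 leaves out the pure powers of \<epsilon>, which do not affect the
  map.\<close>

lemma h_ham_unique:
  assumes zero: "zero_const F" and n: "3 \<le> n" "3 \<le> n'" and b: "b \<noteq> 0" "b' \<noteq> 0"
    and \<phi>: "canonical \<phi>" "conjugated_by \<phi> F (time_one (h_ham n b u))"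
    and \<phi>': "canonical \<phi>'" "conjugated_by \<phi>' F (time_one (h_ham n' b' u'))"
  shows "n' = n \<and> (\<exists>\<sigma>\<in>{1, - 1}. b' = \<sigma> ^ n * b \<and>
    (\<forall>(k, m)\<in>h_index n. k \<ge> 1 \<longrightarrow> u' k m = \<sigma> ^ k * u k m))"
proof -
  let ?h = "h_ham n b u" and ?h' = "h_ham n' b' u'"
  have z: "zero_const (time_one (h_ham n b u))" if "3 \<le> n" for n b u
    using qord_imp_hord[OF qord_h_ham[OF that]] by (intro zero_const_time_one[of 3]) simp_all
  obtain \<theta> where \<theta>: "is_inverse \<theta> \<phi>" "conjugated_by \<theta> (time_one ?h) F"
    by (rule conjugated_by_inverse[OF canonicalD[OF \<phi>(1)] zero z[OF n(1)] \<phi>(2)])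
  define \<Psi> where "\<Psi> = \<phi>' \<circ>\<^sub>f \<theta>"
  have can: "canonical \<Psi>"
    unfolding \<Psi>_def by (rule canonical_comp[OF canonical_inverse[OF \<phi>(1) \<theta>(1)] \<phi>'(1)])
  have conj: "conjugated_by \<Psi> (time_one ?h) (time_one ?h')"
    unfolding \<Psi>_def
    by (rule conjugated_by_trans[OF is_inverseD(1)[OF \<theta>(1)] canonicalD[OF \<phi>'(1)] z[OF n(1)] zero
          z[OF n(2)] \<theta>(2) \<phi>'(2)])
  have half: "coef (h_ham n b u) 0 2 0 = 1 / 2" for n b u
    by (simp add: coef_h_ham coef_leading)
  obtain a where a: "a * a = 1" "coef (fst \<Psi>) 1 0 0 = a" "coef (snd \<Psi>) 1 0 0 = 0"
    "coef (snd \<Psi>) 0 1 0 = a" "jacobian \<Psi> = 1"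
    and eq: "\<And>i j m. 0 < i + j \<Longrightarrow> coef (subst ?h' \<Psi>) i j m = coef ?h i j m"
    using conjugate_hamiltonians[OF qord_h_ham[OF n(1)] half qord_h_ham[OF n(2)] half can conj] by metis
  note lead = leading_unique[OF n b canonicalD[OF can] a(1,2,4) eq]
  have nn: "n' = n"
    by (rule lead(1))
  have a_sq: "a ^ k * (a ^ k * x) = x" for k x
    using a(1) by (simp add: mult.assoc[symmetric] power_mult_distrib[symmetric])
  have "a \<in> {1, - 1}"
    using a(1) by (simp add: square_eq_1_iff)
  moreover have "b' = a ^ n * b"
    by (metis a_sq lead(2) mult.commute)
  moreover have "u' k m = a ^ k * u k m" if k: "(k, m) \<in> h_index n" "1 \<le> k" for k m
  proof -
    have "coef ?h k 0 m = a ^ (k + 0) * coef (h_ham n b' u') k 0 m"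
      using conjugate_normal_forms[OF n(1) b(1) canonicalD[OF can] a(5,1,2,4) lead(3,2), of u' u k 0 m]
        eq k(2) by (simp add: nn)
    moreover have "\<not> (k = n \<and> m = 0)"
      using k(1) by (auto simp: h_index_iff)
    ultimately have "u k m = a ^ k * u' k m"
      using k(1) by (auto simp: coef_h_ham coef_leading)
    then show ?thesis
      by (simp add: a_sq)
  qed
  ultimately show ?thesis
    using nn by blast
qed

theorem theorem2:
  fixes F :: fmap
  assumes "jacobian F = 1"
    and "zero_const F"
    and "order 1 (char_poly (linear_part F)) = 2"
    and "\<not> diagonalisable (linear_part F)"
  shows
    "(\<exists>\<psi> u0. canonical \<psi> \<and> conjugated_by \<psi> F (time_one (g_ham u0)))
     \<and> (\<forall>\<psi> u0 n.
          canonical \<psi> \<and> conjugated_by \<psi> F (time_one (g_ham u0)) \<and>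
          n \<ge> 3 \<and> (\<forall>k. 3 \<le> k \<and> k < n \<longrightarrow> u0 k 0 = 0) \<and> u0 n 0 \<noteq> 0 \<longrightarrow>
          (\<exists>\<phi> u. canonical \<phi> \<and> conjugated_by \<phi> F (time_one (h_ham n (u0 n 0) u))))
     \<and> (\<forall>n b u \<phi> n' b' u' \<phi>'.
          n \<ge> 3 \<and> b \<noteq> 0 \<and> canonical \<phi> \<and> conjugated_by \<phi> F (time_one (h_ham n b u)) \<and>
          n' \<ge> 3 \<and> b' \<noteq> 0 \<and> canonical \<phi>' \<and> conjugated_by \<phi>' F (time_one (h_ham n' b' u')) \<longrightarrow>
          n' = n \<and>
          (\<exists>\<sigma>\<in>{1, - 1}. b' = \<sigma> ^ n * b \<and>
             (\<forall>(k, m)\<in>h_index n. k \<ge> 1 \<longrightarrow> u' k m = \<sigma> ^ k * u k m)))"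
proof (intro conjI allI impI; (elim conjE)?)
  show "\<exists>\<psi> u0. canonical \<psi> \<and> conjugated_by \<psi> F (time_one (g_ham u0))"
    by (rule existence_g_ham[OF assms])
next
  fix \<psi> u0 n
  assume "canonical \<psi>" "conjugated_by \<psi> F (time_one (g_ham u0))" "3 \<le> n"
    "\<forall>k. 3 \<le> k \<and> k < n \<longrightarrow> u0 k 0 = 0" "u0 n 0 \<noteq> 0"
  then show "\<exists>\<phi> u. canonical \<phi> \<and> conjugated_by \<phi> F (time_one (h_ham n (u0 n 0) u))"
    by (intro existence_h_ham[OF assms(2)]) simp_all
next
  fix n b u \<phi> n' b' u' \<phi>'
  assume "3 \<le> n" "b \<noteq> 0" "canonical \<phi>" "conjugated_by \<phi> F (time_one (h_ham n b u))"
    "3 \<le> n'" "b' \<noteq> 0" "canonical \<phi>'" "conjugated_by \<phi>' F (time_one (h_ham n' b' u'))"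
  note unique = h_ham_unique[OF assms(2) this(1,5,2,6,3,4,7,8)]
  then show "n' = n"
    by blast
  from unique show "\<exists>\<sigma>\<in>{1, - 1}. b' = \<sigma> ^ n * b \<and>
      (\<forall>(k, m)\<in>h_index n. k \<ge> 1 \<longrightarrow> u' k m = \<sigma> ^ k * u k m)"
    by blast
qed

end
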